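(* Let $n\ge 3$ and let $\mathbb{M}^n$ be a Cartan-Hadamard model manifold associated to a function $\psi$ with $\Theta\in L^1(\mathbb{R}^+)$. Let $p,q>0$ satisfy $\frac{1}{p+1}+\frac{1}{q+1}\le\frac{n-2}{n}$. Then there exist two functions $\eta_m,\eta_M$, which are continuous and strictly increasing bijections of $(0,+\infty)$ into itself, satisfying $$\eta_m(\xi)<\eta_M(\xi)\quad\forall\xi>0,\qquad \limsup_{\xi\to+\infty}\left[\eta_M(\xi)-\eta_m(\xi)\right]<+\infty,$$ such that for each $\xi>0$ the Cauchy problem $CP(\xi,\eta)$ admits a globally positive solution $(u,v)$ if and only if $\eta_m(\xi)\le\eta\le\eta_M(\xi)$. In addition, writing $\ell_u:=\lim_{r\to+\infty}u(r)$ and $\ell_v:=\lim_{r\to+\infty}v(r)$, the following holds: (a) if $\eta=\eta_m(\xi)$ then $\ell_u>0$ and $\ell_v=0$; (b) if $\eta_m(\xi)<\eta<\eta_M(\xi)$ then $\ell_u>0$ and $\ell_v>0$; (c) if $\eta=\eta_M(\xi)$ then $\ell_u=0$ and $\ell_v>0$.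
   Context: A (noncompact) model manifold $\mathbb{M}^n$ associated to $\psi$ is a Riemannian manifold whose metric, in global polar coordinates $(r,\vartheta)\in\mathbb{R}^+\times\mathbb{S}^{n-1}$ about a pole $o$, is $g=dr\otimes dr+\psi^2(r)\,g_{\mathbb{S}^{n-1}}$, where $\psi\in C^1([0,+\infty))\cap C^\infty((0,+\infty))$, $\psi>0$ on $(0,+\infty)$, $\psi(0)=0$, $\psi'(0)=1$. It is Cartan-Hadamard if and only if $\psi$ is in addition convex. Set $\Theta(r):=\frac{1}{\psi^{n-1}(r)}\int_0^r\psi^{n-1}\,ds$ for $r>0$. For $(\xi,\eta)\in(0,+\infty)^2$, $CP(\xi,\eta)$ denotes the Cauchy problem for functions $u,v$ of $r$ (of class $C^1$ up to $r=0$ and $C^2$ for $r>0$) $$(\psi^{n-1}u')'+\psi^{n-1}|v|^{q-1}v=0,\quad (\psi^{n-1}v')'+\psi^{n-1}|u|^{p-1}u=0\ \ (r>0),\quad u'(0)=v'(0)=0,\ u(0)=\xi,\ v(0)=\eta.$$ A globally positive solution is a solution defined for every $r>0$ with $u,v>0$ on $[0,+\infty)$; its components are decreasing, so the limits at infinity exist. *)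

theory Defs
  imports "HOL-Analysis.Analysis"
begin

(* Functions of the radial variable r are represented by total functions on the reals;
   their values at negative r are never constrained. *)

(* f is of class C^1 on S with derivative f'. The derivative is taken within S,
   so it is one-sided at an endpoint of S. *)
definition C1_with_deriv :: "real set \<Rightarrow> (real \<Rightarrow> real) \<Rightarrow> (real \<Rightarrow> real) \<Rightarrow> bool" where
  "C1_with_deriv S f f' \<longleftrightarrow>
     (\<forall>r\<in>S. (f has_real_derivative f' r) (at r within S)) \<and> continuous_on S f'"

(* The functions psi for which dr^2 + psi(r)^2 g_{S^{n-1}} is the metric of a noncompact
   model manifold. The second conjunct is smoothness on (0,infinity): every iterated
   derivative is differentiable at every r > 0. *)
definition model_function :: "(real \<Rightarrow> real) \<Rightarrow> bool" where
  "model_function \<psi> \<longleftrightarrow>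
     (\<exists>\<psi>'. C1_with_deriv {0..} \<psi> \<psi>' \<and> \<psi>' 0 = 1) \<and>
     (\<forall>k. \<forall>r>0. ((deriv ^^ k) \<psi>) differentiable (at r)) \<and>
     (\<forall>r>0. \<psi> r > 0) \<and> \<psi> 0 = 0"

(* A model manifold enters the analysis only through its dimension and psi. Its sectional
   curvatures are -psi''/psi and (1 - psi'^2)/psi^2, so it is Cartan-Hadamard iff psi is convex. *)
definition cartan_hadamard_model :: "(real \<Rightarrow> real) \<Rightarrow> bool" where
  "cartan_hadamard_model \<psi> \<longleftrightarrow> model_function \<psi> \<and> convex_on {0..} \<psi>"

definition Theta :: "nat \<Rightarrow> (real \<Rightarrow> real) \<Rightarrow> real \<Rightarrow> real" where
  "Theta n \<psi> r = 1 / \<psi> r ^ (n - 1) * (LBINT s:{0..r}. \<psi> s ^ (n - 1))"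

(* (u,v) solves CP(xi,eta) on the whole half-line [0,infinity). *)
definition CP_global_solution ::
  "nat \<Rightarrow> (real \<Rightarrow> real) \<Rightarrow> real \<Rightarrow> real \<Rightarrow> real \<Rightarrow> real \<Rightarrow> (real \<Rightarrow> real) \<Rightarrow> (real \<Rightarrow> real) \<Rightarrow> bool" where
  "CP_global_solution n \<psi> p q \<xi> \<eta> u v \<longleftrightarrow>
     (\<exists>u' v' u'' v''.
        C1_with_deriv {0..} u u' \<and> C1_with_deriv {0<..} u' u'' \<and>
        C1_with_deriv {0..} v v' \<and> C1_with_deriv {0<..} v' v'' \<and>
        (\<forall>r>0. (\<lambda>s. \<psi> s ^ (n - 1) * u' s) differentiable (at r) \<and>
               deriv (\<lambda>s. \<psi> s ^ (n - 1) * u' s) r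
                 + \<psi> r ^ (n - 1) * \<bar>v r\<bar> powr (q - 1) * v r = 0) \<and>
        (\<forall>r>0. (\<lambda>s. \<psi> s ^ (n - 1) * v' s) differentiable (at r) \<and>
               deriv (\<lambda>s. \<psi> s ^ (n - 1) * v' s) r
                 + \<psi> r ^ (n - 1) * \<bar>u r\<bar> powr (p - 1) * u r = 0) \<and>
        u' 0 = 0 \<and> v' 0 = 0) \<and>
     u 0 = \<xi> \<and> v 0 = \<eta>"

definition globally_positive_solution ::
  "nat \<Rightarrow> (real \<Rightarrow> real) \<Rightarrow> real \<Rightarrow> real \<Rightarrow> real \<Rightarrow> real \<Rightarrow> (real \<Rightarrow> real) \<Rightarrow> (real \<Rightarrow> real) \<Rightarrow> bool" where
  "globally_positive_solution n \<psi> p q \<xi> \<eta> u v \<longleftrightarrow>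
     CP_global_solution n \<psi> p q \<xi> \<eta> u v \<and> (\<forall>r\<ge>0. u r > 0 \<and> v r > 0)"

end

theory Submission
  imports Defs
begin

text \<open>
Integrating twice turns the Cauchy problem into \<open>u = \<xi> - \<integral>(1/w)\<integral>w v\<^sup>q\<close>, \<open>v = \<eta> - \<integral>(1/w)\<integral>w u\<^sup>p\<close> with
\<open>w = \<psi>\<^bsup>n-1\<^esup>\<close>. With the nonlinearities cut off at \<open>0\<close> this system is monotone for the order in which \<open>u\<close>
grows and \<open>v\<close> shrinks. Monotone iteration gives a global solution for all data; it is unique, depends
continuously and monotonically on \<open>(\<xi>, \<eta>)\<close>, and has finite limits because \<open>\<Theta>\<close> is integrable. It is
positive iff both limits are nonnegative, so \<open>\<eta>\<^sub>M\<close> and \<open>\<eta>\<^sub>m\<close> are the zero curves of the limits of \<open>u\<close> and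
\<open>v\<close>.

Convexity of \<open>\<psi>\<close> makes a Pohozaev function nonincreasing, which excludes that \<open>u\<close> and \<open>v\<close> vanish
together at a finite radius; shooting in \<open>\<eta>\<close> then gives \<open>\<eta>\<^sub>m \<le> \<eta>\<^sub>M\<close>. Equality would give a solution with
both limits \<open>0\<close>. For it the Pohozaev function stays below a negative constant near infinity. Since the product
of the exponents exceeds \<open>1\<close>, one of the inequalities \<open>v\<^sup>q \<le> u\<close>, \<open>u\<^sup>p \<le> v\<close> eventually persists, and then one
component decays like the radial Green function, which forces the Pohozaev function to approach \<open>0\<close> along a
sequence. Finally \<open>\<eta>\<^sub>M - \<eta>\<^sub>m\<close> is at most the limit of \<open>v\<close> at \<open>\<eta> = \<eta>\<^sub>M\<close>, which is bounded independently of
the data because \<open>-u' \<ge> \<Theta> v\<^sup>q\<close>, \<open>-v' \<ge> \<Theta> u\<^sup>p\<close> is superlinear on an interval of \<open>\<Theta>\<close>-length \<open>\<integral>\<Theta>\<close>.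
\<close>

section \<open>Calculus on the half-line\<close>

text \<open>Exponents below 1 are allowed, so the powers need not be Lipschitz at 0, and neither
  Picard iteration nor Gronwall can be used up to a zero of a component. Order therefore comes
  first: the iteration yields an extremal solution, any other solution is compared with this one,
  and Gronwall is applied only where the smaller components stay positive. Behind the first zero a
  truncated power vanishes and the system decouples. Continuity in the data needs no estimate
  either: monotone limits of solutions are solutions, and uniqueness identifies them.

  Truncation changes no positive solution but gives every datum limits at infinity, so that
  positivity becomes the sign of two numbers.

  The geometry is condensed in \<open>radial_weight\<close> with \<open>\<kappa> = 1/n\<close>; the
  critical hyperbola reads \<open>1/(p+1) + 1/(q+1) = 1 - 2 * \<kappa>\<close>. For the flat weight
  the Pohozaev function is constant on that hyperbola, which is why excluding two zero limits has to
  use the integrability of \<open>\<Theta>\<close>. Exchanging \<open>(p, \<xi>, u)\<close> with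
  \<open>(q, \<eta>, v)\<close> is a symmetry, so most statements concern \<open>u\<close>
  alone.\<close>

lemma nondecreasing_of_deriv:
  fixes f D :: "real \<Rightarrow> real"
  assumes "a \<le> b" "continuous_on {a..b} f"
    and "\<And>x. a < x \<Longrightarrow> x < b \<Longrightarrow> (f has_real_derivative D x) (at x)"
    and "\<And>x. a < x \<Longrightarrow> x < b \<Longrightarrow> 0 \<le> D x"
  shows "f a \<le> f b"
proof (cases "a = b")
  case False
  then have "a < b" using assms(1) by simp
  then show ?thesis
    using DERIV_nonneg_imp_increasing_open[of a b f] assms by blast
qed simp

lemma nonincreasing_of_deriv:
  fixes f D :: "real \<Rightarrow> real"
  assumes "a \<le> b" "continuous_on {a..b} f"
    and "\<And>x. a < x \<Longrightarrow> x < b \<Longrightarrow> (f has_real_derivative D x) (at x)"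
    and "\<And>x. a < x \<Longrightarrow> x < b \<Longrightarrow> D x \<le> 0"
  shows "f b \<le> f a"
  using nondecreasing_of_deriv[of a b "\<lambda>x. - f x" "\<lambda>x. - D x"] assms
  by (force intro!: continuous_intros derivative_intros)

lemma at_within_Ici_eq:
  fixes x a b :: real
  assumes "x < b"
  shows "at x within {a..} = at x within {a..b}"
  by (rule at_within_nhd[where S = "{..<b}"]) (use assms in auto)

lemma continuous_on_Ici:
  fixes f :: "real \<Rightarrow> real"
  assumes "\<And>b. a \<le> b \<Longrightarrow> continuous_on {a..b} f"
  shows "continuous_on {a..} f"
  unfolding continuous_on_eq_continuous_within
proof
  fix x assume "x \<in> {a..}"
  then have "continuous (at x within {a..x+1}) f"
    using assms[of "x+1"] by (simp add: continuous_on_eq_continuous_within)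
  then show "continuous (at x within {a..}) f"
    using at_within_Ici_eq[of x "x+1" a] by simp
qed

lemma DERIV_of_within_Ici:
  fixes x a :: real
  assumes "(f has_real_derivative D) (at x within {a..})" "a < x"
  shows "(f has_real_derivative D) (at x)"
proof -
  have "at x within {a..} = at x"
    by (rule at_within_interior) (use assms in simp)
  then show ?thesis using assms by simp
qed

section \<open>Powers truncated at zero\<close>

definition pw :: "real \<Rightarrow> real \<Rightarrow> real" where
  "pw p x = max 0 x powr p"

lemma pw_nonneg [simp]: "0 \<le> pw p x"
  by (simp add: pw_def)

text \<open>Rests on the convention \<open>0 powr p = 0\<close>, valid for every
  \<open>p\<close>.\<close>

lemma pw_nonpos [simp]: "x \<le> 0 \<Longrightarrow> pw p x = 0"
  by (simp add: pw_def max_def)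

lemma pw_pos_eq: "0 \<le> x \<Longrightarrow> pw p x = x powr p"
  by (simp add: pw_def max_def)

lemma pw_pos: "0 < x \<Longrightarrow> 0 < pw p x"
  by (simp add: pw_def max_def)

lemma pw_mono: "0 \<le> p \<Longrightarrow> x \<le> y \<Longrightarrow> pw p x \<le> pw p y"
  unfolding pw_def by (intro powr_mono2) auto

lemma pw_strict_mono: "0 < p \<Longrightarrow> x < y \<Longrightarrow> 0 < y \<Longrightarrow> pw p x < pw p y"
  unfolding pw_def by (intro powr_less_mono2) auto

lemma continuous_pw: "0 < p \<Longrightarrow> continuous_on A (pw p)"
  unfolding pw_def by (intro continuous_on_powr' continuous_intros) auto

lemma tendsto_pw:
  assumes "0 < p" "(f \<longlongrightarrow> l) F"
  shows "((\<lambda>x. pw p (f x)) \<longlongrightarrow> pw p l) F"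
  using continuous_on_tendsto_compose[OF continuous_pw[OF assms(1), of UNIV] assms(2)] by simp

text \<open>The derivative \<open>p * x powr (p - 1)\<close> is bounded on a compact interval away
  from \<open>0\<close>; for \<open>p < 1\<close> no constant would serve down to \<open>0\<close>.
  Later uses compare ordered pairs, so no absolute values appear.\<close>

lemma pw_lipschitz:
  assumes "0 < m"
  obtains L where "0 < L" "\<And>x y. m \<le> x \<Longrightarrow> x \<le> y \<Longrightarrow> y \<le> M \<Longrightarrow> pw p y - pw p x \<le> L * (y - x)"
proof -
  have cont: "continuous_on {m..M} (\<lambda>x. \<bar>p * x powr (p - 1)\<bar>)"
    using assms by (intro continuous_intros) auto
  have "bounded ((\<lambda>x. \<bar>p * x powr (p - 1)\<bar>) ` {m..M})"
    by (intro compact_imp_bounded compact_continuous_image cont) simp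
  then obtain L where L: "0 < L" "\<And>x. x \<in> {m..M} \<Longrightarrow> \<bar>p * x powr (p - 1)\<bar> \<le> L"
    unfolding bounded_pos by auto
  show thesis
  proof (rule that[OF L(1)])
    fix x y assume xy: "m \<le> x" "x \<le> y" "y \<le> M"
    have "x powr p - L * x \<ge> y powr p - L * y"
    proof (rule nonincreasing_of_deriv[where f = "\<lambda>x. x powr p - L * x" and D = "\<lambda>x. p * x powr (p - 1) - L"])
      show "continuous_on {x..y} (\<lambda>x. x powr p - L * x)"
        using xy assms by (intro continuous_intros) auto
      fix z assume z: "x < z" "z < y"
      show "((\<lambda>x. x powr p - L * x) has_real_derivative p * z powr (p - 1) - L) (at z)"
        using z xy assms by (auto intro!: derivative_eq_intros)
      show "p * z powr (p - 1) - L \<le> 0"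
        using L(2)[of z] z xy by auto
    qed (use xy in auto)
    then show "pw p y - pw p x \<le> L * (y - x)"
      using xy assms by (simp add: pw_pos_eq algebra_simps)
  qed
qed

section \<open>Radial weights\<close>

text \<open>\<open>w\<close> stands for \<open>\<psi> ^ (n - 1)\<close>, the area density of
  geodesic spheres, and \<open>\<kappa>\<close> for \<open>1/n\<close>, so
  \<open>\<kappa> < 1/2\<close> encodes \<open>n \<ge> 3\<close>. \<open>curvature\<close> compares
  the growth of spheres with that of balls and is an equality for the Euclidean weight. Convexity of
  \<open>\<psi>\<close> enters through \<open>w_mono\<close> and \<open>curvature\<close>.\<close>

locale radial_weight =
  fixes w w' :: "real \<Rightarrow> real" and \<kappa> :: real
  assumes w_cont: "continuous_on {0..} w"
    and w_zero: "w 0 = 0"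
    and w_pos: "0 < r \<Longrightarrow> 0 < w r"
    and w_mono: "0 \<le> r \<Longrightarrow> r \<le> s \<Longrightarrow> w r \<le> w s"
    and w_deriv: "0 < r \<Longrightarrow> (w has_real_derivative w' r) (at r)"
    and w'_cont: "continuous_on {0<..} w'"
    and \<kappa>_pos: "0 < \<kappa>" and \<kappa>_less: "\<kappa> < 1/2"
    and curvature: "0 < r \<Longrightarrow> (1 - \<kappa>) * (w r)\<^sup>2 \<le> w' r * integral {0..r} w"
    and theta_bounded: "\<exists>B. \<forall>r\<ge>0. integral {0..r} (\<lambda>s. integral {0..s} w / w s) \<le> B"
begin

definition mass :: "(real \<Rightarrow> real) \<Rightarrow> real \<Rightarrow> real" where
  "mass h r = integral {0..r} (\<lambda>t. w t * h t)"

definition flux :: "(real \<Rightarrow> real) \<Rightarrow> real \<Rightarrow> real" where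
  "flux h r = mass h r / w r"

text \<open>For continuous \<open>h\<close>, the radial solution \<open>f\<close> of
  \<open>(w f')' = w h\<close> with \<open>f(0) = f'(0) = 0\<close>; its derivative is
  \<open>flux h\<close>.\<close>

definition pot :: "(real \<Rightarrow> real) \<Rightarrow> real \<Rightarrow> real" where
  "pot h r = integral {0..r} (flux h)"

text \<open>Boundedness and integrability, but not continuity: the limits of the monotone iteration
  are at first known only pointwise.\<close>

definition adm :: "(real \<Rightarrow> real) \<Rightarrow> bool" where
  "adm h \<longleftrightarrow> (\<forall>r. (\<lambda>t. w t * h t) integrable_on {0..r}) \<and> (\<exists>B. \<forall>t\<ge>0. \<bar>h t\<bar> \<le> B)"

abbreviation W :: "real \<Rightarrow> real" where "W \<equiv> mass (\<lambda>_. 1)"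
abbreviation \<Theta> :: "real \<Rightarrow> real" where "\<Theta> \<equiv> flux (\<lambda>_. 1)"
abbreviation T :: "real \<Rightarrow> real" where "T \<equiv> pot (\<lambda>_. 1)"

lemma w_nonneg: "0 \<le> r \<Longrightarrow> 0 \<le> w r"
  using w_pos[of r] w_zero by (cases "r = 0") auto

lemma adm_continuous:
  assumes "continuous_on {0..} h" "\<And>t. 0 \<le> t \<Longrightarrow> \<bar>h t\<bar> \<le> B"
  shows "adm h"
  unfolding adm_def
proof safe
  fix r :: real
  show "(\<lambda>t. w t * h t) integrable_on {0..r}"
    by (intro integrable_continuous_interval continuous_intros
        continuous_on_subset[OF w_cont] continuous_on_subset[OF assms(1)]) auto
qed (use assms in blast)

lemma adm_const [simp]: "adm (\<lambda>_. c)"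
  by (rule adm_continuous[where B = "\<bar>c\<bar>"]) auto

lemma adm_integrable: "adm h \<Longrightarrow> (\<lambda>t. w t * h t) integrable_on {0..r}"
  by (simp add: adm_def)

lemma adm_minus:
  assumes "adm h" "adm k"
  shows "adm (\<lambda>t. h t - k t)"
proof -
  obtain B C where "\<forall>t\<ge>0. \<bar>h t\<bar> \<le> B" "\<forall>t\<ge>0. \<bar>k t\<bar> \<le> C"
    using assms by (auto simp: adm_def)
  then have "\<forall>t\<ge>0. \<bar>h t - k t\<bar> \<le> B + C"
    by (smt (verit, best))
  moreover have "(\<lambda>t. w t * h t - w t * k t) integrable_on {0..r}" for r
    using assms by (intro integrable_diff) (auto simp: adm_def)
  ultimately show ?thesis
    unfolding adm_def by (auto simp: algebra_simps)
qed

lemma mass_0 [simp]: "mass h 0 = 0"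
  by (simp add: mass_def)

lemma flux_0 [simp]: "flux h 0 = 0"
  by (simp add: flux_def)

lemma pot_0 [simp]: "pot h 0 = 0"
  by (simp add: pot_def)

lemma mass_mono:
  assumes "adm h" "adm k" "\<And>t. 0 \<le> t \<Longrightarrow> t \<le> r \<Longrightarrow> h t \<le> k t"
  shows "mass h r \<le> mass k r"
  unfolding mass_def
  by (intro integral_le adm_integrable assms mult_left_mono w_nonneg) auto

lemma mass_cmult: "mass (\<lambda>t. c * h t) r = c * mass h r"
proof -
  have "mass (\<lambda>t. c * h t) r = integral {0..r} (\<lambda>t. c * (w t * h t))"
    by (simp add: mass_def algebra_simps)
  also have "\<dots> = c * mass h r" by (simp add: mass_def)
  finally show ?thesis .
qed

lemma mass_diff: "adm h \<Longrightarrow> adm k \<Longrightarrow> mass (\<lambda>t. h t - k t) r = mass h r - mass k r"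
  using integral_diff[OF adm_integrable adm_integrable, of h k r]
  by (simp add: mass_def right_diff_distrib)

lemma mass_const: "mass (\<lambda>_. c) r = c * W r"
  using mass_cmult[of c "\<lambda>_. 1"] by simp

lemma mass_nonneg: "adm h \<Longrightarrow> (\<And>t. 0 \<le> t \<Longrightarrow> 0 \<le> h t) \<Longrightarrow> 0 \<le> mass h r"
  using mass_mono[of "\<lambda>_. 0" h r] by (simp add: mass_def)

lemma mass_cong: "(\<And>t. 0 \<le> t \<Longrightarrow> t \<le> r \<Longrightarrow> h t = k t) \<Longrightarrow> mass h r = mass k r"
  unfolding mass_def by (rule integral_cong) auto

lemma mass_abs_le:
  assumes "adm h" "\<And>t. 0 \<le> t \<Longrightarrow> t \<le> r \<Longrightarrow> \<bar>h t\<bar> \<le> B"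
  shows "\<bar>mass h r\<bar> \<le> B * W r"
proof -
  have "mass h r \<le> mass (\<lambda>_. B) r" "mass (\<lambda>_. - B) r \<le> mass h r"
    using assms by (intro mass_mono; force simp: abs_le_iff)+
  then show ?thesis by (simp add: mass_const[of B] mass_const[of "- B"] abs_le_iff)
qed

lemma mass_cont: "adm h \<Longrightarrow> continuous_on {0..} (mass h)"
  unfolding mass_def
  by (intro continuous_on_Ici indefinite_integral_continuous_1) (auto simp: adm_def)

lemma mass_has_derivative:
  assumes h: "continuous_on {0..} h" and r: "0 < r"
  shows "(mass h has_real_derivative w r * h r) (at r)"
proof -
  have "((\<lambda>x. integral {0..x} (\<lambda>t. w t * h t)) has_real_derivative w r * h r) (at r within {0..r+1})"
    using r by (intro integral_has_real_derivative continuous_intros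
        continuous_on_subset[OF w_cont] continuous_on_subset[OF h]) auto
  then have "(mass h has_real_derivative w r * h r) (at r within {0..})"
    using at_within_Ici_eq[of r "r+1" 0] by (simp add: mass_def[abs_def])
  then show ?thesis using r by (rule DERIV_of_within_Ici)
qed

lemma W_nonneg: "0 \<le> W r"
  by (rule mass_nonneg) auto

lemma W_deriv: "0 < r \<Longrightarrow> (W has_real_derivative w r) (at r)"
  using mass_has_derivative[of "\<lambda>_. 1" r] by simp

lemma W_le:
  assumes r: "0 \<le> r"
  shows "W r \<le> r * w r"
proof -
  have "W r \<le> integral {0..r} (\<lambda>t. w r)"
    unfolding mass_def using r adm_integrable[OF adm_const[of 1]]
    by (intro integral_le) (auto intro!: w_mono)
  then show ?thesis using r by simp
qed

lemma W_pos:
  assumes r: "0 < r"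
  shows "0 < W r"
proof -
  have "W (r/2) < W r"
  proof (rule DERIV_pos_imp_increasing_open[where f = W])
    show "continuous_on {r/2..r} W"
      using r by (intro continuous_on_subset[OF mass_cont]) auto
    show "\<exists>y. (W has_real_derivative y) (at x) \<and> 0 < y" if "r/2 < x" "x < r" for x
      using W_deriv[of x] w_pos[of x] that r by (intro exI[of _ "w x"]) auto
  qed (use r in auto)
  then show ?thesis using W_nonneg[of "r/2"] by simp
qed

lemma Theta_nonneg: "0 \<le> r \<Longrightarrow> 0 \<le> \<Theta> r"
  by (simp add: flux_def W_nonneg w_nonneg)

lemma Theta_pos: "0 < r \<Longrightarrow> 0 < \<Theta> r"
  by (simp add: flux_def W_pos w_pos)

lemma Theta_le: "0 \<le> r \<Longrightarrow> \<Theta> r \<le> r"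
  using W_le[of r] w_pos[of r]
  by (cases "r = 0") (auto simp: flux_def field_simps)

lemma flux_abs_le:
  assumes "adm h" "0 \<le> r" "\<And>t. 0 \<le> t \<Longrightarrow> t \<le> r \<Longrightarrow> \<bar>h t\<bar> \<le> B"
  shows "\<bar>flux h r\<bar> \<le> B * \<Theta> r"
proof -
  have "\<bar>mass h r\<bar> / w r \<le> B * W r / w r"
    by (intro divide_right_mono mass_abs_le assms w_nonneg) (use assms in auto)
  then show ?thesis using w_nonneg[of r] assms(2) by (simp add: flux_def)
qed

lemma flux_mono:
  assumes "adm h" "adm k" "0 \<le> r" "\<And>t. 0 \<le> t \<Longrightarrow> t \<le> r \<Longrightarrow> h t \<le> k t"
  shows "flux h r \<le> flux k r"
  unfolding flux_def by (intro divide_right_mono mass_mono w_nonneg assms)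

lemma flux_diff: "adm h \<Longrightarrow> adm k \<Longrightarrow> flux (\<lambda>t. h t - k t) r = flux h r - flux k r"
  by (simp add: flux_def mass_diff diff_divide_distrib)

text \<open>At \<open>0\<close> the quotient reads \<open>0 / 0 = 0\<close>. Monotonicity of
  \<open>w\<close> gives \<open>\<Theta> r \<le> r\<close>, and this squeezes the flux to the same
  value.\<close>

lemma flux_cont:
  assumes h: "adm h"
  shows "continuous_on {0..} (flux h)"
  unfolding continuous_on_eq_continuous_within
proof
  fix x :: real assume "x \<in> {0..}"
  then consider "x = 0" | "0 < x" by fastforce
  then show "continuous (at x within {0..}) (flux h)"
  proof cases
    case 1
    obtain B where B: "\<forall>t\<ge>0. \<bar>h t\<bar> \<le> B" using h by (auto simp: adm_def)
    have "B \<ge> 0" using B by (metis abs_ge_zero order.refl order_trans)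
    have "((\<lambda>r. B * r) \<longlongrightarrow> B * 0) (at 0 within {0..})" by (intro tendsto_intros)
    then have lim: "((\<lambda>r. B * r) \<longlongrightarrow> 0) (at 0 within {0..})" by simp
    have "\<bar>flux h r\<bar> \<le> B * r" if "r \<ge> 0" for r
    proof -
      have "\<bar>flux h r\<bar> \<le> B * \<Theta> r" using B that by (intro flux_abs_le h) auto
      also have "\<dots> \<le> B * r" using \<open>B \<ge> 0\<close> that Theta_le[of r] by (intro mult_left_mono)
      finally show ?thesis .
    qed
    then have "(flux h \<longlongrightarrow> 0) (at 0 within {0..})"
      by (intro Lim_null_comparison[OF _ lim]) (auto simp: eventually_at_filter)
    then show ?thesis using 1 by (simp add: continuous_within)
  next
    case 2
    have "continuous (at x within {0..}) (mass h)" "continuous (at x within {0..}) w"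
      using mass_cont[OF h] w_cont 2 by (auto simp: continuous_on_eq_continuous_within)
    then show ?thesis
      unfolding flux_def[abs_def] continuous_within using w_pos[OF 2]
      by (intro tendsto_divide) auto
  qed
qed

lemma flux_integrable: "adm h \<Longrightarrow> 0 \<le> a \<Longrightarrow> flux h integrable_on {a..r}"
  by (intro integrable_continuous_interval continuous_on_subset[OF flux_cont]) auto

lemma pot_deriv:
  assumes "adm h" "0 \<le> r"
  shows "(pot h has_real_derivative flux h r) (at r within {0..})"
proof -
  have "((\<lambda>x. integral {0..x} (flux h)) has_real_derivative flux h r) (at r within {0..r+1})"
    using assms by (intro integral_has_real_derivative continuous_on_subset[OF flux_cont]) auto
  then show ?thesis
    using at_within_Ici_eq[of r "r+1" 0] by (simp add: pot_def[abs_def])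
qed

lemma pot_deriv_at: "adm h \<Longrightarrow> 0 < r \<Longrightarrow> (pot h has_real_derivative flux h r) (at r)"
  using DERIV_of_within_Ici[OF pot_deriv] by simp

lemma pot_cont: "adm h \<Longrightarrow> continuous_on {0..} (pot h)"
  by (rule DERIV_continuous_on[where D = "flux h"]) (use pot_deriv in auto)

lemma pot_mono:
  assumes "adm h" "adm k" "\<And>t. 0 \<le> t \<Longrightarrow> t \<le> r \<Longrightarrow> h t \<le> k t"
  shows "pot h r \<le> pot k r"
  unfolding pot_def
  by (intro integral_le flux_integrable flux_mono assms) (use assms in auto)

lemma pot_diff:
  assumes "adm h" "adm k"
  shows "pot (\<lambda>t. h t - k t) r = pot h r - pot k r"
proof -
  have "flux (\<lambda>t. h t - k t) = (\<lambda>r. flux h r - flux k r)"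
    using flux_diff[OF assms] by auto
  then show ?thesis
    using integral_diff[OF flux_integrable flux_integrable, of h 0 k r]
    by (simp add: pot_def assms)
qed

lemma flux_const: "flux (\<lambda>_. c) r = c * \<Theta> r"
  by (simp add: flux_def mass_const[of c])

lemma pot_const: "pot (\<lambda>_. c) r = c * T r"
  unfolding pot_def by (subst flux_const[abs_def]) simp

lemma pot_nonneg: "adm h \<Longrightarrow> (\<And>t. 0 \<le> t \<Longrightarrow> 0 \<le> h t) \<Longrightarrow> 0 \<le> pot h r"
  using pot_mono[of "\<lambda>_. 0" h r] by (simp add: pot_const[of 0])

lemma pot_cong: "(\<And>t. 0 \<le> t \<Longrightarrow> h t = k t) \<Longrightarrow> pot h r = pot k r"
  unfolding pot_def flux_def
  by (rule integral_cong) (auto intro!: arg_cong2[where f="(/)"] mass_cong)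

lemma pot_increment_le:
  assumes "adm h" "adm k" "\<And>t. 0 \<le> t \<Longrightarrow> h t \<le> k t" "0 \<le> r" "r \<le> s"
  shows "pot h s - pot h r \<le> pot k s - pot k r"
proof -
  have "pot k r - pot h r \<le> pot k s - pot h s"
  proof (rule nondecreasing_of_deriv[where f = "\<lambda>r. pot k r - pot h r" and D = "\<lambda>r. flux k r - flux h r"])
    show "continuous_on {r..s} (\<lambda>r. pot k r - pot h r)"
      by (intro continuous_intros continuous_on_subset[OF pot_cont]) (use assms in auto)
    fix x assume "r < x" "x < s"
    then show "((\<lambda>r. pot k r - pot h r) has_real_derivative flux k x - flux h x) (at x)"
      using assms by (intro derivative_intros pot_deriv_at) auto
    show "0 \<le> flux k x - flux h x"
      using flux_mono[of h k x] assms \<open>r < x\<close> by auto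
  qed (use assms in auto)
  then show ?thesis by simp
qed

lemma pot_mono_arg:
  assumes "adm h" "\<And>t. 0 \<le> t \<Longrightarrow> 0 \<le> h t" "0 \<le> r" "r \<le> s"
  shows "pot h r \<le> pot h s"
  using pot_increment_le[of "\<lambda>_. 0" h r s] assms by (simp add: pot_const[of 0])

lemma mass_pos:
  assumes h: "adm h" "\<And>t. 0 \<le> t \<Longrightarrow> 0 \<le> h t" "continuous_on {0..} h" "0 < h 0" and r: "0 < r"
  shows "0 < mass h r"
proof -
  have "continuous (at 0 within {0..}) h"
    using h(3) by (simp add: continuous_on_eq_continuous_within)
  then obtain d where d: "d > 0" "\<forall>x\<in>{0..}. dist x 0 < d \<longrightarrow> dist (h x) (h 0) < h 0 / 2"
    using h(4) unfolding continuous_within_eps_delta by (meson half_gt_zero)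
  have d2: "h 0 / 2 < h x" if "0 \<le> x" "x < d" for x
  proof -
    have "\<bar>h x - h 0\<bar> < h 0 / 2" using d(2) that by (auto simp: dist_real_def)
    then show ?thesis by (simp add: abs_if split: if_splits)
  qed
  define s where "s = min (d/2) r"
  have s: "0 < s" "s \<le> r" "s < d" using d r by (auto simp: s_def)
  have "0 < h 0 / 2 * W s" using W_pos[of s] s h by simp
  also have "\<dots> = mass (\<lambda>_. h 0 / 2) s" by (rule mass_const[symmetric])
  also have "\<dots> \<le> mass h s"
    using d2 s by (intro mass_mono h) (auto intro: less_imp_le)
  also have "\<dots> \<le> mass h r"
    unfolding mass_def
  proof (rule integral_subset_le)
    show "{0..s} \<subseteq> {0..r}" using s by simp
    show "\<forall>t\<in>{0..r}. 0 \<le> w t * h t"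
      using h(2) w_nonneg by simp
  qed (simp_all add: adm_integrable[OF h(1)])
  finally show ?thesis .
qed

lemma flux_pos:
  assumes "adm h" "\<And>t. 0 \<le> t \<Longrightarrow> 0 \<le> h t" "continuous_on {0..} h" "0 < h 0" and r: "0 < r"
  shows "0 < flux h r"
  using mass_pos[OF assms] w_pos[OF r] by (simp add: flux_def)

lemma pot_strict_mono_arg:
  assumes "adm h" "\<And>t. 0 \<le> t \<Longrightarrow> 0 \<le> h t" "continuous_on {0..} h" "0 < h 0" "0 \<le> r" "r < s"
  shows "pot h r < pot h s"
proof (rule DERIV_pos_imp_increasing_open[where f = "pot h"])
  show "continuous_on {r..s} (pot h)"
    by (intro continuous_on_subset[OF pot_cont]) (use assms in auto)
  show "\<exists>y. (pot h has_real_derivative y) (at x) \<and> 0 < y" if "r < x" "x < s" for x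
    using pot_deriv_at[of h x] flux_pos[of h x] assms that by force
qed fact

text \<open>Dominated convergence used twice, first for the masses with majorant
  \<open>w t * B\<close>, then for the fluxes with majorant \<open>B * \<Theta> t\<close>.\<close>

lemma dominated:
  assumes adm: "\<And>k. adm (h k)" and bd: "\<And>k t. 0 \<le> t \<Longrightarrow> \<bar>h k t\<bar> \<le> B"
    and lim: "\<And>t. 0 \<le> t \<Longrightarrow> (\<lambda>k. h k t) \<longlonglongrightarrow> g t"
  shows "adm g" "0 \<le> r \<Longrightarrow> (\<lambda>k. pot (h k) r) \<longlonglongrightarrow> pot g r"
proof -
  have "(\<lambda>t. w t * g t) integrable_on {0..r} \<and> (\<lambda>k. mass (h k) r) \<longlonglongrightarrow> mass g r" for r
  proof -
    have a: "\<And>k. (\<lambda>t. w t * h k t) integrable_on {0..r}" using adm by (simp add: adm_def)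
    have b: "(\<lambda>t. w t * B) integrable_on {0..r}" using adm_integrable[OF adm_const] .
    have c: "norm (w t * h k t) \<le> w t * B" if "t \<in> {0..r}" for k t
      using that bd[of t k] w_nonneg[of t] by (auto simp: abs_mult intro!: mult_left_mono)
    have d: "(\<lambda>k. w t * h k t) \<longlonglongrightarrow> w t * g t" if "t \<in> {0..r}" for t
      using that lim[of t] by (auto intro!: tendsto_intros)
    show ?thesis
      using dominated_convergence[OF a b c d] unfolding mass_def by blast
  qed
  note m = this
  have "\<bar>g t\<bar> \<le> B" if "0 \<le> t" for t
    by (rule Lim_bounded[OF tendsto_rabs[OF lim[OF that]]]) (use bd that in auto)
  then show adm_g: "adm g" using m by (auto simp: adm_def)
  assume r: "0 \<le> r"
  have a: "\<And>k. flux (h k) integrable_on {0..r}" using adm flux_integrable by blast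
  have b: "(\<lambda>t. B * \<Theta> t) integrable_on {0..r}"
    using integrable_on_cmult_left[OF flux_integrable[OF adm_const[of 1]], of 0 B r] by simp
  have c: "norm (flux (h k) t) \<le> B * \<Theta> t" if "t \<in> {0..r}" for k t
    using that flux_abs_le[OF adm, of t k B] bd by auto
  have d: "(\<lambda>k. flux (h k) t) \<longlonglongrightarrow> flux g t" if "t \<in> {0..r}" for t
    unfolding flux_def using m[of t] that w_pos[of t]
    by (cases "t = 0") (auto intro!: tendsto_intros)
  show "(\<lambda>k. pot (h k) r) \<longlonglongrightarrow> pot g r"
    unfolding pot_def by (rule dominated_convergence(2)[OF a b c d])
qed

lemma T_bounded: obtains B where "\<And>r. 0 \<le> r \<Longrightarrow> T r \<le> B"
  using theta_bounded that by (auto simp: pot_def flux_def[abs_def] mass_def)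

lemma T_nonneg: "0 \<le> T r"
  by (rule pot_nonneg) auto

lemma T_mono: "0 \<le> r \<Longrightarrow> r \<le> s \<Longrightarrow> T r \<le> T s"
  by (rule pot_mono_arg) auto

lemma T_strict_mono: "0 \<le> r \<Longrightarrow> r < s \<Longrightarrow> T r < T s"
  by (rule pot_strict_mono_arg) auto

end

section \<open>Finite limits of potentials\<close>

lemma mono_bounded_tendsto:
  fixes f :: "real \<Rightarrow> real"
  assumes mono: "\<And>r s. a \<le> r \<Longrightarrow> r \<le> s \<Longrightarrow> f r \<le> f s" and bd: "\<And>r. a \<le> r \<Longrightarrow> f r \<le> B"
  obtains l where "(f \<longlongrightarrow> l) at_top" "\<And>r. a \<le> r \<Longrightarrow> f r \<le> l"
proof -
  define l where "l = Sup (f ` {a..})"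
  have bdd: "bdd_above (f ` {a..})" using bd by (auto intro!: bdd_aboveI)
  have le: "f r \<le> l" if "a \<le> r" for r
    unfolding l_def using that bdd by (intro cSup_upper) auto
  have "(f \<longlongrightarrow> l) at_top"
  proof (rule order_tendstoI)
    fix y assume "y < l"
    then obtain r where r: "a \<le> r" "y < f r"
      unfolding l_def using bdd by (subst (asm) less_cSup_iff) auto
    then show "eventually (\<lambda>x. y < f x) at_top"
      using mono[of r] by (intro eventually_at_top_linorderI[of r]) (auto intro: less_le_trans)
  next
    fix y assume "l < y"
    then show "eventually (\<lambda>x. f x < y) at_top"
      using le by (intro eventually_at_top_linorderI[of a]) (auto intro: le_less_trans)
  qed
  then show thesis using le that by blast
qed

context radial_weight
begin

definition Tinf :: real where "Tinf = (THE l. (T \<longlongrightarrow> l) at_top)"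

lemma T_tendsto: "(T \<longlongrightarrow> Tinf) at_top"
  and T_le_Tinf: "0 \<le> r \<Longrightarrow> T r \<le> Tinf"
proof -
  obtain B where B: "\<And>r. 0 \<le> r \<Longrightarrow> T r \<le> B" using T_bounded by blast
  obtain l where l: "(T \<longlongrightarrow> l) at_top" "\<And>r. 0 \<le> r \<Longrightarrow> T r \<le> l"
    by (rule mono_bounded_tendsto[of 0 T B]) (use B T_mono in auto)
  have "Tinf = l" unfolding Tinf_def
    using l(1) by (intro the_equality) (auto intro: tendsto_unique[OF trivial_limit_at_top_linorder])
  then show "(T \<longlongrightarrow> Tinf) at_top" "0 \<le> r \<Longrightarrow> T r \<le> Tinf" using l by auto
qed

lemma Tinf_pos: "0 < Tinf"
  using T_strict_mono[of 0 1] T_le_Tinf[of 1] by simp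

text \<open>The third bound controls the tail by that of \<open>T\<close> alone, uniformly over all
  \<open>h\<close> with values in \<open>[0, B]\<close>; continuity of the limits in the data rests
  on it.\<close>

lemma pot_limit:
  assumes "adm h" "\<And>t. 0 \<le> t \<Longrightarrow> 0 \<le> h t" "\<And>t. 0 \<le> t \<Longrightarrow> h t \<le> B" "0 \<le> B"
  obtains l where "(pot h \<longlongrightarrow> l) at_top" "\<And>r. 0 \<le> r \<Longrightarrow> pot h r \<le> l"
    "\<And>r. 0 \<le> r \<Longrightarrow> l - pot h r \<le> B * (Tinf - T r)"
proof -
  have le: "pot h s - pot h r \<le> B * (T s - T r)" if "0 \<le> r" "r \<le> s" for r s
    using pot_increment_le[of h "\<lambda>_. B" r s] assms that by (simp add: pot_const[of B] algebra_simps)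
  have "pot h r \<le> B * Tinf" if "0 \<le> r" for r
    using le[of 0 r] mult_left_mono[OF T_le_Tinf[OF that] assms(4)] that by simp
  then obtain l where l: "(pot h \<longlongrightarrow> l) at_top" "\<And>r. 0 \<le> r \<Longrightarrow> pot h r \<le> l"
    using mono_bounded_tendsto[of 0 "pot h" "B * Tinf"] pot_mono_arg[of h] assms by metis
  have "l - pot h r \<le> B * (Tinf - T r)" if "0 \<le> r" for r
  proof (rule tendsto_le[OF trivial_limit_at_top_linorder])
    show "((\<lambda>s. B * (T s - T r)) \<longlongrightarrow> B * (Tinf - T r)) at_top"
      by (intro tendsto_intros T_tendsto)
    show "((\<lambda>s. pot h s - pot h r) \<longlongrightarrow> l - pot h r) at_top"
      by (intro tendsto_intros l)
    show "eventually (\<lambda>s. pot h s - pot h r \<le> B * (T s - T r)) at_top"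
      using le[OF that] by (intro eventually_at_top_linorderI[of r])
  qed
  then show thesis using l that by blast
qed

section \<open>The truncated system\<close>

text \<open>An integral form asking only for admissibility, so that pointwise limits of solutions
  can be recognised as solutions.\<close>

definition sol :: "real \<Rightarrow> real \<Rightarrow> real \<Rightarrow> real \<Rightarrow> (real \<Rightarrow> real) \<Rightarrow> (real \<Rightarrow> real) \<Rightarrow> bool" where
  "sol p q \<xi> \<eta> u v \<longleftrightarrow>
     adm (\<lambda>t. pw q (v t)) \<and> adm (\<lambda>t. pw p (u t)) \<and>
     (\<forall>r\<ge>0. u r = \<xi> - pot (\<lambda>t. pw q (v t)) r) \<and>
     (\<forall>r\<ge>0. v r = \<eta> - pot (\<lambda>t. pw p (u t)) r)"

lemma sol_swap: "sol p q \<xi> \<eta> u v \<longleftrightarrow> sol q p \<eta> \<xi> v u"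
  by (auto simp: sol_def)

lemma adm_cong: "(\<And>t. 0 \<le> t \<Longrightarrow> h t = k t) \<Longrightarrow> adm h \<longleftrightarrow> adm k"
  unfolding adm_def by (intro arg_cong2[where f = "(\<and>)"] all_cong1 integrable_cong ex_cong1) auto

lemma sol_cong:
  assumes "sol p q \<xi> \<eta> u v" "\<And>t. 0 \<le> t \<Longrightarrow> u' t = u t" "\<And>t. 0 \<le> t \<Longrightarrow> v' t = v t"
  shows "sol p q \<xi> \<eta> u' v'"
proof -
  have "adm (\<lambda>t. pw q (v' t)) = adm (\<lambda>t. pw q (v t))" "adm (\<lambda>t. pw p (u' t)) = adm (\<lambda>t. pw p (u t))"
    by (rule adm_cong; simp add: assms)+
  moreover have "pot (\<lambda>t. pw q (v' t)) r = pot (\<lambda>t. pw q (v t)) r" for r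
    by (rule pot_cong) (simp add: assms)
  moreover have "pot (\<lambda>t. pw p (u' t)) r = pot (\<lambda>t. pw p (u t)) r" for r
    by (rule pot_cong) (simp add: assms)
  ultimately show ?thesis using assms by (auto simp: sol_def)
qed

lemma adm_pw:
  assumes "0 < q" "continuous_on {0..} v" "\<And>t. 0 \<le> t \<Longrightarrow> v t \<le> \<eta>"
  shows "adm (\<lambda>t. pw q (v t))"
proof (rule adm_continuous)
  show "continuous_on {0..} (\<lambda>t. pw q (v t))"
    using continuous_on_compose2[OF continuous_pw[of q UNIV] assms(2)] assms(1) by simp
  show "\<bar>pw q (v t)\<bar> \<le> pw q \<eta>" if "0 \<le> t" for t
    using pw_mono[of q "v t" \<eta>] assms that by simp
qed

lemma sol_adm:
  assumes "sol p q \<xi> \<eta> u v"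
  shows "adm (\<lambda>t. pw q (v t))" "adm (\<lambda>t. pw p (u t))"
  using assms by (auto simp: sol_def)

lemma sol_eq:
  assumes "sol p q \<xi> \<eta> u v" "0 \<le> r"
  shows "u r = \<xi> - pot (\<lambda>t. pw q (v t)) r" "v r = \<eta> - pot (\<lambda>t. pw p (u t)) r"
  using assms by (auto simp: sol_def)

lemma sol_0:
  assumes "sol p q \<xi> \<eta> u v"
  shows "u 0 = \<xi>" "v 0 = \<eta>"
  using sol_eq[OF assms, of 0] by auto

lemma sol_deriv_within:
  assumes s: "sol p q \<xi> \<eta> u v" and r: "0 \<le> r"
  shows "(u has_real_derivative - flux (\<lambda>t. pw q (v t)) r) (at r within {0..})"
proof -
  have "((\<lambda>r. \<xi> - pot (\<lambda>t. pw q (v t)) r) has_real_derivative 0 - flux (\<lambda>t. pw q (v t)) r) (at r within {0..})"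
    by (intro derivative_intros pot_deriv sol_adm[OF s] r)
  then show ?thesis
    using has_field_derivative_transform_within[of _ "0 - flux (\<lambda>t. pw q (v t)) r" r "{0..}" 1 u]
      r sol_eq(1)[OF s] by simp
qed

lemma sol_deriv:
  assumes "sol p q \<xi> \<eta> u v" "0 < r"
  shows "(u has_real_derivative - flux (\<lambda>t. pw q (v t)) r) (at r)"
  using DERIV_of_within_Ici[OF sol_deriv_within] assms by simp

lemma sol_cont: "sol p q \<xi> \<eta> u v \<Longrightarrow> continuous_on {0..} u"
  by (rule DERIV_continuous_on) (use sol_deriv_within in auto)

lemma sol_le: "sol p q \<xi> \<eta> u v \<Longrightarrow> 0 \<le> r \<Longrightarrow> u r \<le> \<xi>"
  using sol_eq(1)[of p q \<xi> \<eta> u v r] pot_nonneg[of "\<lambda>t. pw q (v t)" r] sol_adm(1)[of p q \<xi> \<eta> u v]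
  by simp

lemma sol_antimono:
  assumes "sol p q \<xi> \<eta> u v" "0 \<le> r" "r \<le> s"
  shows "u s \<le> u r"
  using pot_mono_arg[of "\<lambda>t. pw q (v t)" r s] sol_adm[OF assms(1)] assms
    sol_eq[OF assms(1), of r] sol_eq[OF assms(1), of s] by simp

lemma sol_pw_le:
  assumes "0 < p" "sol p q \<xi> \<eta> u v" "0 \<le> t"
  shows "pw p (u t) \<le> pw p \<xi>"
  using assms sol_le[OF assms(2,3)] by (intro pw_mono) auto

section \<open>Monotone iteration and the maximal solution\<close>

text \<open>The \<open>u\<close> component is eliminated. The remaining map for \<open>v\<close>
  reverses the order twice, hence is increasing, and starting from the constant upper bound
  \<open>\<eta>\<close> makes the iterates decrease to the largest solution.\<close>

primrec iter :: "real \<Rightarrow> real \<Rightarrow> real \<Rightarrow> real \<Rightarrow> nat \<Rightarrow> real \<Rightarrow> real" where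
  "iter p q \<xi> \<eta> 0 = (\<lambda>_. \<eta>)"
| "iter p q \<xi> \<eta> (Suc k) = (\<lambda>r. \<eta> - pot (\<lambda>t. pw p (\<xi> - pot (\<lambda>s. pw q (iter p q \<xi> \<eta> k s)) t)) r)"

lemma adm_step:
  assumes "0 < p" "adm (\<lambda>s. pw q (v s))"
  shows "adm (\<lambda>t. pw p (\<xi> - pot (\<lambda>s. pw q (v s)) t))"
proof (rule adm_pw[where \<eta> = \<xi>])
  show "continuous_on {0..} (\<lambda>t. \<xi> - pot (\<lambda>s. pw q (v s)) t)"
    by (intro continuous_intros pot_cont assms)
  show "\<xi> - pot (\<lambda>s. pw q (v s)) t \<le> \<xi>" if "0 \<le> t" for t
    using pot_nonneg[of "\<lambda>s. pw q (v s)" t] assms by simp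
qed fact

lemma iter_props:
  assumes pq: "0 < p" "0 < q"
  shows "adm (\<lambda>t. pw q (iter p q \<xi> \<eta> k t)) \<and>
    (\<forall>r\<ge>0. iter p q \<xi> \<eta> k r \<le> \<eta> \<and> \<eta> - pw p \<xi> * Tinf \<le> iter p q \<xi> \<eta> k r)"
proof (induction k)
  case 0
  have "0 \<le> pw p \<xi> * Tinf" using Tinf_pos by simp
  then show ?case by simp
next
  case (Suc k)
  define h where "h = (\<lambda>t. pw p (\<xi> - pot (\<lambda>s. pw q (iter p q \<xi> \<eta> k s)) t))"
  have h: "adm h" unfolding h_def by (rule adm_step) (use Suc pq in auto)
  have h0: "0 \<le> h t" for t by (simp add: h_def)
  have h1: "h t \<le> pw p \<xi>" for t
    unfolding h_def using pq pot_nonneg[of "\<lambda>s. pw q (iter p q \<xi> \<eta> k s)" t] Suc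
    by (intro pw_mono) auto
  have eq: "iter p q \<xi> \<eta> (Suc k) = (\<lambda>r. \<eta> - pot h r)" by (simp add: h_def)
  have b: "\<eta> - pot h r \<le> \<eta> \<and> \<eta> - pw p \<xi> * Tinf \<le> \<eta> - pot h r" if "0 \<le> r" for r
  proof -
    have "pot h r \<le> pot (\<lambda>_. pw p \<xi>) r" using h h1 by (intro pot_mono) auto
    also have "\<dots> = pw p \<xi> * T r" by (rule pot_const)
    also have "\<dots> \<le> pw p \<xi> * Tinf" using T_le_Tinf[OF that] by (intro mult_left_mono) auto
    finally show ?thesis using pot_nonneg[OF h h0] by simp
  qed
  have "adm (\<lambda>t. pw q (\<eta> - pot h t))"
    using pq b by (intro adm_pw[where \<eta> = \<eta>] continuous_intros pot_cont h) auto
  then show ?case unfolding eq using b by blast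
qed

lemma step_mono:
  assumes "0 < p" "0 < q" "adm (\<lambda>s. pw q (v1 s))" "adm (\<lambda>s. pw q (v2 s))"
    and "\<And>t. 0 \<le> t \<Longrightarrow> v1 t \<le> v2 t" "\<xi>2 \<le> \<xi>1"
  shows "pot (\<lambda>t. pw p (\<xi>2 - pot (\<lambda>s. pw q (v2 s)) t)) r \<le> pot (\<lambda>t. pw p (\<xi>1 - pot (\<lambda>s. pw q (v1 s)) t)) r"
proof (intro pot_mono adm_step assms pw_mono)
  fix t
  have "pot (\<lambda>s. pw q (v1 s)) t \<le> pot (\<lambda>s. pw q (v2 s)) t"
    using assms by (intro pot_mono pw_mono) auto
  then show "\<xi>2 - pot (\<lambda>s. pw q (v2 s)) t \<le> \<xi>1 - pot (\<lambda>s. pw q (v1 s)) t"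
    using assms(6) by simp
qed (use assms in auto)

lemma iter_decreasing:
  assumes pq: "0 < p" "0 < q" and r: "0 \<le> r"
  shows "iter p q \<xi> \<eta> (Suc k) r \<le> iter p q \<xi> \<eta> k r"
  using r
proof (induction k arbitrary: r)
  case 0
  then show ?case using iter_props[OF pq, of \<xi> \<eta> 1] by simp
next
  case (Suc k)
  have a: "adm (\<lambda>t. pw q (iter p q \<xi> \<eta> j t))" for j using iter_props[OF pq] by blast
  have "pot (\<lambda>t. pw p (\<xi> - pot (\<lambda>s. pw q (iter p q \<xi> \<eta> k s)) t)) r
      \<le> pot (\<lambda>t. pw p (\<xi> - pot (\<lambda>s. pw q (iter p q \<xi> \<eta> (Suc k) s)) t)) r"
    by (rule step_mono[OF pq a a Suc.IH]) auto
  moreover have "iter p q \<xi> \<eta> (Suc j) r = \<eta> - pot (\<lambda>t. pw p (\<xi> - pot (\<lambda>s. pw q (iter p q \<xi> \<eta> j s)) t)) r" for j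
    by simp
  ultimately show ?case by (metis diff_left_mono)
qed

text \<open>Proved for data ordered by \<open>\<xi> \<le> \<xi>1\<close> and
  \<open>\<eta>1 \<le> \<eta>\<close> rather than for equal data: in the limit this is already the
  comparison principle.\<close>

lemma sol_le_iter:
  assumes pq: "0 < p" "0 < q" and s: "sol p q \<xi>1 \<eta>1 u v" and le: "\<xi> \<le> \<xi>1" "\<eta>1 \<le> \<eta>"
    and r: "0 \<le> r"
  shows "v r \<le> iter p q \<xi> \<eta> k r"
  using r
proof (induction k arbitrary: r)
  case 0
  then show ?case using sol_le[of q p \<eta>1 \<xi>1 v u r] s le by (simp add: sol_swap)
next
  case (Suc k)
  have a: "adm (\<lambda>t. pw q (iter p q \<xi> \<eta> k t))" using iter_props[OF pq] by blast
  have "pot (\<lambda>t. pw p (\<xi> - pot (\<lambda>s. pw q (iter p q \<xi> \<eta> k s)) t)) r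
      \<le> pot (\<lambda>t. pw p (\<xi>1 - pot (\<lambda>s. pw q (v s)) t)) r"
    by (rule step_mono) (use pq a sol_adm[OF s] Suc le in auto)
  also have "\<dots> = pot (\<lambda>t. pw p (u t)) r"
    by (rule pot_cong) (use sol_eq[OF s] in simp)
  finally show ?case using sol_eq[OF s Suc.prems] le by simp
qed

text \<open>The limit inherits from the iterates that it lies above every solution with ordered
  data, so existence and maximality of \<open>v\<close> come together. Each of the two equations
  takes one passage to the limit by \<open>dominated\<close>.\<close>

lemma sol_exists_max:
  assumes pq: "0 < p" "0 < q"
  obtains u v where "sol p q \<xi> \<eta> u v"
    "\<And>\<xi>1 \<eta>1 u1 v1 r. sol p q \<xi>1 \<eta>1 u1 v1 \<Longrightarrow> \<xi> \<le> \<xi>1 \<Longrightarrow> \<eta>1 \<le> \<eta> \<Longrightarrow> 0 \<le> r \<Longrightarrow> v1 r \<le> v r"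
proof -
  let ?V = "iter p q \<xi> \<eta>"
  have "\<exists>l. (\<lambda>k. ?V k r) \<longlonglongrightarrow> l" if "0 \<le> r" for r
  proof -
    have "decseq (\<lambda>k. ?V k r)" using iter_decreasing[OF pq that] by (intro decseq_SucI)
    moreover have "\<eta> - pw p \<xi> * Tinf \<le> ?V k r" for k using iter_props[OF pq] that by blast
    ultimately show ?thesis using decseq_convergent by metis
  qed
  then obtain v where v: "\<And>r. 0 \<le> r \<Longrightarrow> (\<lambda>k. ?V k r) \<longlonglongrightarrow> v r" by metis
  define h where "h = (\<lambda>k t. pw q (?V k t))"
  have h: "adm (h k)" for k using iter_props[OF pq] by (simp add: h_def)
  have hb: "\<bar>h k t\<bar> \<le> pw q \<eta>" if "0 \<le> t" for k t
    using iter_props[OF pq, of \<xi> \<eta> k] that pq by (auto simp: h_def intro!: pw_mono)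
  have hl: "(\<lambda>k. h k t) \<longlonglongrightarrow> pw q (v t)" if "0 \<le> t" for t
    unfolding h_def by (intro tendsto_pw pq v that)
  have D1: "adm (\<lambda>t. pw q (v t))" "\<And>r. 0 \<le> r \<Longrightarrow> (\<lambda>k. pot (h k) r) \<longlonglongrightarrow> pot (\<lambda>t. pw q (v t)) r"
    by (rule dominated[of h "pw q \<eta>"]; use h hb hl in blast)+
  define u where "u = (\<lambda>r. \<xi> - pot (\<lambda>t. pw q (v t)) r)"
  define g where "g = (\<lambda>k t. pw p (\<xi> - pot (h k) t))"
  have g: "adm (g k)" for k
    unfolding g_def h_def by (rule adm_step) (use pq h in \<open>auto simp: h_def\<close>)
  have gb: "\<bar>g k t\<bar> \<le> pw p \<xi>" if "0 \<le> t" for k t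
    unfolding g_def using pot_nonneg[OF h[of k], of t] pq by (auto simp: h_def intro!: pw_mono)
  have gl: "(\<lambda>k. g k t) \<longlonglongrightarrow> pw p (u t)" if "0 \<le> t" for t
    unfolding g_def u_def by (intro tendsto_pw pq tendsto_intros D1(2) that)
  have D2: "adm (\<lambda>t. pw p (u t))" "\<And>r. 0 \<le> r \<Longrightarrow> (\<lambda>k. pot (g k) r) \<longlonglongrightarrow> pot (\<lambda>t. pw p (u t)) r"
    by (rule dominated[of g "pw p \<xi>"]; use g gb gl in blast)+
  have "v r = \<eta> - pot (\<lambda>t. pw p (u t)) r" if "0 \<le> r" for r
  proof (rule LIMSEQ_unique)
    show "(\<lambda>k. ?V (Suc k) r) \<longlonglongrightarrow> v r" using v[OF that] by (rule LIMSEQ_Suc)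
    have "?V (Suc k) r = \<eta> - pot (g k) r" for k by (simp add: g_def h_def)
    then show "(\<lambda>k. ?V (Suc k) r) \<longlonglongrightarrow> \<eta> - pot (\<lambda>t. pw p (u t)) r"
      using tendsto_diff[OF tendsto_const D2(2)[OF that], of \<eta>] by simp
  qed
  then have "sol p q \<xi> \<eta> u v"
    unfolding sol_def using D1(1) D2(1) by (auto simp: u_def)
  moreover have "v1 r \<le> v r" if "sol p q \<xi>1 \<eta>1 u1 v1" "\<xi> \<le> \<xi>1" "\<eta>1 \<le> \<eta>" "0 \<le> r" for \<xi>1 \<eta>1 u1 v1 r
    by (rule LIMSEQ_le_const[OF v[OF that(4)]]) (use sol_le_iter[OF pq that(1-4)] in auto)
  ultimately show thesis using that by blast
qed

section \<open>Uniqueness and comparison\<close>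

text \<open>Up to \<open>R\<close> the components take values in \<open>[u R, \<xi>]\<close> and
  \<open>[v1 R, \<eta>]\<close>, intervals away from \<open>0\<close> on which the powers are
  Lipschitz, so a Gronwall argument applies.\<close>

lemma sol_unique_ordered_positive:
  assumes pq: "0 < p" "0 < q"
    and s: "sol p q \<xi> \<eta> u v" and s1: "sol p q \<xi> \<eta> u1 v1"
    and le: "\<And>r. 0 \<le> r \<Longrightarrow> v1 r \<le> v r" "\<And>r. 0 \<le> r \<Longrightarrow> u r \<le> u1 r"
    and R: "0 \<le> R" "0 < u R" "0 < v1 R"
  shows "u1 R = u R \<and> v1 R = v R"
proof -
  have sw: "sol q p \<eta> \<xi> v u" "sol q p \<eta> \<xi> v1 u1" using s s1 by (simp_all add: sol_swap)
  obtain Lp where Lp: "0 < Lp" "\<And>x y. u R \<le> x \<Longrightarrow> x \<le> y \<Longrightarrow> y \<le> \<xi> \<Longrightarrow> pw p y - pw p x \<le> Lp * (y - x)"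
    using pw_lipschitz[OF R(2), of \<xi> p] by blast
  obtain Lq where Lq: "0 < Lq" "\<And>x y. v1 R \<le> x \<Longrightarrow> x \<le> y \<Longrightarrow> y \<le> \<eta> \<Longrightarrow> pw q y - pw q x \<le> Lq * (y - x)"
    using pw_lipschitz[OF R(3), of \<eta> q] by blast
  define L where "L = max Lp Lq"
  define D where "D = (\<lambda>r. v r - v1 r)"
  define E where "E = (\<lambda>r. u1 r - u r)"
  define hp where "hp = (\<lambda>t. pw p (u1 t) - pw p (u t))"
  define hq where "hq = (\<lambda>t. pw q (v t) - pw q (v1 t))"
  have adm_h: "adm hp" "adm hq"
    unfolding hp_def hq_def using sol_adm[OF s] sol_adm[OF s1] by (auto intro: adm_minus)
  have h_nonneg: "0 \<le> hp t" "0 \<le> hq t" if "0 \<le> t" for t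
    unfolding hp_def hq_def using pw_mono[of p "u t" "u1 t"] pw_mono[of q "v1 t" "v t"] le[OF that] pq by auto
  have D_eq: "D r = pot hp r" and E_eq: "E r = pot hq r" if "0 \<le> r" for r
    unfolding D_def E_def hp_def hq_def
    using sol_eq[OF s that] sol_eq[OF s1 that] sol_adm[OF s] sol_adm[OF s1] by (simp_all add: pot_diff)
  have D_mono: "D a \<le> D b" and E_mono: "E a \<le> E b" if "0 \<le> a" "a \<le> b" for a b
    using pot_mono_arg[OF adm_h(1) h_nonneg(1) that] pot_mono_arg[OF adm_h(2) h_nonneg(2) that]
    by (simp_all add: D_eq E_eq that order_trans[OF that])
  have L0: "0 < L" using Lp(1) by (simp add: L_def)
  define Q where "Q = (\<lambda>r. pot hp r + pot hq r)"
  have flux_le: "flux hp r + flux hq r \<le> L * \<Theta> r * Q r" if r: "0 < r" "r < R" for r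
  proof -
    have hpb: "\<bar>hp t\<bar> \<le> L * E r" if "0 \<le> t" "t \<le> r" for t
    proof -
      have "hp t \<le> Lp * (u1 t - u t)" unfolding hp_def
        using sol_antimono[OF s, of t R] le(2)[of t] sol_le[OF s1, of t] that r by (intro Lp(2)) auto
      also have "\<dots> \<le> L * E t" unfolding E_def L_def using le(2)[of t] that by (intro mult_right_mono) auto
      also have "\<dots> \<le> L * E r" using E_mono[of t r] that L0 by (intro mult_left_mono) auto
      finally show ?thesis using h_nonneg that by simp
    qed
    have hqb: "\<bar>hq t\<bar> \<le> L * D r" if "0 \<le> t" "t \<le> r" for t
    proof -
      have "hq t \<le> Lq * (v t - v1 t)" unfolding hq_def
        using sol_antimono[OF sw(2), of t R] le(1)[of t] sol_le[OF sw(1), of t] that r by (intro Lq(2)) auto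
      also have "\<dots> \<le> L * D t" unfolding D_def L_def using le(1)[of t] that by (intro mult_right_mono) auto
      also have "\<dots> \<le> L * D r" using D_mono[of t r] that L0 by (intro mult_left_mono) auto
      finally show ?thesis using h_nonneg that by simp
    qed
    have "\<bar>flux hp r\<bar> \<le> L * E r * \<Theta> r" "\<bar>flux hq r\<bar> \<le> L * D r * \<Theta> r"
      using flux_abs_le[OF adm_h(1) _ hpb] flux_abs_le[OF adm_h(2) _ hqb] r by auto
    then show ?thesis using r by (simp add: Q_def D_eq E_eq algebra_simps)
  qed
  \<comment> \<open>Gronwall with \<open>T\<close> in the role of time: \<open>flux_le\<close> reads
    \<open>Q' \<le> L * T' * Q\<close>, and \<open>Q 0 = 0\<close>.\<close>
  have "Q R * exp (- L * T R) \<le> Q 0 * exp (- L * T 0)"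
  proof (rule nonincreasing_of_deriv[where f = "\<lambda>r. Q r * exp (- L * T r)"
        and D = "\<lambda>r. (flux hp r + flux hq r) * exp (- L * T r) + Q r * (exp (- L * T r) * (- L * \<Theta> r))"])
    show "continuous_on {0..R} (\<lambda>r. Q r * exp (- L * T r))"
      unfolding Q_def
      by (intro continuous_intros continuous_on_subset[OF pot_cont] adm_h adm_const) auto
    fix x assume x: "0 < x" "x < R"
    show "((\<lambda>r. Q r * exp (- L * T r)) has_real_derivative
        (flux hp x + flux hq x) * exp (- L * T x) + Q x * (exp (- L * T x) * (- L * \<Theta> x))) (at x)"
      unfolding Q_def
      by (rule derivative_eq_intros pot_deriv_at adm_h adm_const x refl)+ (simp add: algebra_simps)
    have "(flux hp x + flux hq x - L * \<Theta> x * Q x) * exp (- L * T x) \<le> 0"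
      using flux_le[OF x] by (intro mult_nonpos_nonneg) auto
    then show "(flux hp x + flux hq x) * exp (- L * T x) + Q x * (exp (- L * T x) * (- L * \<Theta> x)) \<le> 0"
      by (simp add: algebra_simps)
  qed fact
  then have "Q R \<le> 0" by (simp add: Q_def mult_le_0_iff)
  then show ?thesis
    using D_eq[OF R(1)] E_eq[OF R(1)] le(1)[OF R(1)] le(2)[OF R(1)] by (auto simp: Q_def D_def E_def)
qed

lemma first_nonpos:
  fixes f :: "real \<Rightarrow> real"
  assumes "continuous_on {0..} f" "0 < f 0" "0 \<le> b" "f b \<le> 0"
  obtains R where "0 < R" "R \<le> b" "f R = 0" "\<And>r. 0 \<le> r \<Longrightarrow> r < R \<Longrightarrow> 0 < f r"
proof -
  define S where "S = {0..b} \<inter> f -` {..0}"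
  have "closed S" unfolding S_def
    by (intro continuous_closed_preimage continuous_on_subset[OF assms(1)]) auto
  then have "compact S" unfolding S_def by (metis compact_Int_closed compact_Icc compact_eq_bounded_closed bounded_Int bounded_closed_interval)
  moreover have "S \<noteq> {}" using assms by (auto simp: S_def)
  ultimately obtain R where R: "R \<in> S" "\<And>t. t \<in> S \<Longrightarrow> R \<le> t"
    using compact_attains_inf[of S] by blast
  have pos: "0 < f r" if "0 \<le> r" "r < R" for r
    using R(1) R(2)[of r] that by (force simp: S_def)
  have "0 < R" using R(1) assms(2) by (cases "R = 0") (auto simp: S_def)
  have "0 \<le> f R"
  proof (rule ccontr)
    assume "\<not> 0 \<le> f R"
    then have "f R \<le> 0" "f R / 2 < 0" by auto
    have "\<exists>x\<ge>0. x \<le> R \<and> f x = f R / 2"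
      using \<open>0 < R\<close> assms(2) \<open>f R / 2 < 0\<close>
      by (intro IVT2' continuous_on_subset[OF assms(1)]) auto
    then obtain x where "0 \<le> x" "x \<le> R" "f x = f R / 2" by blast
    with \<open>f R / 2 < 0\<close> pos[of x] show False by (cases "x = R") auto
  qed
  with R(1) have "f R = 0" by (auto simp: S_def)
  then show thesis using that[OF \<open>0 < R\<close> _ _ pos] R(1) by (auto simp: S_def)
qed

text \<open>Before the first zero \<open>R\<close> of the smaller components \<open>u\<close> and
  \<open>v1\<close> the Gronwall argument applies. At \<open>R\<close> one component vanishes in
  both solutions, by continuity, and is nonpositive from there on; so its truncated power agrees
  everywhere, which fixes the other component and then the first.\<close>

lemma sol_unique_ordered:
  assumes pq: "0 < p" "0 < q" and pos: "0 < \<xi>" "0 < \<eta>"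
    and s: "sol p q \<xi> \<eta> u v" and s1: "sol p q \<xi> \<eta> u1 v1"
    and le: "\<And>r. 0 \<le> r \<Longrightarrow> v1 r \<le> v r"
    and r: "0 \<le> r"
  shows "u1 r = u r \<and> v1 r = v r"
proof -
  have sw: "sol q p \<eta> \<xi> v u" "sol q p \<eta> \<xi> v1 u1" using s s1 by (simp_all add: sol_swap)
  have le2: "u r \<le> u1 r" if "0 \<le> r" for r
    using pot_mono[of "\<lambda>t. pw q (v1 t)" "\<lambda>t. pw q (v t)" r] sol_adm[OF s] sol_adm[OF s1]
      le pw_mono[of q] pq sol_eq[OF s that] sol_eq[OF s1 that] by fastforce
  note eq = sol_unique_ordered_positive[OF pq s s1 le le2]
  have by_p: ?thesis if e: "\<And>t. 0 \<le> t \<Longrightarrow> pw p (u t) = pw p (u1 t)"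
  proof -
    have v: "v t = v1 t" if "0 \<le> t" for t
      using sol_eq[OF s that] sol_eq[OF s1 that] pot_cong[of "\<lambda>t. pw p (u t)" "\<lambda>t. pw p (u1 t)" t] e by simp
    then show ?thesis
      using sol_eq[OF s r] sol_eq[OF s1 r] pot_cong[of "\<lambda>t. pw q (v t)" "\<lambda>t. pw q (v1 t)" r] r by simp
  qed
  have by_q: ?thesis if e: "\<And>t. 0 \<le> t \<Longrightarrow> pw q (v t) = pw q (v1 t)"
  proof -
    have u: "u t = u1 t" if "0 \<le> t" for t
      using sol_eq[OF s that] sol_eq[OF s1 that] pot_cong[of "\<lambda>t. pw q (v t)" "\<lambda>t. pw q (v1 t)" t] e by simp
    then show ?thesis
      using sol_eq[OF s r] sol_eq[OF s1 r] pot_cong[of "\<lambda>t. pw p (u t)" "\<lambda>t. pw p (u1 t)" r] r by simp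
  qed
  show ?thesis
  proof (cases "0 < min (u r) (v1 r)")
    case True
    then show ?thesis using eq[OF _ _ r] by simp
  next
    case False
    have c: "continuous_on {0..} (\<lambda>r. min (u r) (v1 r))"
      using sol_cont[OF s] sol_cont[OF sw(2)] by (intro continuous_intros)
    have p0: "0 < min (u 0) (v1 0)" using sol_0[OF s] sol_0[OF s1] pos by simp
    have pr: "min (u r) (v1 r) \<le> 0" using False by (rule leI)
    obtain R where R: "0 < R" "min (u R) (v1 R) = 0" "\<And>t. 0 \<le> t \<Longrightarrow> t < R \<Longrightarrow> 0 < min (u t) (v1 t)"
      by (rule first_nonpos[OF c p0 r pr]) blast
    have below: "u1 t = u t \<and> v1 t = v t" if "0 \<le> t" "t < R" for t
      using eq[of t] R(3)[of t] that by simp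
    have at_R: "f R = g R" if c: "continuous_on {0..} f" "continuous_on {0..} g"
      and e: "\<And>t. 0 \<le> t \<Longrightarrow> t < R \<Longrightarrow> f t = g t" for f g :: "real \<Rightarrow> real"
    proof (rule tendsto_unique[of "at_left R"])
      have lim: "(f \<longlongrightarrow> f R) (at_left R)" if "continuous_on {0..} f" for f :: "real \<Rightarrow> real"
      proof -
        have "isCont f R"
          using that R(1) continuous_on_interior[of "{0..}" f R] by simp
        then have "(f \<longlongrightarrow> f R) (at R)" by (simp add: isCont_def)
        then show ?thesis by (rule tendsto_mono[OF at_le[OF subset_UNIV]])
      qed
      show "(g \<longlongrightarrow> g R) (at_left R)" by (rule lim) fact
      have "eventually (\<lambda>t. f t = g t) (at_left R)"
        using e R(1) by (intro eventually_at_leftI[of 0]) auto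
      then show "(g \<longlongrightarrow> f R) (at_left R)"
        using lim[OF c(1)] by (rule tendsto_cong[THEN iffD1])
    qed simp
    have atR: "u1 R = u R" "v1 R = v R"
      using at_R[OF sol_cont[OF s1] sol_cont[OF s]] at_R[OF sol_cont[OF sw(2)] sol_cont[OF sw(1)]] below by auto
    consider "u R = 0" | "v1 R = 0" using R(2) by (metis min_def)
    then show ?thesis
    proof cases
      case 1
      have "pw p (u t) = pw p (u1 t)" if "0 \<le> t" for t
      proof (cases "t < R")
        case False
        then have "u t \<le> 0" "u1 t \<le> 0"
          using sol_antimono[OF s, of R t] sol_antimono[OF s1, of R t] 1 atR R(1) by auto
        then show ?thesis by simp
      qed (use below that in simp)
      then show ?thesis by (rule by_p)
    next
      case 2
      have "pw q (v t) = pw q (v1 t)" if "0 \<le> t" for t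
      proof (cases "t < R")
        case False
        then have "v t \<le> 0" "v1 t \<le> 0"
          using sol_antimono[OF sw(1), of R t] sol_antimono[OF sw(2), of R t] 2 atR R(1) by auto
        then show ?thesis by simp
      qed (use below that in simp)
      then show ?thesis by (rule by_q)
    qed
  qed
qed

text \<open>The two solutions are not known to be ordered; each is compared with the maximal one
  instead.\<close>

lemma sol_unique:
  assumes pq: "0 < p" "0 < q" and pos: "0 < \<xi>" "0 < \<eta>"
    and s: "sol p q \<xi> \<eta> u v" and s1: "sol p q \<xi> \<eta> u1 v1" and r: "0 \<le> r"
  shows "u1 r = u r" "v1 r = v r"
proof -
  obtain um vm where m: "sol p q \<xi> \<eta> um vm"
    "\<And>\<xi>1 \<eta>1 u1 v1 r. sol p q \<xi>1 \<eta>1 u1 v1 \<Longrightarrow> \<xi> \<le> \<xi>1 \<Longrightarrow> \<eta>1 \<le> \<eta> \<Longrightarrow> 0 \<le> r \<Longrightarrow> v1 r \<le> vm r"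
    using sol_exists_max[OF pq] by blast
  have "u r = um r \<and> v r = vm r" "u1 r = um r \<and> v1 r = vm r"
    using sol_unique_ordered[OF pq pos m(1) s _ r] sol_unique_ordered[OF pq pos m(1) s1 _ r]
      m(2)[OF s] m(2)[OF s1] by auto
  then show "u1 r = u r" "v1 r = v r" by auto
qed

text \<open>By uniqueness the second solution is the maximal one, which gives the order. Inserting
  this order into the integral equations shows that the initial gaps never shrink.\<close>

lemma sol_compare:
  assumes pq: "0 < p" "0 < q" and pos: "0 < \<xi>2" "0 < \<eta>2"
    and s1: "sol p q \<xi>1 \<eta>1 u1 v1" and s2: "sol p q \<xi>2 \<eta>2 u2 v2"
    and le: "\<xi>2 \<le> \<xi>1" "\<eta>1 \<le> \<eta>2" and r: "0 \<le> r"
  shows "\<xi>1 - \<xi>2 \<le> u1 r - u2 r" "\<eta>2 - \<eta>1 \<le> v2 r - v1 r"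
proof -
  obtain um vm where m: "sol p q \<xi>2 \<eta>2 um vm"
    "\<And>\<xi>1 \<eta>1 u1 v1 r. sol p q \<xi>1 \<eta>1 u1 v1 \<Longrightarrow> \<xi>2 \<le> \<xi>1 \<Longrightarrow> \<eta>1 \<le> \<eta>2 \<Longrightarrow> 0 \<le> r \<Longrightarrow> v1 r \<le> vm r"
    using sol_exists_max[OF pq] by blast
  have vle: "v1 t \<le> v2 t" if "0 \<le> t" for t
    using m(2)[OF s1 le that] sol_unique[OF pq pos m(1) s2 that] by simp
  have "pot (\<lambda>t. pw q (v1 t)) t \<le> pot (\<lambda>t. pw q (v2 t)) t" for t
    using vle pq by (intro pot_mono sol_adm[OF s1] sol_adm[OF s2] pw_mono) auto
  then have u: "\<xi>1 - \<xi>2 \<le> u1 t - u2 t" if "0 \<le> t" for t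
    using sol_eq(1)[OF s1 that] sol_eq(1)[OF s2 that] by (smt (verit))
  then show "\<xi>1 - \<xi>2 \<le> u1 r - u2 r" using r .
  have "u2 t \<le> u1 t" if "0 \<le> t" for t using u[OF that] le by simp
  then have "pot (\<lambda>t. pw p (u2 t)) r \<le> pot (\<lambda>t. pw p (u1 t)) r"
    using pq by (intro pot_mono sol_adm[OF s1] sol_adm[OF s2] pw_mono) auto
  then show "\<eta>2 - \<eta>1 \<le> v2 r - v1 r"
    using sol_eq(2)[OF s1 r] sol_eq(2)[OF s2 r] by simp
qed

text \<open>One function serves both components, the second being \<open>U q p \<eta> \<xi>\<close>
  by symmetry.\<close>

definition U :: "real \<Rightarrow> real \<Rightarrow> real \<Rightarrow> real \<Rightarrow> real \<Rightarrow> real" where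
  "U p q \<xi> \<eta> = (SOME u. \<exists>v. sol p q \<xi> \<eta> u v)"

text \<open>The two choices might stem from different solution pairs; uniqueness makes them agree on
  \<open>r \<ge> 0\<close>, and \<open>sol_cong\<close> ignores the negative radii.\<close>

lemma sol_U:
  assumes pq: "0 < p" "0 < q" and pos: "0 < \<xi>" "0 < \<eta>"
  shows "sol p q \<xi> \<eta> (U p q \<xi> \<eta>) (U q p \<eta> \<xi>)"
proof -
  have some: "\<exists>v. sol p q \<xi> \<eta> (U p q \<xi> \<eta>) v" if pq: "0 < p" "0 < q" for p q \<xi> \<eta>
  proof -
    obtain u v where "sol p q \<xi> \<eta> u v" by (rule sol_exists_max[OF pq])
    then have "\<exists>u v. sol p q \<xi> \<eta> u v" by blast
    then show ?thesis unfolding U_def by (rule someI_ex)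
  qed
  from some[OF pq] obtain v where v: "sol p q \<xi> \<eta> (U p q \<xi> \<eta>) v" by blast
  from some[OF pq(2,1)] obtain u where u: "sol p q \<xi> \<eta> u (U q p \<eta> \<xi>)" by (auto simp: sol_swap)
  show ?thesis
    by (rule sol_cong[OF v]) (use sol_unique(2)[OF pq pos v u] in auto)
qed

end

section \<open>Continuous dependence and limits at infinity\<close>

text \<open>An implicit function theorem from monotonicity: the intermediate value theorem in
  \<open>y\<close> defines the curve, in \<open>x\<close> makes it onto, and the curve is continuous
  because the signs of \<open>F\<close> slightly below and slightly above it persist for nearby
  \<open>x\<close>.\<close>

lemma zero_curve:
  fixes F :: "real \<Rightarrow> real \<Rightarrow> real"
  assumes inc: "\<And>x x' y. 0 < x \<Longrightarrow> x < x' \<Longrightarrow> 0 < y \<Longrightarrow> F x y < F x' y"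
    and dec: "\<And>x y y'. 0 < x \<Longrightarrow> 0 < y \<Longrightarrow> y < y' \<Longrightarrow> F x y' < F x y"
    and cont: "\<And>x y e. 0 < x \<Longrightarrow> 0 < y \<Longrightarrow> 0 < e \<Longrightarrow>
      \<exists>d>0. \<forall>x'>0. \<forall>y'>0. \<bar>x' - x\<bar> < d \<longrightarrow> \<bar>y' - y\<bar> < d \<longrightarrow> \<bar>F x' y' - F x y\<bar> < e"
    and ypos: "\<And>x. 0 < x \<Longrightarrow> \<exists>y>0. 0 < F x y" and yneg: "\<And>x. 0 < x \<Longrightarrow> \<exists>y>0. F x y < 0"
    and xpos: "\<And>y. 0 < y \<Longrightarrow> \<exists>x>0. 0 < F x y" and xneg: "\<And>y. 0 < y \<Longrightarrow> \<exists>x>0. F x y < 0"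
  obtains \<phi> where "\<And>x y. 0 < x \<Longrightarrow> 0 < y \<Longrightarrow> 0 < F x y \<longleftrightarrow> y < \<phi> x"
    "\<And>x y. 0 < x \<Longrightarrow> 0 < y \<Longrightarrow> F x y = 0 \<longleftrightarrow> y = \<phi> x"
    "continuous_on {0<..} \<phi>" "strict_mono_on {0<..} \<phi>" "bij_betw \<phi> {0<..} {0<..}"
proof -
  have cont_y: "continuous_on {0<..} (F x)" if x0: "0 < x" for x
    unfolding continuous_on_iff dist_real_def
  proof (intro ballI allI impI)
    fix y e :: real assume "y \<in> {0<..}" "0 < e"
    then obtain d where "d > 0" "\<forall>x'>0. \<forall>y'>0. \<bar>x' - x\<bar> < d \<longrightarrow> \<bar>y' - y\<bar> < d \<longrightarrow> \<bar>F x' y' - F x y\<bar> < e"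
      using cont[OF x0, of y e] by auto
    then show "\<exists>d>0. \<forall>y'\<in>{0<..}. \<bar>y' - y\<bar> < d \<longrightarrow> \<bar>F x y' - F x y\<bar> < e"
      using x0 by (intro exI[of _ d]) auto
  qed
  have cont_x: "continuous_on {0<..} (\<lambda>x. F x y)" if y0: "0 < y" for y
    unfolding continuous_on_iff dist_real_def
  proof (intro ballI allI impI)
    fix x e :: real assume "x \<in> {0<..}" "0 < e"
    then obtain d where "d > 0" "\<forall>x'>0. \<forall>y'>0. \<bar>x' - x\<bar> < d \<longrightarrow> \<bar>y' - y\<bar> < d \<longrightarrow> \<bar>F x' y' - F x y\<bar> < e"
      using cont[of x y e] y0 by auto
    then show "\<exists>d>0. \<forall>x'\<in>{0<..}. \<bar>x' - x\<bar> < d \<longrightarrow> \<bar>F x' y - F x y\<bar> < e"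
      using y0 by (intro exI[of _ d]) auto
  qed
  have "\<exists>y>0. F x y = 0" if x0: "0 < x" for x
  proof -
    obtain a b where ab: "0 < a" "0 < F x a" "0 < b" "F x b < 0" using ypos[OF x0] yneg[OF x0] by blast
    have "a \<le> b" using dec[OF x0 ab(3), of a] ab by (cases "a \<le> b") auto
    then have "\<exists>y\<ge>a. y \<le> b \<and> F x y = 0"
      using ab by (intro IVT2' continuous_on_subset[OF cont_y[OF x0]]) auto
    then show ?thesis using ab by (meson less_le_trans)
  qed
  then obtain \<phi> where \<phi>: "\<And>x. 0 < x \<Longrightarrow> 0 < \<phi> x" "\<And>x. 0 < x \<Longrightarrow> F x (\<phi> x) = 0" by metis
  have pos: "0 < F x y \<longleftrightarrow> y < \<phi> x" and zero: "F x y = 0 \<longleftrightarrow> y = \<phi> x" and neg: "F x y < 0 \<longleftrightarrow> \<phi> x < y"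
    if "0 < x" "0 < y" for x y
    using dec[OF that(1), of y "\<phi> x"] dec[OF that(1), of "\<phi> x" y] \<phi>[OF that(1)] that
    by (cases y "\<phi> x" rule: linorder_cases; force)+
  have mono: "strict_mono_on {0<..} \<phi>"
  proof (rule strict_mono_onI)
    fix r s :: real assume "r \<in> {0<..}" "s \<in> {0<..}" "r < s"
    then show "\<phi> r < \<phi> s" using inc[of r s "\<phi> r"] \<phi>[of r] pos[of s "\<phi> r"] by auto
  qed
  have "\<exists>x>0. F x y = 0" if y0: "0 < y" for y
  proof -
    obtain a b where ab: "0 < a" "F a y < 0" "0 < b" "0 < F b y" using xpos[OF y0] xneg[OF y0] by blast
    have "a \<le> b" using inc[OF ab(3) _ y0, of a] ab by (cases "a \<le> b") auto
    then have "\<exists>x\<ge>a. x \<le> b \<and> F x y = 0"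
      using ab by (intro IVT' continuous_on_subset[OF cont_x[OF y0]]) auto
    then show ?thesis using ab by (meson less_le_trans)
  qed
  then have "{0<..} \<subseteq> \<phi> ` {0<..}" using zero by (fastforce simp: image_iff)
  then have "bij_betw \<phi> {0<..} {0<..}"
    unfolding bij_betw_def using mono \<phi>(1) by (auto intro: strict_mono_on_imp_inj_on)
  moreover have "continuous_on {0<..} \<phi>"
    unfolding continuous_on_iff dist_real_def
  proof (intro ballI allI impI)
    fix x e :: real assume "x \<in> {0<..}" "0 < e"
    then have x: "0 < x" by simp
    \<comment> \<open>The entry \<open>\<phi> x / 2\<close> keeps \<open>a\<close> positive when
      \<open>e\<close> is large.\<close>
    define a where "a = max (\<phi> x / 2) (\<phi> x - e)"
    define b where "b = \<phi> x + e"
    have ab: "0 < a" "a < \<phi> x" "\<phi> x - e \<le> a" "\<phi> x < b" using \<phi>(1)[OF x] \<open>0 < e\<close> by (auto simp: a_def b_def)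
    have "0 < F x a" "F x b < 0" using pos[OF x, of a] neg[OF x, of b] ab by auto
    have b0: "0 < b" using ab by simp
    obtain d1 where d1: "d1 > 0" "\<forall>x'\<in>{0<..}. \<bar>x' - x\<bar> < d1 \<longrightarrow> \<bar>F x' a - F x a\<bar> < F x a"
      using cont_x[OF ab(1), unfolded continuous_on_iff dist_real_def, rule_format, of x "F x a"]
        x \<open>0 < F x a\<close> by auto
    obtain d2 where d2: "d2 > 0" "\<forall>x'\<in>{0<..}. \<bar>x' - x\<bar> < d2 \<longrightarrow> \<bar>F x' b - F x b\<bar> < - F x b"
      using cont_x[OF b0, unfolded continuous_on_iff dist_real_def, rule_format, of x "- F x b"]
        x \<open>F x b < 0\<close> by auto
    note d = d1(1) d2(1) d1(2) d2(2)
    show "\<exists>d>0. \<forall>x'\<in>{0<..}. \<bar>x' - x\<bar> < d \<longrightarrow> \<bar>\<phi> x' - \<phi> x\<bar> < e"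
    proof (intro exI[of _ "min d1 d2"] conjI ballI impI)
      fix x' assume x': "x' \<in> {0<..}" "\<bar>x' - x\<bar> < min d1 d2"
      then have "0 < F x' a" "F x' b < 0" using d(3,4)[rule_format, of x'] by auto
      then have "a < \<phi> x'" "\<phi> x' < b" using pos[of x' a] neg[of x' b] ab x' by auto
      then show "\<bar>\<phi> x' - \<phi> x\<bar> < e" using ab by (auto simp: b_def)
    qed (use d in auto)
  qed
  ultimately show thesis using that pos zero mono by blast
qed

text \<open>On a square \<open>F\<close> lies between its values at two opposite corners, so
  convergence along that diagonal already gives joint continuity.\<close>

lemma monotone_sandwich_continuity:
  fixes F :: "real \<Rightarrow> real \<Rightarrow> real"
  assumes mono: "\<And>x x' y y'. 0 < x \<Longrightarrow> x \<le> x' \<Longrightarrow> 0 < y' \<Longrightarrow> y' \<le> y \<Longrightarrow> F x y \<le> F x' y'"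
    and pos: "\<And>k. 0 < \<delta> k \<and> \<delta> k < x \<and> \<delta> k < y"
    and lower: "(\<lambda>k. F (x - \<delta> k) (y + \<delta> k)) \<longlonglongrightarrow> F x y"
    and upper: "(\<lambda>k. F (x + \<delta> k) (y - \<delta> k)) \<longlonglongrightarrow> F x y"
    and e: "0 < e"
  shows "\<exists>d>0. \<forall>x'>0. \<forall>y'>0. \<bar>x' - x\<bar> < d \<longrightarrow> \<bar>y' - y\<bar> < d \<longrightarrow> \<bar>F x' y' - F x y\<bar> < e"
proof -
  have "eventually (\<lambda>k. F x y - e < F (x - \<delta> k) (y + \<delta> k) \<and> F (x + \<delta> k) (y - \<delta> k) < F x y + e) sequentially"
    using order_tendstoD(1)[OF lower, of "F x y - e"] order_tendstoD(2)[OF upper, of "F x y + e"] e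
    by (auto intro: eventually_conj)
  then obtain k where k: "F x y - e < F (x - \<delta> k) (y + \<delta> k)" "F (x + \<delta> k) (y - \<delta> k) < F x y + e"
    using eventually_happens'[OF trivial_limit_sequentially] by fast
  show ?thesis
  proof (intro exI[of _ "\<delta> k"] conjI allI impI)
    fix x' y' :: real assume *: "0 < x'" "0 < y'" "\<bar>x' - x\<bar> < \<delta> k" "\<bar>y' - y\<bar> < \<delta> k"
    have "F (x - \<delta> k) (y + \<delta> k) \<le> F x' y'" using * pos[of k] by (intro mono) auto
    moreover have "F x' y' \<le> F (x + \<delta> k) (y - \<delta> k)" using * pos[of k] by (intro mono) auto
    ultimately show "\<bar>F x' y' - F x y\<bar> < e" using k by linarith
  qed (use pos in auto)
qed

context radial_weight
begin

lemma U_eq: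
  assumes "0 < p" "0 < q" "0 < \<xi>" "0 < \<eta>" "0 \<le> r"
  shows "U p q \<xi> \<eta> r = \<xi> - pot (\<lambda>t. pw q (U q p \<eta> \<xi> t)) r"
  using sol_eq[OF sol_U] assms by simp

lemma U_compare:
  assumes "0 < p" "0 < q" "0 < \<xi>2" "0 < \<eta>1" "\<xi>2 \<le> \<xi>1" "\<eta>1 \<le> \<eta>2" "0 \<le> r"
  shows "\<xi>1 - \<xi>2 \<le> U p q \<xi>1 \<eta>1 r - U p q \<xi>2 \<eta>2 r"
  using sol_compare(1)[OF _ _ _ _ sol_U sol_U, of p q \<xi>2 \<eta>2 \<xi>1 \<eta>1 r] assms by simp

section \<open>The limits at infinity as functions of the data\<close>

definition LU :: "real \<Rightarrow> real \<Rightarrow> real \<Rightarrow> real \<Rightarrow> real" where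
  "LU p q \<xi> \<eta> = (THE l. (U p q \<xi> \<eta> \<longlongrightarrow> l) at_top)"

lemma LU_props:
  assumes pq: "0 < p" "0 < q" and pos: "0 < \<xi>" "0 < \<eta>"
  shows "(U p q \<xi> \<eta> \<longlongrightarrow> LU p q \<xi> \<eta>) at_top"
    and "0 \<le> r \<Longrightarrow> LU p q \<xi> \<eta> \<le> U p q \<xi> \<eta> r"
    and "0 \<le> r \<Longrightarrow> U p q \<xi> \<eta> r - pw q \<eta> * (Tinf - T r) \<le> LU p q \<xi> \<eta>"
proof -
  define h where "h = (\<lambda>t. pw q (U q p \<eta> \<xi> t))"
  note s = sol_U[OF pq pos]
  have s': "sol q p \<eta> \<xi> (U q p \<eta> \<xi>) (U p q \<xi> \<eta>)" using s by (simp add: sol_swap)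
  have h: "adm h" "\<And>t. 0 \<le> t \<Longrightarrow> 0 \<le> h t" "\<And>t. 0 \<le> t \<Longrightarrow> h t \<le> pw q \<eta>" "0 \<le> pw q \<eta>"
    unfolding h_def using sol_adm[OF s] sol_pw_le[OF pq(2) s'] by auto
  obtain l where l: "(pot h \<longlongrightarrow> l) at_top" "\<And>r. 0 \<le> r \<Longrightarrow> pot h r \<le> l"
    "\<And>r. 0 \<le> r \<Longrightarrow> l - pot h r \<le> pw q \<eta> * (Tinf - T r)"
    using pot_limit[OF h] by blast
  have eq: "U p q \<xi> \<eta> r = \<xi> - pot h r" if "0 \<le> r" for r
    using U_eq[OF pq pos that] by (simp add: h_def)
  have lim: "(U p q \<xi> \<eta> \<longlongrightarrow> \<xi> - l) at_top"
  proof (rule Lim_transform_eventually)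
    show "((\<lambda>r. \<xi> - pot h r) \<longlongrightarrow> \<xi> - l) at_top" by (intro tendsto_intros l)
    show "eventually (\<lambda>r. \<xi> - pot h r = U p q \<xi> \<eta> r) at_top"
      using eq by (intro eventually_at_top_linorderI[of 0]) simp
  qed
  have L: "LU p q \<xi> \<eta> = \<xi> - l"
    unfolding LU_def by (intro the_equality lim tendsto_unique[OF trivial_limit_at_top_linorder _ lim])
  show "(U p q \<xi> \<eta> \<longlongrightarrow> LU p q \<xi> \<eta>) at_top" unfolding L by (rule lim)
  show "LU p q \<xi> \<eta> \<le> U p q \<xi> \<eta> r" if "0 \<le> r"
    using l(2)[OF that] eq[OF that] L by simp
  show "U p q \<xi> \<eta> r - pw q \<eta> * (Tinf - T r) \<le> LU p q \<xi> \<eta>" if "0 \<le> r"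
    using l(3)[OF that] eq[OF that] L by simp
qed

lemma LU_compare:
  assumes "0 < p" "0 < q" "0 < \<xi>2" "0 < \<eta>1" "\<xi>2 \<le> \<xi>1" "\<eta>1 \<le> \<eta>2"
  shows "\<xi>1 - \<xi>2 \<le> LU p q \<xi>1 \<eta>1 - LU p q \<xi>2 \<eta>2"
proof (rule tendsto_lowerbound[OF _ _ trivial_limit_at_top_linorder])
  show "((\<lambda>r. U p q \<xi>1 \<eta>1 r - U p q \<xi>2 \<eta>2 r) \<longlongrightarrow> LU p q \<xi>1 \<eta>1 - LU p q \<xi>2 \<eta>2) at_top"
    using assms by (intro tendsto_diff LU_props(1)) auto
  show "eventually (\<lambda>r. \<xi>1 - \<xi>2 \<le> U p q \<xi>1 \<eta>1 r - U p q \<xi>2 \<eta>2 r) at_top"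
    using U_compare assms by (intro eventually_at_top_linorderI[of 0]) auto
qed

text \<open>Strictness survives the limit because the gap between the two solutions is
  \<open>pot h r\<close>, positive at \<open>r = 1\<close> and nondecreasing in
  \<open>r\<close>.\<close>

lemma LU_strict_dec:
  assumes pq: "0 < p" "0 < q" and pos: "0 < \<xi>" "0 < \<eta>1" "\<eta>1 < \<eta>2"
  shows "LU p q \<xi> \<eta>2 < LU p q \<xi> \<eta>1"
proof -
  have pos2: "0 < \<eta>2" using pos by simp
  define h where "h = (\<lambda>t. pw q (U q p \<eta>2 \<xi> t) - pw q (U q p \<eta>1 \<xi> t))"
  note s1 = sol_U[OF pq pos(1,2)] and s2 = sol_U[OF pq pos(1) pos2]
  have s1': "sol q p \<eta>1 \<xi> (U q p \<eta>1 \<xi>) (U p q \<xi> \<eta>1)" and s2': "sol q p \<eta>2 \<xi> (U q p \<eta>2 \<xi>) (U p q \<xi> \<eta>2)"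
    using s1 s2 by (simp_all add: sol_swap)
  have h: "adm h" unfolding h_def using sol_adm(1)[OF s1] sol_adm(1)[OF s2] by (rule adm_minus[rotated])
  have h0: "0 \<le> h t" if "0 \<le> t" for t
    unfolding h_def using U_compare[OF pq(2,1) pos(2,1) _ _ that, of \<eta>2 \<xi>] pq pos
    by (simp add: pw_mono)
  have hc: "continuous_on {0..} h" unfolding h_def
    by (intro continuous_intros continuous_on_compose2[OF continuous_pw[OF pq(2), of UNIV]]
        sol_cont[OF s1'] sol_cont[OF s2']) auto
  have "0 < h 0" unfolding h_def using sol_0[OF s1'] sol_0[OF s2'] pw_strict_mono[OF pq(2) pos(3) pos2] by simp
  then have P: "0 < pot h 1" using pot_strict_mono_arg[OF h h0 hc, of 0 1] by simp
  have diff: "U p q \<xi> \<eta>1 r - U p q \<xi> \<eta>2 r = pot h r" if "0 \<le> r" for r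
    using sol_eq(1)[OF s1 that] sol_eq(1)[OF s2 that] sol_adm(1)[OF s1] sol_adm(1)[OF s2]
    by (simp add: h_def pot_diff)
  have "pot h 1 \<le> LU p q \<xi> \<eta>1 - LU p q \<xi> \<eta>2"
  proof (rule tendsto_lowerbound[OF _ _ trivial_limit_at_top_linorder])
    show "((\<lambda>r. U p q \<xi> \<eta>1 r - U p q \<xi> \<eta>2 r) \<longlongrightarrow> LU p q \<xi> \<eta>1 - LU p q \<xi> \<eta>2) at_top"
      using assms by (intro tendsto_diff LU_props(1)) auto
    show "eventually (\<lambda>r. pot h 1 \<le> U p q \<xi> \<eta>1 r - U p q \<xi> \<eta>2 r) at_top"
      using diff pot_mono_arg[OF h h0] by (intro eventually_at_top_linorderI[of 1]) auto
  qed
  then show ?thesis using P by simp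
qed

lemma LU_ge:
  assumes pq: "0 < p" "0 < q" and pos: "0 < \<xi>" "0 < \<eta>"
  shows "\<xi> - pw q \<eta> * Tinf \<le> LU p q \<xi> \<eta>"
  using LU_props(3)[OF pq pos, of 0] sol_0[OF sol_U[OF pq pos]] by simp

text \<open>The second component never falls below \<open>\<eta> - pw p \<xi> * Tinf\<close>; this
  constant, fed into the equation for the first, bounds its total loss from below.\<close>

lemma LU_le:
  assumes pq: "0 < p" "0 < q" and pos: "0 < \<xi>" "0 < \<eta>"
  shows "LU p q \<xi> \<eta> \<le> \<xi> - pw q (\<eta> - pw p \<xi> * Tinf) * Tinf"
proof -
  define c where "c = pw q (\<eta> - pw p \<xi> * Tinf)"
  note s = sol_U[OF pq pos]
  have "\<eta> - pw p \<xi> * Tinf \<le> U q p \<eta> \<xi> t" if "0 \<le> t" for t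
    using LU_ge[OF pq(2,1) pos(2,1)] LU_props(2)[OF pq(2,1) pos(2,1) that] by simp
  then have "pot (\<lambda>_. c) r \<le> pot (\<lambda>t. pw q (U q p \<eta> \<xi> t)) r" for r
    unfolding c_def using pq by (intro pot_mono sol_adm[OF s] pw_mono) auto
  then have le: "U p q \<xi> \<eta> r \<le> \<xi> - c * T r" if "0 \<le> r" for r
    using U_eq[OF pq pos that] by (simp add: pot_const[of c])
  have "LU p q \<xi> \<eta> \<le> \<xi> - c * Tinf"
  proof (rule tendsto_le[OF trivial_limit_at_top_linorder _ LU_props(1)[OF pq pos]])
    show "((\<lambda>r. \<xi> - c * T r) \<longlongrightarrow> \<xi> - c * Tinf) at_top" by (intro tendsto_intros T_tendsto)
    show "eventually (\<lambda>r. U p q \<xi> \<eta> r \<le> \<xi> - c * T r) at_top"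
      using le by (intro eventually_at_top_linorderI[of 0]) auto
  qed
  then show ?thesis by (simp add: c_def)
qed

lemma sol_limit:
  fixes u v :: "nat \<Rightarrow> real \<Rightarrow> real"
  assumes pq: "0 < p" "0 < q"
    and s: "\<And>k. sol p q (x k) (y k) (u k) (v k)"
    and lim: "x \<longlonglongrightarrow> \<xi>" "y \<longlonglongrightarrow> \<eta>"
    and limu: "\<And>r. 0 \<le> r \<Longrightarrow> (\<lambda>k. u k r) \<longlonglongrightarrow> ul r"
    and limv: "\<And>r. 0 \<le> r \<Longrightarrow> (\<lambda>k. v k r) \<longlonglongrightarrow> vl r"
    and bd: "\<And>k. x k \<le> X" "\<And>k. y k \<le> Y"
  shows "sol p q \<xi> \<eta> ul vl"
proof -
  have s': "sol q p (y k) (x k) (v k) (u k)" for k using s by (simp add: sol_swap)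
  have D1: "adm (\<lambda>t. pw q (vl t))" "\<And>r. 0 \<le> r \<Longrightarrow> (\<lambda>k. pot (\<lambda>t. pw q (v k t)) r) \<longlonglongrightarrow> pot (\<lambda>t. pw q (vl t)) r"
  proof -
    have a: "\<And>k. adm (\<lambda>t. pw q (v k t))" using sol_adm[OF s] by simp
    have b: "\<bar>pw q (v k t)\<bar> \<le> pw q Y" if "0 \<le> t" for k t
      using sol_le[OF s' that, of k] bd(2)[of k] pq by (simp add: pw_mono)
    have c: "(\<lambda>k. pw q (v k t)) \<longlonglongrightarrow> pw q (vl t)" if "0 \<le> t" for t
      by (intro tendsto_pw pq limv that)
    show "adm (\<lambda>t. pw q (vl t))" "\<And>r. 0 \<le> r \<Longrightarrow> (\<lambda>k. pot (\<lambda>t. pw q (v k t)) r) \<longlonglongrightarrow> pot (\<lambda>t. pw q (vl t)) r"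
      by (rule dominated[of "\<lambda>k t. pw q (v k t)" "pw q Y"]; use a b c in blast)+
  qed
  have D2: "adm (\<lambda>t. pw p (ul t))" "\<And>r. 0 \<le> r \<Longrightarrow> (\<lambda>k. pot (\<lambda>t. pw p (u k t)) r) \<longlonglongrightarrow> pot (\<lambda>t. pw p (ul t)) r"
  proof -
    have a: "\<And>k. adm (\<lambda>t. pw p (u k t))" using sol_adm[OF s] by simp
    have b: "\<bar>pw p (u k t)\<bar> \<le> pw p X" if "0 \<le> t" for k t
      using sol_le[OF s that, of k] bd(1)[of k] pq by (simp add: pw_mono)
    have c: "(\<lambda>k. pw p (u k t)) \<longlonglongrightarrow> pw p (ul t)" if "0 \<le> t" for t
      by (intro tendsto_pw pq limu that)
    show "adm (\<lambda>t. pw p (ul t))" "\<And>r. 0 \<le> r \<Longrightarrow> (\<lambda>k. pot (\<lambda>t. pw p (u k t)) r) \<longlonglongrightarrow> pot (\<lambda>t. pw p (ul t)) r"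
      by (rule dominated[of "\<lambda>k t. pw p (u k t)" "pw p X"]; use a b c in blast)+
  qed
  have "ul r = \<xi> - pot (\<lambda>t. pw q (vl t)) r" if "0 \<le> r" for r
  proof (rule LIMSEQ_unique[OF limu[OF that]])
    have "(\<lambda>k. x k - pot (\<lambda>t. pw q (v k t)) r) \<longlonglongrightarrow> \<xi> - pot (\<lambda>t. pw q (vl t)) r"
      by (intro tendsto_intros lim D1(2) that)
    then show "(\<lambda>k. u k r) \<longlonglongrightarrow> \<xi> - pot (\<lambda>t. pw q (vl t)) r"
      by (simp add: sol_eq(1)[OF s that])
  qed
  moreover have "vl r = \<eta> - pot (\<lambda>t. pw p (ul t)) r" if "0 \<le> r" for r
  proof (rule LIMSEQ_unique[OF limv[OF that]])
    have "(\<lambda>k. y k - pot (\<lambda>t. pw p (u k t)) r) \<longlonglongrightarrow> \<eta> - pot (\<lambda>t. pw p (ul t)) r"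
      by (intro tendsto_intros lim D2(2) that)
    then show "(\<lambda>k. v k r) \<longlonglongrightarrow> \<eta> - pot (\<lambda>t. pw p (ul t)) r"
      by (simp add: sol_eq(2)[OF s that])
  qed
  ultimately show ?thesis unfolding sol_def using D1(1) D2(1) by blast
qed

lemma shift_sequence:
  assumes "0 < \<xi>" "0 < \<eta>"
  obtains \<delta> :: "nat \<Rightarrow> real" where "decseq \<delta>" "\<delta> \<longlonglongrightarrow> 0" "\<And>k. 0 < \<delta> k \<and> \<delta> k < \<xi> \<and> \<delta> k < \<eta>"
proof (rule that)
  define m where "m = min \<xi> \<eta> / 2"
  have m: "0 < m" "m < \<xi>" "m < \<eta>" using assms by (auto simp: m_def)
  show "decseq (\<lambda>k. m / real (Suc k))"
    using m by (intro decseq_SucI divide_left_mono) auto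
  show "(\<lambda>k. m / real (Suc k)) \<longlonglongrightarrow> 0"
    using tendsto_mult_right_zero[OF LIMSEQ_inverse_real_of_nat, of m] by (simp add: divide_inverse)
  show "0 < m / real (Suc k) \<and> m / real (Suc k) < \<xi> \<and> m / real (Suc k) < \<eta>" for k
  proof -
    have "m / real (Suc k) \<le> m / 1" using m by (intro divide_left_mono) auto
    then show ?thesis using m by simp
  qed
qed

text \<open>Along this diagonal both components are monotone in \<open>k\<close> and bounded, hence
  converge; the limit solves the system, and uniqueness identifies it. The opposite diagonal is the
  second claim with the roles exchanged.\<close>

lemma U_diagonal_limit:
  assumes pq: "0 < p" "0 < q" and pos: "0 < \<xi>" "0 < \<eta>" and \<delta>: "decseq \<delta>" "\<delta> \<longlonglongrightarrow> 0" "\<And>k. 0 < \<delta> k \<and> \<delta> k < \<xi>"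
    and r: "0 \<le> r"
  shows "(\<lambda>k. U p q (\<xi> - \<delta> k) (\<eta> + \<delta> k) r) \<longlonglongrightarrow> U p q \<xi> \<eta> r"
    "(\<lambda>k. U q p (\<eta> + \<delta> k) (\<xi> - \<delta> k) r) \<longlonglongrightarrow> U q p \<eta> \<xi> r"
proof -
  have xy: "0 < \<xi> - \<delta> k" "0 < \<eta> + \<delta> k" for k using \<delta>(3)[of k] pos by auto
  have dm: "\<delta> (Suc k) \<le> \<delta> k" for k using \<delta>(1) by (simp add: decseq_Suc_iff)
  have "\<exists>l. (\<lambda>k. U p q (\<xi> - \<delta> k) (\<eta> + \<delta> k) r) \<longlonglongrightarrow> l" if "0 \<le> r" for r
  proof -
    have "incseq (\<lambda>k. U p q (\<xi> - \<delta> k) (\<eta> + \<delta> k) r)"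
    proof (rule incseq_SucI)
      fix k
      show "U p q (\<xi> - \<delta> k) (\<eta> + \<delta> k) r \<le> U p q (\<xi> - \<delta> (Suc k)) (\<eta> + \<delta> (Suc k)) r"
        using U_compare[OF pq xy(1)[of k] xy(2)[of "Suc k"] _ _ that, of "\<xi> - \<delta> (Suc k)" "\<eta> + \<delta> k"] dm[of k] by simp
    qed
    moreover have "U p q (\<xi> - \<delta> k) (\<eta> + \<delta> k) r \<le> U p q \<xi> \<eta> r" for k
      using U_compare[OF pq xy(1)[of k] pos(2) _ _ that, of \<xi> "\<eta> + \<delta> k"] \<delta>(3)[of k] by simp
    ultimately show ?thesis
      using incseq_convergent[of "\<lambda>k. U p q (\<xi> - \<delta> k) (\<eta> + \<delta> k) r" "U p q \<xi> \<eta> r"] by blast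
  qed
  then obtain ul where ul: "\<And>r. 0 \<le> r \<Longrightarrow> (\<lambda>k. U p q (\<xi> - \<delta> k) (\<eta> + \<delta> k) r) \<longlonglongrightarrow> ul r" by metis
  have "\<exists>l. (\<lambda>k. U q p (\<eta> + \<delta> k) (\<xi> - \<delta> k) r) \<longlonglongrightarrow> l" if "0 \<le> r" for r
  proof -
    have "decseq (\<lambda>k. U q p (\<eta> + \<delta> k) (\<xi> - \<delta> k) r)"
    proof (rule decseq_SucI)
      fix k
      show "U q p (\<eta> + \<delta> (Suc k)) (\<xi> - \<delta> (Suc k)) r \<le> U q p (\<eta> + \<delta> k) (\<xi> - \<delta> k) r"
        using U_compare[OF pq(2,1) xy(2)[of "Suc k"] xy(1)[of k] _ _ that, of "\<eta> + \<delta> k" "\<xi> - \<delta> (Suc k)"] dm[of k] by simp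
    qed
    moreover have "U q p \<eta> \<xi> r \<le> U q p (\<eta> + \<delta> k) (\<xi> - \<delta> k) r" for k
      using U_compare[OF pq(2,1) pos(2) xy(1)[of k] _ _ that, of "\<eta> + \<delta> k" \<xi>] \<delta>(3)[of k] by simp
    ultimately show ?thesis
      using decseq_convergent[of "\<lambda>k. U q p (\<eta> + \<delta> k) (\<xi> - \<delta> k) r" "U q p \<eta> \<xi> r"] by blast
  qed
  then obtain vl where vl: "\<And>r. 0 \<le> r \<Longrightarrow> (\<lambda>k. U q p (\<eta> + \<delta> k) (\<xi> - \<delta> k) r) \<longlonglongrightarrow> vl r" by metis
  have "sol p q \<xi> \<eta> ul vl"
  proof (rule sol_limit[OF pq sol_U[OF pq xy] _ _ ul vl])
    show "(\<lambda>k. \<xi> - \<delta> k) \<longlonglongrightarrow> \<xi>" "(\<lambda>k. \<eta> + \<delta> k) \<longlonglongrightarrow> \<eta>"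
      using tendsto_diff[OF tendsto_const \<delta>(2), of \<xi>] tendsto_add[OF tendsto_const \<delta>(2), of \<eta>] by auto
    show "\<xi> - \<delta> k \<le> \<xi>" for k using \<delta>(3)[of k] by simp
    show "\<eta> + \<delta> k \<le> \<eta> + \<delta> 0" for k using \<delta>(1) by (simp add: decseqD)
  qed
  from sol_unique[OF pq pos sol_U[OF pq pos] this r]
  show "(\<lambda>k. U p q (\<xi> - \<delta> k) (\<eta> + \<delta> k) r) \<longlonglongrightarrow> U p q \<xi> \<eta> r"
    "(\<lambda>k. U q p (\<eta> + \<delta> k) (\<xi> - \<delta> k) r) \<longlonglongrightarrow> U q p \<eta> \<xi> r"
    using ul[OF r] vl[OF r] by auto
qed

lemma U_continuity:
  assumes pq: "0 < p" "0 < q" and pos: "0 < \<xi>" "0 < \<eta>" and r: "0 \<le> r" and e: "0 < e"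
  shows "\<exists>d>0. \<forall>x'>0. \<forall>y'>0. \<bar>x' - \<xi>\<bar> < d \<longrightarrow> \<bar>y' - \<eta>\<bar> < d \<longrightarrow> \<bar>U p q x' y' r - U p q \<xi> \<eta> r\<bar> < e"
proof -
  obtain \<delta> :: "nat \<Rightarrow> real" where \<delta>: "decseq \<delta>" "\<delta> \<longlonglongrightarrow> 0" "\<And>k. 0 < \<delta> k \<and> \<delta> k < \<xi> \<and> \<delta> k < \<eta>"
    using shift_sequence[OF pos] by blast
  show ?thesis
  proof (rule monotone_sandwich_continuity[where F = "\<lambda>x y. U p q x y r" and \<delta> = \<delta>])
    show "U p q x y r \<le> U p q x' y' r" if "0 < x" "x \<le> x'" "0 < y'" "y' \<le> y" for x x' y y'
      using U_compare[OF pq that(1,3,2,4) r] that by simp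
    show "(\<lambda>k. U p q (\<xi> - \<delta> k) (\<eta> + \<delta> k) r) \<longlonglongrightarrow> U p q \<xi> \<eta> r"
      using U_diagonal_limit(1)[OF pq pos \<delta>(1,2) _ r] \<delta>(3) by simp
    show "(\<lambda>k. U p q (\<xi> + \<delta> k) (\<eta> - \<delta> k) r) \<longlonglongrightarrow> U p q \<xi> \<eta> r"
      using U_diagonal_limit(2)[OF pq(2,1) pos(2,1) \<delta>(1,2) _ r] \<delta>(3) by simp
  qed (use \<delta> e in auto)
qed

text \<open>Convergence at a fixed large radius suffices, since \<open>y k \<le> Y\<close> makes the
  tails uniformly small.\<close>

lemma LU_limit:
  fixes x y :: "nat \<Rightarrow> real"
  assumes pq: "0 < p" "0 < q" and pos: "0 < \<xi>" "0 < \<eta>" "\<And>k. 0 < x k" "\<And>k. 0 < y k" "\<And>k. y k \<le> Y" "\<eta> \<le> Y"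
    and lim: "\<And>r. 0 \<le> r \<Longrightarrow> (\<lambda>k. U p q (x k) (y k) r) \<longlonglongrightarrow> U p q \<xi> \<eta> r"
  shows "(\<lambda>k. LU p q (x k) (y k)) \<longlonglongrightarrow> LU p q \<xi> \<eta>"
proof (rule LIMSEQ_I)
  fix e :: real assume e: "0 < e"
  have "((\<lambda>r. pw q Y * (Tinf - T r)) \<longlongrightarrow> pw q Y * (Tinf - Tinf)) at_top"
    by (intro tendsto_intros T_tendsto)
  then have "eventually (\<lambda>r. pw q Y * (Tinf - T r) < e / 2 \<and> 0 \<le> r) at_top"
    using e by (intro eventually_conj order_tendstoD(2) eventually_ge_at_top) auto
  then obtain R where R: "pw q Y * (Tinf - T R) < e / 2" "0 \<le> R"
    using eventually_happens'[OF trivial_limit_at_top_linorder] by fast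
  have tail: "pw q z * (Tinf - T R) \<le> pw q Y * (Tinf - T R)" if "z \<le> Y" for z
    using T_le_Tinf[OF R(2)] pq that by (intro mult_right_mono pw_mono) auto
  obtain N where N: "\<And>k. N \<le> k \<Longrightarrow> \<bar>U p q (x k) (y k) R - U p q \<xi> \<eta> R\<bar> < e / 2"
    using LIMSEQ_D[OF lim[OF R(2)], of "e/2"] e by auto
  show "\<exists>N. \<forall>k\<ge>N. norm (LU p q (x k) (y k) - LU p q \<xi> \<eta>) < e"
  proof (intro exI[of _ N] allI impI)
    fix k assume "N \<le> k"
    then show "norm (LU p q (x k) (y k) - LU p q \<xi> \<eta>) < e"
      using N[of k] tail[of "y k"] tail[of \<eta>] pos(5)[of k] pos(6) R
        LU_props(2,3)[OF pq pos(3,4) R(2), of k k] LU_props(2,3)[OF pq pos(1,2) R(2)]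
      unfolding real_norm_def by linarith
  qed
qed

lemma LU_continuity:
  assumes pq: "0 < p" "0 < q" and pos: "0 < \<xi>" "0 < \<eta>" and e: "0 < e"
  shows "\<exists>d>0. \<forall>x'>0. \<forall>y'>0. \<bar>x' - \<xi>\<bar> < d \<longrightarrow> \<bar>y' - \<eta>\<bar> < d \<longrightarrow> \<bar>LU p q x' y' - LU p q \<xi> \<eta>\<bar> < e"
proof -
  obtain \<delta> :: "nat \<Rightarrow> real" where \<delta>: "decseq \<delta>" "\<delta> \<longlonglongrightarrow> 0" "\<And>k. 0 < \<delta> k \<and> \<delta> k < \<xi> \<and> \<delta> k < \<eta>"
    using shift_sequence[OF pos] by blast
  have xy: "0 < \<xi> - \<delta> k" "0 < \<eta> + \<delta> k" "0 < \<xi> + \<delta> k" "0 < \<eta> - \<delta> k" for k using \<delta>(3)[of k] pos by auto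
  have le: "\<eta> + \<delta> k \<le> \<eta> + \<delta> 0" "\<eta> - \<delta> k \<le> \<eta>" "\<eta> \<le> \<eta> + \<delta> 0" for k
    using \<delta>(1) \<delta>(3)[of k] \<delta>(3)[of 0] by (auto simp: decseqD)
  show ?thesis
  proof (rule monotone_sandwich_continuity[where \<delta> = \<delta>])
    show "LU p q x y \<le> LU p q x' y'" if "0 < x" "x \<le> x'" "0 < y'" "y' \<le> y" for x x' y y'
      using LU_compare[OF pq that(1,3,2,4)] that by simp
    show "(\<lambda>k. LU p q (\<xi> - \<delta> k) (\<eta> + \<delta> k)) \<longlonglongrightarrow> LU p q \<xi> \<eta>"
    proof (rule LU_limit[OF pq pos xy(1,2) le(1,3)])
      show "(\<lambda>k. U p q (\<xi> - \<delta> k) (\<eta> + \<delta> k) r) \<longlonglongrightarrow> U p q \<xi> \<eta> r" if "0 \<le> r" for r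
        using U_diagonal_limit(1)[OF pq pos \<delta>(1,2) _ that] \<delta>(3) by simp
    qed
    show "(\<lambda>k. LU p q (\<xi> + \<delta> k) (\<eta> - \<delta> k)) \<longlonglongrightarrow> LU p q \<xi> \<eta>"
    proof (rule LU_limit[OF pq pos xy(3,4) le(2) order.refl])
      show "(\<lambda>k. U p q (\<xi> + \<delta> k) (\<eta> - \<delta> k) r) \<longlonglongrightarrow> U p q \<xi> \<eta> r" if "0 \<le> r" for r
        using U_diagonal_limit(2)[OF pq(2,1) pos(2,1) \<delta>(1,2) _ that] \<delta>(3) by simp
    qed
  qed (use \<delta> e in auto)
qed

lemma pw_small:
  assumes "0 < p" "0 < c"
  obtains x where "0 < x" "pw p x * Tinf < c"
proof -
  have "((\<lambda>x. pw p x * Tinf) \<longlongrightarrow> pw p 0 * Tinf) (at_right 0)"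
    by (intro tendsto_intros tendsto_pw assms)
  then have "eventually (\<lambda>x. pw p x * Tinf < c) (at_right 0)"
    using assms by (intro order_tendstoD(2)) auto
  then have "eventually (\<lambda>x. pw p x * Tinf < c \<and> 0 < x) (at_right 0)"
    by (intro eventually_conj eventually_at_right_less)
  then show thesis using that eventually_happens'[OF trivial_limit_at_right_real] by blast
qed

lemma LU_signs:
  assumes pq: "0 < p" "0 < q"
  shows "0 < \<xi> \<Longrightarrow> \<exists>\<eta>>0. 0 < LU p q \<xi> \<eta>" "0 < \<xi> \<Longrightarrow> \<exists>\<eta>>0. LU p q \<xi> \<eta> < 0"
    "0 < \<eta> \<Longrightarrow> \<exists>\<xi>>0. 0 < LU p q \<xi> \<eta>" "0 < \<eta> \<Longrightarrow> \<exists>\<xi>>0. LU p q \<xi> \<eta> < 0"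
proof -
  show "\<exists>\<eta>>0. 0 < LU p q \<xi> \<eta>" if \<xi>: "0 < \<xi>"
  proof -
    obtain \<eta> where "0 < \<eta>" "pw q \<eta> * Tinf < \<xi>" using pw_small[OF pq(2) \<xi>] by blast
    then show ?thesis using LU_ge[OF pq \<xi>, of \<eta>] by (intro exI[of _ \<eta>]) auto
  qed
  show "\<exists>\<eta>>0. LU p q \<xi> \<eta> < 0" if \<xi>: "0 < \<xi>"
  proof -
    \<comment> \<open>Chosen so that the loss \<open>pw q c * Tinf\<close> exceeds
      \<open>\<xi>\<close>; adding \<open>pw p \<xi> * Tinf\<close> to the datum then cancels the
      subtraction in \<open>LU_le\<close>.\<close>
    define c where "c = ((\<xi> + 1) / Tinf) powr (1 / q)"
    have c: "0 < c" "pw q c * Tinf = \<xi> + 1"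
      using \<xi> Tinf_pos pq by (auto simp: c_def pw_pos_eq powr_powr)
    have "0 < c + pw p \<xi> * Tinf" using c Tinf_pos by (simp add: add_pos_nonneg)
    then show ?thesis
      using LU_le[OF pq \<xi>, of "c + pw p \<xi> * Tinf"] c by (intro exI[of _ "c + pw p \<xi> * Tinf"]) auto
  qed
  show "\<exists>\<xi>>0. 0 < LU p q \<xi> \<eta>" if \<eta>: "0 < \<eta>"
  proof -
    have "0 < pw q \<eta> * Tinf + 1" using Tinf_pos by (simp add: add_nonneg_pos)
    then show ?thesis using LU_ge[OF pq _ \<eta>, of "pw q \<eta> * Tinf + 1"] by (intro exI[of _ "pw q \<eta> * Tinf + 1"]) auto
  qed
  show "\<exists>\<xi>>0. LU p q \<xi> \<eta> < 0" if \<eta>: "0 < \<eta>"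
  proof -
    have c: "0 < pw q (\<eta> / 2) * Tinf" using \<eta> Tinf_pos by (simp add: pw_pos)
    obtain x where x: "0 < x" "pw p x * Tinf < \<eta> / 2" using pw_small[OF pq(1), of "\<eta>/2"] \<eta> by auto
    \<comment> \<open>Small enough to keep the second component above \<open>\<eta> / 2\<close>, and
      less than the loss \<open>pw q (\<eta> / 2) * Tinf\<close> which this forces on the
      first.\<close>
    define \<xi> where "\<xi> = min x (pw q (\<eta> / 2) * Tinf / 2)"
    have \<xi>: "0 < \<xi>" "\<xi> \<le> x" "\<xi> < pw q (\<eta> / 2) * Tinf" using x c by (auto simp: \<xi>_def)
    have "pw p \<xi> * Tinf \<le> pw p x * Tinf" using \<xi> pq Tinf_pos by (intro mult_right_mono pw_mono) auto
    then have "\<eta> / 2 \<le> \<eta> - pw p \<xi> * Tinf" using x by linarith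
    then have "pw q (\<eta> / 2) * Tinf \<le> pw q (\<eta> - pw p \<xi> * Tinf) * Tinf"
      using pq Tinf_pos by (intro mult_right_mono pw_mono) auto
    then show ?thesis using LU_le[OF pq \<xi>(1) \<eta>] \<xi> by (intro exI[of _ \<xi>]) auto
  qed
qed

end

section \<open>The Pohozaev function\<close>

text \<open>From \<open>x 0 \<ge> M\<close> the sequence would grow at least like
  \<open>M * \<Lambda> ^ j\<close>. The bound \<open>K\<close> is quantified after \<open>M\<close>,
  so it may depend on the sequence.\<close>

lemma superlinear_recursion_unbounded:
  fixes c B \<sigma> :: real
  assumes "0 < c" "1 < B" "1 < \<sigma>"
  obtains M where "0 < M" "\<And>K x. (\<And>j. 0 < x j) \<Longrightarrow> (\<And>j. c / B ^ j * x j powr \<sigma> \<le> x (Suc j)) \<Longrightarrow>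
    (\<And>j. x j \<le> K) \<Longrightarrow> x 0 < M"
proof -
  \<comment> \<open>\<open>\<Lambda> powr (\<sigma> - 1) = B\<close> compensates the decaying
    coefficient, and \<open>c * M powr (\<sigma> - 1) = \<Lambda>\<close> gains one factor
    \<open>\<Lambda>\<close> in each step.\<close>
  define \<Lambda> where "\<Lambda> = B powr (1 / (\<sigma> - 1))"
  define M where "M = (\<Lambda> / c) powr (1 / (\<sigma> - 1))"
  have \<Lambda>: "1 < \<Lambda>" "\<Lambda> powr (\<sigma> - 1) = B" using assms by (auto simp: \<Lambda>_def powr_powr)
  have M: "0 < M" "c * M powr (\<sigma> - 1) = \<Lambda>"
    using assms \<Lambda> by (auto simp: M_def powr_powr)
  have "x 0 < M" if x: "\<And>j. 0 < x j" "\<And>j. c / B ^ j * x j powr \<sigma> \<le> x (Suc j)" "\<And>j. x j \<le> K" for x K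
  proof (rule ccontr)
    assume "\<not> x 0 < M"
    have "M * \<Lambda> ^ j \<le> x j" for j
    proof (induction j)
      case 0
      then show ?case using \<open>\<not> x 0 < M\<close> by simp
    next
      case (Suc j)
      have pos: "0 < M * \<Lambda> ^ j" using M \<Lambda> by simp
      have "(M * \<Lambda> ^ j) powr (\<sigma> - 1) = M powr (\<sigma> - 1) * B ^ j"
        using M \<Lambda> by (simp add: powr_mult powr_power[symmetric] powr_realpow[symmetric] powr_powr mult.commute)
      moreover have "(M * \<Lambda> ^ j) powr \<sigma> = (M * \<Lambda> ^ j) powr (\<sigma> - 1) * (M * \<Lambda> ^ j)"
        using pos by (simp add: powr_mult_base[symmetric] powr_diff)
      ultimately have "c / B ^ j * (M * \<Lambda> ^ j) powr \<sigma> = (c * M powr (\<sigma> - 1)) * (M * \<Lambda> ^ j)"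
        using assms by (simp add: field_simps)
      then have "M * \<Lambda> ^ Suc j = c / B ^ j * (M * \<Lambda> ^ j) powr \<sigma>"
        using M by simp
      also have "\<dots> \<le> c / B ^ j * x j powr \<sigma>"
        using Suc pos assms by (intro mult_left_mono powr_mono2) auto
      also have "\<dots> \<le> x (Suc j)" by (rule x)
      finally show ?case .
    qed
    moreover obtain j where "K / M < \<Lambda> ^ j" using real_arch_pow[OF \<Lambda>(1)] by blast
    ultimately show False using x(3)[of j] M by (smt (verit) pos_divide_less_eq mult.commute)
  qed
  then show thesis using that M by blast
qed

text \<open>At the last point of \<open>[a, b]\<close> with \<open>f \<le> 0\<close> the function
  vanishes, and its negative derivative would keep it negative a little longer.\<close>

lemma nonpos_persists:
  fixes f f' :: "real \<Rightarrow> real"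
  assumes der: "\<And>x. a \<le> x \<Longrightarrow> (f has_real_derivative f' x) (at x)"
    and neg: "\<And>x. a \<le> x \<Longrightarrow> f x = 0 \<Longrightarrow> f' x < 0"
    and "f a \<le> 0" "a \<le> b"
  shows "f b \<le> 0"
proof (rule ccontr)
  assume "\<not> f b \<le> 0"
  then have fb: "0 < f b" by simp
  have cont: "continuous_on {a..b} f"
    using der by (intro DERIV_atLeastAtMost_imp_continuous_on) auto
  define S where "S = {a..b} \<inter> f -` {..0}"
  have "closed S" unfolding S_def by (intro continuous_closed_preimage cont) auto
  then have "compact S"
    unfolding S_def by (metis bounded_Int bounded_closed_interval compact_eq_bounded_closed)
  moreover have "S \<noteq> {}" using assms by (auto simp: S_def)
  ultimately obtain s where s: "s \<in> S" "\<And>t. t \<in> S \<Longrightarrow> t \<le> s"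
    using compact_attains_sup[of S] by blast
  have sab: "a \<le> s" "s \<le> b" "f s \<le> 0" using s(1) by (auto simp: S_def)
  then have sb: "s < b" using fb by (cases "s = b") auto
  have after: "0 < f t" if "s < t" "t \<le> b" for t
    using s(2)[of t] that sab by (force simp: S_def)
  have "f s = 0"
  proof (rule ccontr)
    assume "f s \<noteq> 0"
    then have "f s / 2 < 0" "f s \<le> f s / 2" using sab by auto
    then have "\<exists>x\<ge>s. x \<le> b \<and> f x = f s / 2"
      using fb sb sab by (intro IVT' continuous_on_subset[OF cont]) auto
    then obtain x where "s \<le> x" "x \<le> b" "f x = f s / 2" by blast
    then show False using after[of x] \<open>f s / 2 < 0\<close> \<open>f s \<noteq> 0\<close> by (cases "x = s") auto
  qed
  then obtain d where d: "0 < d" "\<And>h. 0 < h \<Longrightarrow> h < d \<Longrightarrow> f (s + h) < f s"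
    using DERIV_neg_dec_right[OF der[OF sab(1)]] neg[OF sab(1)] by auto
  define h where "h = min (d/2) (b - s)"
  have "0 < h" "h < d" "s + h \<le> b" using d sb by (auto simp: h_def)
  then show False using d(2)[of h] after[of "s + h"] \<open>f s = 0\<close> by auto
qed

context radial_weight
begin

text \<open>Integrability alone does not make \<open>\<Theta>\<close> tend to \<open>0\<close>, but
  a positive lower bound from \<open>R\<close> on would make \<open>T\<close> grow linearly.\<close>

lemma theta_small:
  assumes "0 < c" "0 \<le> R"
  obtains r where "R \<le> r" "\<Theta> r < c"
proof -
  have "\<exists>r\<ge>R. \<Theta> r < c"
  proof (rule ccontr)
    assume "\<not> ?thesis"
    then have ge: "c \<le> \<Theta> r" if "R \<le> r" for r using that by (auto simp: not_less)
    define r where "r = R + (Tinf + 1) / c"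
    have r: "R \<le> r" "0 \<le> r" using Tinf_pos assms by (auto simp: r_def)
    have "T R - c * R \<le> T r - c * r"
    proof (rule nondecreasing_of_deriv[where f = "\<lambda>r. T r - c * r" and D = "\<lambda>r. \<Theta> r - c"])
      show "continuous_on {R..r} (\<lambda>r. T r - c * r)"
        using assms by (intro continuous_intros continuous_on_subset[OF pot_cont]) auto
      fix x assume x: "R < x" "x < r"
      then have "0 < x" using assms by simp
      then show "((\<lambda>r. T r - c * r) has_real_derivative \<Theta> x - c) (at x)"
        by (auto intro!: derivative_eq_intros pot_deriv_at)
      show "0 \<le> \<Theta> x - c" using ge[of x] x by simp
    qed (use r in auto)
    then have "c * (r - R) \<le> T r" using T_nonneg[of R] by (simp add: algebra_simps)
    moreover have "c * (r - R) = Tinf + 1" using assms by (simp add: r_def)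
    ultimately show False using T_le_Tinf[OF r(2)] by simp
  qed
  then show thesis using that by blast
qed

lemma Theta_deriv:
  assumes "0 < r"
  shows "(\<Theta> has_real_derivative 1 - W r * w' r / (w r)\<^sup>2) (at r)"
proof -
  have "((\<lambda>r. W r / w r) has_real_derivative (w r * w r - W r * w' r) / (w r * w r)) (at r)"
    using w_pos[OF assms] by (intro DERIV_divide W_deriv w_deriv assms) auto
  then show ?thesis
    using w_pos[OF assms] by (simp add: flux_def[abs_def] power2_eq_square diff_divide_distrib)
qed

text \<open>In other words \<open>\<Theta>' \<le> \<kappa>\<close>, with equality for the Euclidean
  weight.\<close>

lemma curvature_quotient:
  assumes "0 < r"
  shows "1 - \<kappa> \<le> W r * w' r / (w r)\<^sup>2"
  using curvature[OF assms] w_pos[OF assms] by (simp add: mass_def field_simps)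

text \<open>The coefficients \<open>1/(p+1)\<close> and \<open>1/(q+1)\<close> are those for which the terms in \<open>u\<^sup>p\<^sup>+\<^sup>1\<close> and \<open>v\<^sup>q\<^sup>+\<^sup>1\<close>
  cancel in the derivative.\<close>

definition poh :: "real \<Rightarrow> real \<Rightarrow> (real \<Rightarrow> real) \<Rightarrow> (real \<Rightarrow> real) \<Rightarrow> real \<Rightarrow> real" where
  "poh p q u v r =
     W r / (w r)\<^sup>2 * (mass (\<lambda>t. pw q (v t)) r * mass (\<lambda>t. pw p (u t)) r)
     + W r * (pw (p + 1) (u r) / (p + 1) + pw (q + 1) (v r) / (q + 1))
     - mass (\<lambda>t. pw q (v t)) r * v r / (q + 1) - mass (\<lambda>t. pw p (u t)) r * u r / (p + 1)"

lemma sol_pw_cont: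
  assumes "0 < q" "sol p q \<xi> \<eta> u v"
  shows "continuous_on {0..} (\<lambda>t. pw q (v t))"
proof -
  have "sol q p \<eta> \<xi> v u" using assms by (simp add: sol_swap)
  from sol_cont[OF this] show ?thesis
    using continuous_on_compose2[OF continuous_pw[OF assms(1), of UNIV]] by simp
qed

lemma sol_mass_deriv:
  assumes "0 < q" "sol p q \<xi> \<eta> u v" "0 < r"
  shows "(mass (\<lambda>t. pw q (v t)) has_real_derivative w r * pw q (v r)) (at r)"
  by (rule mass_has_derivative[OF sol_pw_cont[OF assms(1,2)] assms(3)])

lemma sol_mass_pos:
  assumes "0 < q" "sol p q \<xi> \<eta> u v" "0 < \<eta>" "0 < r"
  shows "0 < mass (\<lambda>t. pw q (v t)) r"
  using assms sol_0[OF assms(2)]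
  by (intro mass_pos sol_adm(1)[OF assms(2)] sol_pw_cont[OF assms(1,2)]) (auto simp: pw_pos)

lemma pw_deriv:
  assumes "0 < x"
  shows "(pw s has_real_derivative s * pw (s - 1) x) (at x)"
proof -
  have "((\<lambda>x. x powr s) has_real_derivative s * x powr (s - 1)) (at x)"
    by (rule has_real_derivative_powr[OF assms])
  then have "(pw s has_real_derivative s * x powr (s - 1)) (at x)"
    by (rule DERIV_cong_ev[THEN iffD1, rotated 3, OF _ refl _ refl])
      (use assms in \<open>auto simp: pw_pos_eq eventually_nhds intro!: exI[of _ "{0<..}"]\<close>)
  then show ?thesis using assms by (simp add: pw_pos_eq)
qed

lemma poh_deriv:
  assumes pq: "0 < p" "0 < q" and s: "sol p q \<xi> \<eta> u v"
    and r: "0 < r" and pos: "0 < u r" "0 < v r"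
  shows "(poh p q u v has_real_derivative
     mass (\<lambda>t. pw q (v t)) r * mass (\<lambda>t. pw p (u t)) r / w r
       * (1 + 1 / (p + 1) + 1 / (q + 1) - 2 * (W r * w' r / (w r)\<^sup>2))) (at r)"
proof -
  have s': "sol q p \<eta> \<xi> v u" using s by (simp add: sol_swap)
  define I where "I = mass (\<lambda>t. pw q (v t))"
  define J where "J = mass (\<lambda>t. pw p (u t))"
  have dI: "(I has_real_derivative w r * pw q (v r)) (at r)"
    and dJ: "(J has_real_derivative w r * pw p (u r)) (at r)"
    unfolding I_def J_def using sol_mass_deriv[OF pq(2) s r] sol_mass_deriv[OF pq(1) s' r] by auto
  have du: "(u has_real_derivative - I r / w r) (at r)" and dv: "(v has_real_derivative - J r / w r) (at r)"
    using sol_deriv[OF s r] sol_deriv[OF s' r] by (auto simp: I_def J_def flux_def)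
  have dpu: "((\<lambda>r. pw (p + 1) (u r)) has_real_derivative ((p + 1) * pw p (u r)) * (- I r / w r)) (at r)"
    using DERIV_chain2[OF pw_deriv[OF pos(1), of "p + 1"] du] by simp
  have dpv: "((\<lambda>r. pw (q + 1) (v r)) has_real_derivative ((q + 1) * pw q (v r)) * (- J r / w r)) (at r)"
    using DERIV_chain2[OF pw_deriv[OF pos(2), of "q + 1"] dv] by simp
  have wr: "w r \<noteq> 0" using w_pos[OF r] by simp
  have dE: "((\<lambda>r. W r / (w r)\<^sup>2) has_real_derivative 1 / w r - 2 * W r * w' r / (w r) ^ 3) (at r)"
    using wr by (auto intro!: derivative_eq_intros W_deriv w_deriv r simp: field_simps power2_eq_square power3_eq_cube)
  have poh: "poh p q u v = (\<lambda>r. W r / (w r)\<^sup>2 * (I r * J r)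
     + W r * (pw (p + 1) (u r) / (p + 1) + pw (q + 1) (v r) / (q + 1))
     - I r * v r / (q + 1) - J r * u r / (p + 1))"
    by (auto simp: poh_def I_def J_def)
  \<comment> \<open>With the reciprocals as atoms, \<open>w r\<close> is the only denominator left
    for \<open>field_simps\<close> to clear.\<close>
  define a where "a = 1 / (q + 1)"
  define b where "b = 1 / (p + 1)"
  have "((\<lambda>r. W r / (w r)\<^sup>2 * (I r * J r) + W r * (pw (p + 1) (u r) / (p + 1) + pw (q + 1) (v r) / (q + 1))
     - I r * v r / (q + 1) - J r * u r / (p + 1)) has_real_derivative
     ((1 / w r - 2 * W r * w' r / (w r) ^ 3) * (I r * J r) + (w r * pw q (v r) * J r + w r * pw p (u r) * I r) * (W r / (w r)\<^sup>2)
      + (w r * (pw (p + 1) (u r) / (p + 1) + pw (q + 1) (v r) / (q + 1))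
         + (((p + 1) * pw p (u r)) * (- I r / w r) / (p + 1) + ((q + 1) * pw q (v r)) * (- J r / w r) / (q + 1)) * W r)
      - (w r * pw q (v r) * v r + (- J r / w r) * I r) / (q + 1) - (w r * pw p (u r) * u r + (- I r / w r) * J r) / (p + 1))) (at r)"
    by (intro DERIV_add DERIV_diff DERIV_mult DERIV_cdivide dE dI dJ du dv dpu dpv W_deriv r)
  moreover have "pw (p + 1) (u r) = pw p (u r) * u r" "pw (q + 1) (v r) = pw q (v r) * v r"
    using pos by (auto simp: pw_pos_eq powr_add)
  then have "((1 / w r - 2 * W r * w' r / (w r) ^ 3) * (I r * J r) + (w r * pw q (v r) * J r + w r * pw p (u r) * I r) * (W r / (w r)\<^sup>2)
      + (w r * (pw (p + 1) (u r) / (p + 1) + pw (q + 1) (v r) / (q + 1))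
         + (((p + 1) * pw p (u r)) * (- I r / w r) / (p + 1) + ((q + 1) * pw q (v r)) * (- J r / w r) / (q + 1)) * W r)
      - (w r * pw q (v r) * v r + (- J r / w r) * I r) / (q + 1) - (w r * pw p (u r) * u r + (- I r / w r) * J r) / (p + 1))
     = I r * J r / w r * (1 + 1 / (p + 1) + 1 / (q + 1) - 2 * (W r * w' r / (w r)\<^sup>2))"
  proof -
    assume e: "pw (p + 1) (u r) = pw p (u r) * u r" "pw (q + 1) (v r) = pw q (v r) * v r"
    have pq0: "(p + 1) * y * z / (p + 1) = y * z" "(q + 1) * y * z / (q + 1) = y * z" for y z
      using pq by auto
    have pq1: "x / (q + 1) = a * x" "x / (p + 1) = b * x" for x
      by (auto simp: a_def b_def)
    have ab: "1 / (p + 1) = b" "1 / (q + 1) = a" by (auto simp: a_def b_def)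
    show ?thesis unfolding e pq0 unfolding ab unfolding pq1 using wr
      by (simp add: field_simps power2_eq_square power3_eq_cube)
  qed
  ultimately show ?thesis unfolding poh by (simp add: I_def J_def)
qed

lemma poh_cont:
  assumes pq: "0 < p" "0 < q" and s: "sol p q \<xi> \<eta> u v"
  shows "continuous_on {0..} (poh p q u v)"
proof -
  have s': "sol q p \<eta> \<xi> v u" using s by (simp add: sol_swap)
  \<comment> \<open>The factor \<open>W r / (w r)\<^sup>2\<close> can be singular at
    \<open>0\<close>; distributing the two divisions by \<open>w\<close> leaves factors that are
    continuous there.\<close>
  have "poh p q u v r = \<Theta> r * flux (\<lambda>t. pw q (v t)) r * mass (\<lambda>t. pw p (u t)) r
     + W r * (pw (p + 1) (u r) / (p + 1) + pw (q + 1) (v r) / (q + 1))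
     - mass (\<lambda>t. pw q (v t)) r * v r / (q + 1) - mass (\<lambda>t. pw p (u t)) r * u r / (p + 1)" for r
    by (simp add: poh_def flux_def power2_eq_square)
  then have "poh p q u v = (\<lambda>r. \<Theta> r * flux (\<lambda>t. pw q (v t)) r * mass (\<lambda>t. pw p (u t)) r
     + W r * (pw (p + 1) (u r) / (p + 1) + pw (q + 1) (v r) / (q + 1))
     - mass (\<lambda>t. pw q (v t)) r * v r / (q + 1) - mass (\<lambda>t. pw p (u t)) r * u r / (p + 1))" by blast
  moreover have "continuous_on {0..} (\<lambda>r. pw (p + 1) (u r))" "continuous_on {0..} (\<lambda>r. pw (q + 1) (v r))"
    using continuous_on_compose2[OF continuous_pw[of "p + 1" UNIV] sol_cont[OF s]]
      continuous_on_compose2[OF continuous_pw[of "q + 1" UNIV] sol_cont[OF s']] pq by auto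
  ultimately show ?thesis
    using pq by (auto intro!: continuous_intros flux_cont mass_cont sol_adm[OF s] sol_cont[OF s] sol_cont[OF s'])
qed

lemma poh_0: "poh p q u v 0 = 0"
  by (simp add: poh_def)

text \<open>The bracket in \<open>poh_deriv\<close> is at most
  \<open>1 + (1 - 2 * \<kappa>) - 2 * (1 - \<kappa>) = 0\<close>: the exponent condition and
  \<open>curvature\<close> match exactly.\<close>

lemma poh_antimono:
  assumes pq: "0 < p" "0 < q" and pos: "0 < \<xi>" "0 < \<eta>" and s: "sol p q \<xi> \<eta> u v"
    and crit: "1 / (p + 1) + 1 / (q + 1) \<le> 1 - 2 * \<kappa>"
    and uv: "\<And>r. 0 < r \<Longrightarrow> r < R \<Longrightarrow> 0 < u r \<and> 0 < v r"
    and r: "0 \<le> r" "r \<le> R"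
  shows "poh p q u v R \<le> poh p q u v r"
proof (rule nonincreasing_of_deriv[OF r(2), where f = "poh p q u v"])
  have s': "sol q p \<eta> \<xi> v u" using s by (simp add: sol_swap)
  show "continuous_on {r..R} (poh p q u v)"
    using r by (intro continuous_on_subset[OF poh_cont[OF pq s]]) auto
  fix x assume x: "r < x" "x < R"
  then have x0: "0 < x" using r by simp
  show "(poh p q u v has_real_derivative
     mass (\<lambda>t. pw q (v t)) x * mass (\<lambda>t. pw p (u t)) x / w x
       * (1 + 1 / (p + 1) + 1 / (q + 1) - 2 * (W x * w' x / (w x)\<^sup>2))) (at x)"
    using poh_deriv[OF pq s x0] uv[OF x0] x by simp
  have "0 \<le> mass (\<lambda>t. pw q (v t)) x * mass (\<lambda>t. pw p (u t)) x / w x"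
    using sol_mass_pos[OF pq(2) s pos(2) x0] sol_mass_pos[OF pq(1) s' pos(1) x0] w_pos[OF x0] by simp
  moreover have "1 + 1 / (p + 1) + 1 / (q + 1) - 2 * (W x * w' x / (w x)\<^sup>2) \<le> 0"
    using curvature_quotient[OF x0] crit by simp
  ultimately show "mass (\<lambda>t. pw q (v t)) x * mass (\<lambda>t. pw p (u t)) x / w x
       * (1 + 1 / (p + 1) + 1 / (q + 1) - 2 * (W x * w' x / (w x)\<^sup>2)) \<le> 0"
    by (rule mult_nonneg_nonpos)
qed

text \<open>At a common zero only the product of the two masses survives in \<open>poh\<close>, and
  it is positive, whereas \<open>poh\<close> starts at \<open>0\<close> and does not
  increase.\<close>

lemma no_dirichlet_solution:
  assumes pq: "0 < p" "0 < q" and pos: "0 < \<xi>" "0 < \<eta>" and s: "sol p q \<xi> \<eta> u v"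
    and crit: "1 / (p + 1) + 1 / (q + 1) \<le> 1 - 2 * \<kappa>"
    and R: "0 < R" "\<And>r. 0 \<le> r \<Longrightarrow> r < R \<Longrightarrow> 0 < u r \<and> 0 < v r"
  shows "\<not> (u R = 0 \<and> v R = 0)"
proof
  assume z: "u R = 0 \<and> v R = 0"
  have s': "sol q p \<eta> \<xi> v u" using s by (simp add: sol_swap)
  have "poh p q u v R \<le> 0"
    using poh_antimono[OF pq pos s crit, of R 0] R poh_0[of p q u v] by simp
  moreover have "0 < poh p q u v R"
    using sol_mass_pos[OF pq(2) s pos(2) R(1)] sol_mass_pos[OF pq(1) s' pos(1) R(1)] w_pos[OF R(1)] W_pos[OF R(1)] z
    by (simp add: poh_def)
  ultimately show False by simp
qed

text \<open>An identically vanishing Pohozaev function would force \<open>\<Theta>\<close> to be nondecreasing.\<close>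

lemma poh_eventually_negative:
  assumes pq: "0 < p" "0 < q" and pos: "0 < \<xi>" "0 < \<eta>" and s: "sol p q \<xi> \<eta> u v"
    and crit: "1 / (p + 1) + 1 / (q + 1) \<le> 1 - 2 * \<kappa>"
    and uv: "\<And>r. 0 \<le> r \<Longrightarrow> 0 < u r \<and> 0 < v r"
  obtains c R where "0 < c" "0 \<le> R" "\<And>r. R \<le> r \<Longrightarrow> poh p q u v r \<le> - c"
proof -
  have s': "sol q p \<eta> \<xi> v u" using s by (simp add: sol_swap)
  have anti: "poh p q u v t \<le> poh p q u v r" if "0 \<le> r" "r \<le> t" for r t
    by (rule poh_antimono[OF pq pos s crit _ that]) (use uv in auto)
  have "\<exists>R\<ge>0. poh p q u v R < 0"
  proof (rule ccontr)
    assume "\<not> ?thesis"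
    then have zero: "poh p q u v r = 0" if "0 \<le> r" for r
      using anti[of 0 r] poh_0[of p q u v] that by (force simp: not_less)
    have bracket: "1 + 1 / (p + 1) + 1 / (q + 1) = 2 * (W r * w' r / (w r)\<^sup>2)" if r: "0 < r" for r
    proof -
      have "(poh p q u v has_real_derivative 0) (at r)"
        by (rule DERIV_cong_ev[THEN iffD1, OF refl _ refl DERIV_const[of 0]])
          (use r zero in \<open>auto simp: eventually_nhds intro!: exI[of _ "{0<..}"]\<close>)
      from DERIV_unique[OF this poh_deriv[OF pq s r]] show ?thesis
        using uv[of r] r sol_mass_pos[OF pq(2) s pos(2) r] sol_mass_pos[OF pq(1) s' pos(1) r] w_pos[OF r] by auto
    qed
    \<comment> \<open>The bracket gives
      \<open>\<Theta>' = (1 - 1/(p+1) - 1/(q+1)) / 2 \<ge> \<kappa>\<close>, incompatible with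
      \<open>\<Theta>\<close> being small at some large radius.\<close>
    have "\<Theta> 1 \<le> \<Theta> r" if "1 \<le> r" for r
    proof (rule nondecreasing_of_deriv[OF that, where f = \<Theta> and D = "\<lambda>r. 1 - W r * w' r / (w r)\<^sup>2"])
      show "continuous_on {1..r} \<Theta>" by (intro continuous_on_subset[OF flux_cont]) auto
      fix x :: real assume x: "1 < x" "x < r"
      show "(\<Theta> has_real_derivative 1 - W x * w' x / (w x)\<^sup>2) (at x)" by (rule Theta_deriv) (use x in simp)
      show "0 \<le> 1 - W x * w' x / (w x)\<^sup>2" using bracket[of x] x crit \<kappa>_pos by simp
    qed
    moreover obtain r where "1 \<le> r" "\<Theta> r < \<Theta> 1" using theta_small[OF Theta_pos[of 1], of 1] by auto
    ultimately show False by force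
  qed
  then obtain R where "0 \<le> R" "poh p q u v R < 0" by blast
  then show thesis using that[of "- poh p q u v R" R] anti by auto
qed

section \<open>The Green function and an explicit majorant\<close>

text \<open>A majorant of the Green function that avoids the integral of \<open>1 / w\<close>. For
  \<open>w r = r ^ (n - 1)\<close> it is \<open>r powr (2 - n) / (n - 2)\<close>, the Green function
  itself.\<close>

definition K :: "real \<Rightarrow> real" where "K r = \<Theta> r / ((1 - 2 * \<kappa>) * w r)"

text \<open>The tail \<open>G r\<close> of the integral of \<open>1 / w\<close> is the radial Green function of the manifold.\<close>

lemma green_exists:
  obtains G where "\<And>r. 1 < r \<Longrightarrow> (G has_real_derivative - 1 / w r) (at r)" "(G \<longlongrightarrow> 0) at_top"
    "\<And>r. 1 < r \<Longrightarrow> 0 < G r" "\<And>r. 1 < r \<Longrightarrow> G r \<le> K r" "continuous_on {1..} G"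
proof -
  define F where "F = (\<lambda>r. integral {1..r} (\<lambda>t. 1 / w t))"
  have inv_cont: "continuous_on {1..b} (\<lambda>t. 1 / w t)" for b
  proof -
    have "\<forall>t\<in>{1..b}. w t \<noteq> 0"
    proof
      fix t assume "t \<in> {1..b}"
      then show "w t \<noteq> 0" using w_pos[of t] by simp
    qed
    then show ?thesis by (intro continuous_on_divide continuous_on_const continuous_on_subset[OF w_cont]) auto
  qed
  have F_within: "(F has_real_derivative 1 / w r) (at r within {1..})" if "1 \<le> r" for r
    using integral_has_real_derivative[OF inv_cont, of r "r+1"] that at_within_Ici_eq[of r "r+1" 1]
    by (simp add: F_def)
  have F_deriv: "(F has_real_derivative 1 / w r) (at r)" if "1 < r" for r
    using DERIV_of_within_Ici[OF F_within that] that by simp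
  have F_cont: "continuous_on {1..} F"
    by (rule DERIV_continuous_on[where D = "\<lambda>r. 1 / w r"]) (use F_within in auto)
  have c0: "0 < 1 - 2 * \<kappa>" using \<kappa>_less by simp
  have K_nonneg: "0 \<le> K r" if "0 \<le> r" for r
    unfolding K_def using Theta_nonneg[OF that] w_nonneg[OF that] c0 by simp
  have K_eq: "K = (\<lambda>r. (W r / (w r)\<^sup>2) / (1 - 2 * \<kappa>))"
    using c0 by (auto simp: K_def flux_def power2_eq_square)
  have K_deriv: "(K has_real_derivative (1 / w r - 2 * W r * w' r / (w r) ^ 3) / (1 - 2 * \<kappa>)) (at r)" if "0 < r" for r
    unfolding K_eq
    using w_pos[OF that] that
    by (intro DERIV_cdivide)
      (auto intro!: derivative_eq_intros W_deriv w_deriv simp: field_simps power2_eq_square power3_eq_cube)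
  have K_le: "1 / w r + (1 / w r - 2 * W r * w' r / (w r) ^ 3) / (1 - 2 * \<kappa>) \<le> 0" if "0 < r" for r
  proof -
    have wr: "0 < w r" using w_pos[OF that] .
    have "1 / w r - 2 * W r * w' r / (w r) ^ 3 = (1 - 2 * (W r * w' r / (w r)\<^sup>2)) / w r"
      using wr by (simp add: field_simps power2_eq_square power3_eq_cube)
    also have "\<dots> \<le> - (1 - 2 * \<kappa>) / w r"
      using curvature_quotient[OF that] wr by (intro divide_right_mono) auto
    finally have "(1 / w r - 2 * W r * w' r / (w r) ^ 3) / (1 - 2 * \<kappa>) \<le> (- (1 - 2 * \<kappa>) / w r) / (1 - 2 * \<kappa>)"
      using c0 by (intro divide_right_mono) auto
    also have "\<dots> = - (1 / w r)" using c0 wr by (simp add: field_simps)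
    finally show ?thesis by simp
  qed
  have K_cont: "continuous_on {1..} K"
    by (rule DERIV_continuous_on[where D = "\<lambda>r. (1 / w r - 2 * W r * w' r / (w r) ^ 3) / (1 - 2 * \<kappa>)"])
      (auto intro!: has_field_derivative_at_within K_deriv)
  \<comment> \<open>\<open>curvature\<close> gives \<open>K' \<le> - 1 / w\<close>. Hence
    \<open>F + K\<close> does not increase, which yields both the convergence of the integral of
    \<open>1 / w\<close> and the bound of its tail by \<open>K\<close>.\<close>
  have FK: "F s + K s \<le> F r + K r" if "1 \<le> r" "r \<le> s" for r s
  proof (rule nonincreasing_of_deriv[OF that(2), where f = "\<lambda>r. F r + K r"
        and D = "\<lambda>r. 1 / w r + (1 / w r - 2 * W r * w' r / (w r) ^ 3) / (1 - 2 * \<kappa>)"])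
    show "continuous_on {r..s} (\<lambda>r. F r + K r)"
      using that by (intro continuous_intros continuous_on_subset[OF F_cont] continuous_on_subset[OF K_cont]) auto
    fix x assume "r < x" "x < s"
    then show "((\<lambda>r. F r + K r) has_real_derivative 1 / w x + (1 / w x - 2 * W x * w' x / (w x) ^ 3) / (1 - 2 * \<kappa>)) (at x)"
      using that by (intro DERIV_add F_deriv K_deriv) auto
    show "1 / w x + (1 / w x - 2 * W x * w' x / (w x) ^ 3) / (1 - 2 * \<kappa>) \<le> 0"
      using \<open>r < x\<close> that by (intro K_le) auto
  qed
  have F_strict: "F r < F s" if "1 \<le> r" "r < s" for r s
  proof (rule DERIV_pos_imp_increasing_open[where f = F])
    show "continuous_on {r..s} F" using that by (intro continuous_on_subset[OF F_cont]) auto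
    show "\<exists>y. (F has_real_derivative y) (at x) \<and> 0 < y" if "r < x" "x < s" for x
      using F_deriv[of x] w_pos[of x] that \<open>1 \<le> r\<close> by (intro exI[of _ "1 / w x"]) auto
  qed fact
  have "F r \<le> F 1 + K 1" if "1 \<le> r" for r
    using FK[OF order.refl that] K_nonneg[of r] that by simp
  moreover have "F r \<le> F s" if "1 \<le> r" "r \<le> s" for r s
    using F_strict[of r s] that by (cases "r = s") auto
  ultimately obtain l where l: "(F \<longlongrightarrow> l) at_top" "\<And>r. 1 \<le> r \<Longrightarrow> F r \<le> l"
    using mono_bounded_tendsto[of 1 F "F 1 + K 1"] by blast
  have lK: "l \<le> F r + K r" if "1 \<le> r" for r
  proof (rule tendsto_upperbound[OF l(1) _ trivial_limit_at_top_linorder])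
    show "eventually (\<lambda>s. F s \<le> F r + K r) at_top"
    proof (rule eventually_at_top_linorderI[of r])
      fix s assume "r \<le> s"
      then show "F s \<le> F r + K r" using FK[OF that, of s] K_nonneg[of s] that by simp
    qed
  qed
  show thesis
  proof (rule that[of "\<lambda>r. l - F r"])
    show "((\<lambda>r. l - F r) has_real_derivative - 1 / w r) (at r)" if "1 < r" for r
      using DERIV_diff[OF DERIV_const F_deriv[OF that], of l] by simp
    show "((\<lambda>r. l - F r) \<longlongrightarrow> 0) at_top" using tendsto_diff[OF tendsto_const l(1), of l] by simp
    show "0 < l - F r" if "1 < r" for r using F_strict[of r "r+1"] l(2)[of "r+1"] that by simp
    show "l - F r \<le> K r" if "1 < r" for r using lK[of r] that by simp
    show "continuous_on {1..} (\<lambda>r. l - F r)" by (intro continuous_intros F_cont)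
  qed
qed

section \<open>Solutions vanishing at infinity\<close>

text \<open>With \<open>I\<close> the mass of \<open>pw q (v t)\<close>, integration by parts
  suggests that \<open>u r\<close> is \<open>I r * G r\<close> plus the integral of
  \<open>w * pw q v * G\<close> over the tail. The lower bound drops this integral; the upper one
  uses \<open>w * G \<le> w * K = \<Theta> / (1 - 2 * \<kappa>)\<close> and the monotonicity of
  \<open>v\<close>. The proof differentiates, so that no improper integral is needed.\<close>

lemma green_bounds:
  assumes pq: "0 < p" "0 < q" and pos: "0 < \<xi>" "0 < \<eta>" and s: "sol p q \<xi> \<eta> u v"
    and lim: "(u \<longlongrightarrow> 0) at_top"
    and G: "\<And>r. 1 < r \<Longrightarrow> (G has_real_derivative - 1 / w r) (at r)" "(G \<longlongrightarrow> 0) at_top"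
      "\<And>r. 1 < r \<Longrightarrow> 0 < G r" "\<And>r. 1 < r \<Longrightarrow> G r \<le> K r" "continuous_on {1..} G"
    and r: "1 < r"
  shows "mass (\<lambda>t. pw q (v t)) r * G r \<le> u r"
    "u r \<le> mass (\<lambda>t. pw q (v t)) r * G r + (Tinf - T r) / (1 - 2 * \<kappa>) * pw q (v r)"
proof -
  have s': "sol q p \<eta> \<xi> v u" using s by (simp add: sol_swap)
  define I where "I = mass (\<lambda>t. pw q (v t))"
  have c0: "0 < 1 - 2 * \<kappa>" using \<kappa>_less by simp
  have I_deriv: "(I has_real_derivative w x * pw q (v x)) (at x)" if "0 < x" for x
    unfolding I_def by (rule sol_mass_deriv[OF pq(2) s that])
  have I_pos: "0 < I x" if "0 < x" for x
    unfolding I_def by (rule sol_mass_pos[OF pq(2) s pos(2) that])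
  have I_cont: "continuous_on {0..} I" unfolding I_def by (rule mass_cont[OF sol_adm(1)[OF s]])
  have I_mono: "I r \<le> I x" if "r \<le> x" for x
  proof (rule nondecreasing_of_deriv[OF that, where f = I and D = "\<lambda>x. w x * pw q (v x)"])
    show "continuous_on {r..x} I" using r by (intro continuous_on_subset[OF I_cont]) auto
    show "(I has_real_derivative w y * pw q (v y)) (at y)" if "r < y" "y < x" for y
      using r that by (intro I_deriv) auto
    show "0 \<le> w y * pw q (v y)" if "r < y" "y < x" for y
      using r that w_nonneg[of y] by simp
  qed
  have u_deriv: "(u has_real_derivative - I x / w x) (at x)" if "0 < x" for x
    using sol_deriv[OF s that] by (simp add: I_def flux_def)
  have "0 \<le> u r - I r * G r"
  proof (rule tendsto_upperbound[OF _ _ trivial_limit_at_top_linorder])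
    show "((\<lambda>s. u s - I r * G s) \<longlongrightarrow> 0) at_top"
      using tendsto_diff[OF lim tendsto_mult_right_zero[OF G(2)], of "I r"] by simp
    have "u s - I r * G s \<le> u r - I r * G r" if "r \<le> s" for s
    proof (rule nonincreasing_of_deriv[OF that, where f = "\<lambda>s. u s - I r * G s" and D = "\<lambda>x. - I x / w x - I r * (- 1 / w x)"])
      show "continuous_on {r..s} (\<lambda>s. u s - I r * G s)"
        using r by (intro continuous_intros continuous_on_subset[OF sol_cont[OF s]] continuous_on_subset[OF G(5)]) auto
      fix x assume x: "r < x" "x < s"
      show "((\<lambda>s. u s - I r * G s) has_real_derivative - I x / w x - I r * (- 1 / w x)) (at x)"
        using x r by (intro DERIV_diff DERIV_cmult u_deriv G(1)) auto
      have "I r / w x \<le> I x / w x"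
        using I_mono[of x] x r w_pos[of x] by (intro divide_right_mono) auto
      then show "- I x / w x - I r * (- 1 / w x) \<le> 0" by simp
    qed
    then show "eventually (\<lambda>s. u s - I r * G s \<le> u r - I r * G r) at_top"
      by (intro eventually_at_top_linorderI[of r])
  qed
  then show "mass (\<lambda>t. pw q (v t)) r * G r \<le> u r" by (simp add: I_def)
  define B where "B = pw q (v r) / (1 - 2 * \<kappa>)"
  have B: "0 \<le> B" unfolding B_def using c0 by simp
  have "u r - I r * G r + B * T r \<le> B * Tinf"
  proof (rule tendsto_le[OF trivial_limit_at_top_linorder _ tendsto_const])
    have "((\<lambda>s. u s + B * T s) \<longlongrightarrow> 0 + B * Tinf) at_top"
      by (intro tendsto_intros lim T_tendsto)
    then show "((\<lambda>s. u s + B * T s) \<longlongrightarrow> B * Tinf) at_top" by simp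
    have "u r - I r * G r + B * T r \<le> u s - I s * G s + B * T s" if "r \<le> s" for s
    proof (rule nondecreasing_of_deriv[OF that, where f = "\<lambda>s. u s - I s * G s + B * T s"
          and D = "\<lambda>x. - I x / w x - (w x * pw q (v x) * G x + (- 1 / w x) * I x) + B * \<Theta> x"])
      show "continuous_on {r..s} (\<lambda>s. u s - I s * G s + B * T s)"
        using r by (intro continuous_intros continuous_on_subset[OF sol_cont[OF s]] continuous_on_subset[OF G(5)]
            continuous_on_subset[OF I_cont] continuous_on_subset[OF pot_cont]) auto
      fix x assume x: "r < x" "x < s"
      show "((\<lambda>s. u s - I s * G s + B * T s) has_real_derivative
          - I x / w x - (w x * pw q (v x) * G x + (- 1 / w x) * I x) + B * \<Theta> x) (at x)"
        using x r by (intro DERIV_add DERIV_diff DERIV_mult DERIV_cmult u_deriv G(1) I_deriv pot_deriv_at) auto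
      have wx: "0 < w x" using x r by (intro w_pos) auto
      have "pw q (v x) \<le> pw q (v r)" using sol_antimono[OF s', of r x] x r pq by (intro pw_mono) auto
      then have "pw q (v x) * (w x * G x) \<le> pw q (v r) * (w x * K x)"
        using wx x r G(3)[of x] G(4)[of x] by (intro mult_mono mult_left_mono) auto
      also have "\<dots> = B * \<Theta> x" using wx by (simp add: K_def B_def)
      finally show "0 \<le> - I x / w x - (w x * pw q (v x) * G x + (- 1 / w x) * I x) + B * \<Theta> x"
        by (simp add: algebra_simps)
    qed
    moreover have "0 \<le> I s * G s" if "r \<le> s" for s
      using that r I_pos[of s] G(3)[of s] by simp
    ultimately show "eventually (\<lambda>s. u r - I r * G r + B * T r \<le> u s + B * T s) at_top"
      by (intro eventually_at_top_linorderI[of r]) force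
  qed
  then show "u r \<le> mass (\<lambda>t. pw q (v t)) r * G r + (Tinf - T r) / (1 - 2 * \<kappa>) * pw q (v r)"
    by (simp add: I_def B_def algebra_simps diff_divide_distrib)
qed

lemma tail_small:
  assumes "0 < e"
  obtains R where "R0 \<le> R" "\<And>r. R \<le> r \<Longrightarrow> (Tinf - T r) / (1 - 2 * \<kappa>) \<le> e"
proof -
  have c0: "0 < 1 - 2 * \<kappa>" using \<kappa>_less by simp
  have "((\<lambda>r. (Tinf - T r) / (1 - 2 * \<kappa>)) \<longlongrightarrow> (Tinf - Tinf) / (1 - 2 * \<kappa>)) at_top"
    using c0 by (intro tendsto_intros T_tendsto) auto
  then have "eventually (\<lambda>r. (Tinf - T r) / (1 - 2 * \<kappa>) < e) at_top"
    using assms by (intro order_tendstoD(2)) auto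
  then obtain R where R: "\<And>r. R \<le> r \<Longrightarrow> (Tinf - T r) / (1 - 2 * \<kappa>) < e"
    unfolding eventually_at_top_linorder by blast
  have "(Tinf - T r) / (1 - 2 * \<kappa>) \<le> e" if "max R R0 \<le> r" for r
    using R[of r] that by simp
  then show thesis using that[of "max R R0"] by simp
qed

text \<open>On the region \<open>v\<^sup>q \<le> u\<close> \<open>w u'\<close> stays bounded, so \<open>u\<close> decays like the Green function and
  the Pohozaev function would have to vanish at infinity.\<close>

lemma no_vanishing_if_dominated:
  assumes pq: "0 < p" "0 < q" and pos: "0 < \<xi>" "0 < \<eta>" and s: "sol p q \<xi> \<eta> u v"
    and crit: "1 / (p + 1) + 1 / (q + 1) \<le> 1 - 2 * \<kappa>"
    and uv: "\<And>r. 0 \<le> r \<Longrightarrow> 0 < u r \<and> 0 < v r"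
    and lim: "(u \<longlongrightarrow> 0) at_top" "(v \<longlongrightarrow> 0) at_top"
    and dom: "\<And>r. R \<le> r \<Longrightarrow> pw q (v r) \<le> u r"
  shows False
proof -
  have s': "sol q p \<eta> \<xi> v u" using s by (simp add: sol_swap)
  have c0: "0 < 1 - 2 * \<kappa>" using \<kappa>_less by simp
  obtain G where G: "\<And>r. 1 < r \<Longrightarrow> (G has_real_derivative - 1 / w r) (at r)" "(G \<longlongrightarrow> 0) at_top"
      "\<And>r. 1 < r \<Longrightarrow> 0 < G r" "\<And>r. 1 < r \<Longrightarrow> G r \<le> K r" "continuous_on {1..} G"
    using green_exists by blast
  define I where "I = mass (\<lambda>t. pw q (v t))"
  define J where "J = mass (\<lambda>t. pw p (u t))"
  \<comment> \<open>With the factor \<open>1/2\<close>, the last term of the Green bound is at most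
    \<open>u r / 2\<close> and is absorbed on the left.\<close>
  obtain R1 where R1: "max R 2 \<le> R1" "\<And>r. R1 \<le> r \<Longrightarrow> (Tinf - T r) / (1 - 2 * \<kappa>) \<le> 1/2"
    using tail_small[of "1/2" "max R 2"] by auto
  have I_pos: "0 < I x" if "0 < x" for x
    unfolding I_def by (rule sol_mass_pos[OF pq(2) s pos(2) that])
  have J_pos: "0 < J x" if "0 < x" for x
    unfolding J_def by (rule sol_mass_pos[OF pq(1) s' pos(1) that])
  have uK: "u r \<le> 2 * I r * K r" if r: "R1 \<le> r" for r
  proof -
    have r1: "1 < r" "R \<le> r" "0 < r" using r R1(1) by auto
    have "u r \<le> I r * G r + (Tinf - T r) / (1 - 2 * \<kappa>) * pw q (v r)"
      using green_bounds(2)[OF pq pos s lim(1) G r1(1)] by (simp add: I_def)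
    also have "\<dots> \<le> I r * K r + 1/2 * u r"
      using G(4)[OF r1(1)] I_pos[OF r1(3)] R1(2)[OF r] dom[OF r1(2)] uv[of r] r1
      by (intro add_mono mult_mono mult_left_mono) auto
    finally show ?thesis by simp
  qed
  \<comment> \<open>Gronwall constant for
    \<open>I' = w * pw q v \<le> w * u \<le> 2 * w * I * K\<close>, which says
    \<open>(ln I)' \<le> 2 / (1 - 2 * \<kappa>) * T'\<close>, with \<open>T\<close> bounded by
    \<open>Tinf\<close>.\<close>
  define C where "C = I R1 * exp (2 / (1 - 2 * \<kappa>) * Tinf)"
  have IC: "I r \<le> C" if r: "R1 \<le> r" for r
  proof -
    have "ln (I r) - 2 / (1 - 2 * \<kappa>) * T r \<le> ln (I R1) - 2 / (1 - 2 * \<kappa>) * T R1"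
    proof (rule nonincreasing_of_deriv[OF r, where f = "\<lambda>r. ln (I r) - 2 / (1 - 2 * \<kappa>) * T r"
          and D = "\<lambda>x. 1 / I x * (w x * pw q (v x)) - 2 / (1 - 2 * \<kappa>) * \<Theta> x"])
      have der: "((\<lambda>r. ln (I r) - 2 / (1 - 2 * \<kappa>) * T r) has_real_derivative
          1 / I x * (w x * pw q (v x)) - 2 / (1 - 2 * \<kappa>) * \<Theta> x) (at x)" if "0 < x" for x
        using that I_pos[OF that]
        by (intro DERIV_diff DERIV_cmult pot_deriv_at DERIV_chain2[OF DERIV_ln_divide])
          (auto simp: I_def intro!: sol_mass_deriv[OF pq(2) s])
      show "continuous_on {R1..r} (\<lambda>r. ln (I r) - 2 / (1 - 2 * \<kappa>) * T r)"
        using R1(1) by (intro continuous_at_imp_continuous_on ballI DERIV_isCont[OF der]) auto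
      fix x assume x: "R1 < x" "x < r"
      then have x0: "0 < x" and xR: "R \<le> x" using R1(1) by auto
      show "((\<lambda>r. ln (I r) - 2 / (1 - 2 * \<kappa>) * T r) has_real_derivative
          1 / I x * (w x * pw q (v x)) - 2 / (1 - 2 * \<kappa>) * \<Theta> x) (at x)" by (rule der[OF x0])
      have "w x * pw q (v x) \<le> w x * (2 * I x * K x)"
        using dom[OF xR] uK[of x] x w_pos[OF x0] by (intro mult_left_mono) auto
      also have "\<dots> = I x * (2 / (1 - 2 * \<kappa>) * \<Theta> x)" using w_pos[OF x0] by (simp add: K_def)
      finally show "1 / I x * (w x * pw q (v x)) - 2 / (1 - 2 * \<kappa>) * \<Theta> x \<le> 0"
        using I_pos[OF x0] by (simp add: divide_le_eq mult.commute)
    qed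
    moreover have "2 / (1 - 2 * \<kappa>) * T r \<le> 2 / (1 - 2 * \<kappa>) * Tinf" "0 \<le> 2 / (1 - 2 * \<kappa>) * T R1"
      using T_le_Tinf[of r] T_nonneg[of R1] c0 r R1(1) by (auto intro!: mult_left_mono divide_right_mono)
    ultimately have "ln (I r) \<le> ln (I R1) + 2 / (1 - 2 * \<kappa>) * Tinf" by linarith
    then have "exp (ln (I r)) \<le> exp (ln (I R1) + 2 / (1 - 2 * \<kappa>) * Tinf)" by simp
    then show ?thesis using I_pos[of r] I_pos[of R1] r R1(1) by (simp add: C_def exp_add)
  qed
  have C: "0 < C" using I_pos[of R1] R1(1) by (simp add: C_def)
  \<comment> \<open>From the product of \<open>J \<le> pw p \<xi> * W\<close> and
    \<open>u \<le> 2 * C * K\<close>, which equals \<open>D * \<Theta>\<^sup>2\<close>.\<close>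
  define D where "D = 2 * C * pw p \<xi> / (1 - 2 * \<kappa>)"
  have D: "0 < D" using C c0 pw_pos[OF pos(1)] by (simp add: D_def)
  have lower: "- (C * v r + D * (\<Theta> r)\<^sup>2) \<le> poh p q u v r" if r: "R1 \<le> r" for r
  proof -
    have r0: "0 < r" using r R1(1) by simp
    have wr: "0 < w r" using w_pos[OF r0] .
    have "J r \<le> pw p \<xi> * W r"
      using mass_abs_le[of "\<lambda>t. pw p (u t)" r "pw p \<xi>"] sol_adm[OF s] sol_pw_le[OF pq(1) s] by (auto simp: J_def)
    then have "J r * u r \<le> (pw p \<xi> * W r) * (2 * C * K r)"
    proof (rule mult_mono)
      have "0 \<le> K r" unfolding K_def using Theta_nonneg[of r] r0 wr c0 by simp
      then have "2 * I r * K r \<le> 2 * C * K r" using IC[OF r] by (intro mult_right_mono) auto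
      then show "u r \<le> 2 * C * K r" using uK[OF r] by simp
    qed (use uv[of r] r0 W_nonneg in auto)
    also have "\<dots> = D * (\<Theta> r)\<^sup>2"
      by (simp add: D_def K_def flux_def power2_eq_square mult_ac)
    finally have 1: "J r * u r \<le> D * (\<Theta> r)\<^sup>2" .
    have 2: "I r * v r \<le> C * v r" using IC[OF r] uv[of r] r0 by (intro mult_right_mono) auto
    have "I r * v r / (q + 1) \<le> I r * v r" "J r * u r / (p + 1) \<le> J r * u r"
      using I_pos[OF r0] J_pos[OF r0] uv[of r] r0 pq by (auto simp: divide_le_eq algebra_simps)
    moreover have "0 \<le> W r / (w r)\<^sup>2 * (I r * J r) + W r * (pw (p + 1) (u r) / (p + 1) + pw (q + 1) (v r) / (q + 1))"
      using W_nonneg I_pos[OF r0] J_pos[OF r0] pq by simp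
    ultimately show ?thesis using 1 2 unfolding poh_def I_def[symmetric] J_def[symmetric] by linarith
  qed
  obtain c R2 where c: "0 < c" "0 \<le> R2" "\<And>r. R2 \<le> r \<Longrightarrow> poh p q u v r \<le> - c"
    using poh_eventually_negative[OF pq pos s crit uv] by blast
  have "eventually (\<lambda>r. v r < c / (2 * C)) at_top"
    using lim(2) c C by (intro order_tendstoD(2)) auto
  then obtain R3 where R3: "\<And>r. R3 \<le> r \<Longrightarrow> v r < c / (2 * C)"
    unfolding eventually_at_top_linorder by blast
  \<comment> \<open>\<open>v\<close> is small at all large radii, \<open>\<Theta>\<close> is known
    to be small only at some, so the radius is chosen last. The entry \<open>1\<close> allows
    \<open>\<Theta>\<^sup>2 \<le> \<Theta>\<close>.\<close>
  have min_pos: "0 < min 1 (c / (2 * D))" "0 \<le> max R1 (max R2 R3)" using c D R1(1) by auto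
  obtain r where r: "max R1 (max R2 R3) \<le> r" "\<Theta> r < min 1 (c / (2 * D))"
    using theta_small[OF min_pos] by blast
  have "C * v r < c / 2" using R3[of r] r C by (simp add: field_simps)
  moreover have "D * (\<Theta> r)\<^sup>2 \<le> D * \<Theta> r"
    using r Theta_nonneg[of r] R1(1) D by (intro mult_left_mono) (auto simp: power2_eq_square mult_left_le_one_le)
  moreover have "D * \<Theta> r < c / 2" using r D by (simp add: field_simps)
  ultimately show False using lower[of r] c(3)[of r] r by linarith
qed

text \<open>After clearing denominators, a sum below \<open>1\<close> says exactly
  \<open>1 < p * q\<close>; the strictness comes from \<open>\<kappa> > 0\<close>.\<close>

lemma exponents_superlinear:
  assumes pq: "0 < p" "0 < q" and crit: "1 / (p + 1) + 1 / (q + 1) \<le> 1 - 2 * \<kappa>"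
  shows "1 < p * q"
proof -
  have "1 / (p + 1) + 1 / (q + 1) < 1" using crit \<kappa>_pos by simp
  moreover have "1 / (p + 1) + 1 / (q + 1) = (p + q + 2) / ((p + 1) * (q + 1))"
    using pq by (simp add: field_simps)
  ultimately have "p + q + 2 < (p + 1) * (q + 1)" using pq by (simp add: divide_less_eq_1_pos)
  then show ?thesis by (simp add: algebra_simps)
qed

text \<open>Where \<open>v\<^sup>q = u\<close>, the Green bounds and \<open>q > 1\<close> make \<open>q ln v - ln u\<close> decrease; so \<open>v\<^sup>q \<le> u\<close> persists once it
  holds. If it never holds then \<open>u\<^sup>p \<le> v\<^sup>p\<^sup>q \<le> v\<close> eventually.\<close>

lemma no_vanishing_aux:
  assumes pq: "0 < p" "1 < q" and pos: "0 < \<xi>" "0 < \<eta>" and s: "sol p q \<xi> \<eta> u v"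
    and crit: "1 / (p + 1) + 1 / (q + 1) \<le> 1 - 2 * \<kappa>"
    and uv: "\<And>r. 0 \<le> r \<Longrightarrow> 0 < u r \<and> 0 < v r"
    and lim: "(u \<longlongrightarrow> 0) at_top" "(v \<longlongrightarrow> 0) at_top"
  shows False
proof -
  have q: "0 < q" using pq by simp
  have s': "sol q p \<eta> \<xi> v u" using s by (simp add: sol_swap)
  have p1: "1 < p * q" by (rule exponents_superlinear[OF pq(1) q crit])
  obtain G where G: "\<And>r. 1 < r \<Longrightarrow> (G has_real_derivative - 1 / w r) (at r)" "(G \<longlongrightarrow> 0) at_top"
      "\<And>r. 1 < r \<Longrightarrow> 0 < G r" "\<And>r. 1 < r \<Longrightarrow> G r \<le> K r" "continuous_on {1..} G"
    using green_exists by blast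
  define I where "I = mass (\<lambda>t. pw q (v t))"
  define J where "J = mass (\<lambda>t. pw p (u t))"
  have "eventually (\<lambda>r. v r < 1) at_top"
    using lim by (intro order_tendstoD(2)) auto
  then obtain R0 where R0: "\<And>r. R0 \<le> r \<Longrightarrow> v r < 1"
    unfolding eventually_at_top_linorder by blast
  \<comment> \<open>\<open>q * (1 - \<delta>) = (q + 1) / 2\<close> still exceeds \<open>1\<close>,
    so a fraction \<open>\<delta>\<close> of \<open>v\<close> can be given up to the tail
    term.\<close>
  define \<delta> where "\<delta> = (1 - 1 / q) / 2"
  have \<delta>: "0 < \<delta>" "1 < q * (1 - \<delta>)" "\<delta> < 1" using pq by (auto simp: \<delta>_def field_simps)
  obtain R1 where R1: "max R0 2 \<le> R1" "\<And>r. R1 \<le> r \<Longrightarrow> (Tinf - T r) / (1 - 2 * \<kappa>) \<le> \<delta>"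
    using tail_small[OF \<delta>(1), of "max R0 2"] by blast
  have dominated_p: "pw p (u r) \<le> v r" if "u r \<le> pw q (v r)" "R1 \<le> r" for r
  proof -
    have r: "0 \<le> r" "v r < 1" using that R1(1) R0[of r] by auto
    have "pw p (u r) \<le> pw p (pw q (v r))" using pq that by (intro pw_mono) auto
    also have "\<dots> = v r powr (p * q)" using uv[OF r(1)] by (simp add: pw_pos_eq powr_powr mult.commute)
    also have "\<dots> \<le> v r powr 1" using uv[OF r(1)] r(2) p1 by (intro powr_mono') auto
    finally show ?thesis using uv[OF r(1)] by simp
  qed
  show False
  proof (cases "\<exists>r1\<ge>R1. pw q (v r1) \<le> u r1")
    case True
    then obtain r1 where r1: "R1 \<le> r1" "pw q (v r1) \<le> u r1" by blast
    define f where "f = (\<lambda>r. q * ln (v r) - ln (u r))"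
    have f_le: "f r \<le> 0 \<longleftrightarrow> pw q (v r) \<le> u r" and f_eq: "f r = 0 \<longleftrightarrow> pw q (v r) = u r" if "0 \<le> r" for r
    proof -
      have "f r = ln (pw q (v r)) - ln (u r)" using uv[OF that] by (simp add: f_def pw_pos_eq ln_powr)
      then show "f r \<le> 0 \<longleftrightarrow> pw q (v r) \<le> u r" "f r = 0 \<longleftrightarrow> pw q (v r) = u r"
        using uv[OF that] pw_pos[of "v r" q] by auto
    qed
    have "f r \<le> 0" if r: "r1 \<le> r" for r
    proof (rule nonpos_persists[where a = r1 and f = f and f' = "\<lambda>x. q * (1 / v x * (- J x / w x)) - 1 / u x * (- I x / w x)"])
      fix x assume x: "r1 \<le> x"
      then have x0: "0 < x" "1 < x" and xR: "R1 \<le> x" using r1 R1(1) by auto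
      have du: "(u has_real_derivative - I x / w x) (at x)" and dv: "(v has_real_derivative - J x / w x) (at x)"
        using sol_deriv[OF s x0(1)] sol_deriv[OF s' x0(1)] by (auto simp: I_def J_def flux_def)
      show "(f has_real_derivative q * (1 / v x * (- J x / w x)) - 1 / u x * (- I x / w x)) (at x)"
        unfolding f_def using uv[of x] x0
        by (intro DERIV_diff DERIV_cmult DERIV_chain2[OF DERIV_ln_divide] du dv) auto
      assume "f x = 0"
      then have eq: "pw q (v x) = u x" using f_eq[of x] x0 by simp
      \<comment> \<open>At a zero of \<open>f\<close> the tail term is at most
        \<open>\<delta> * v x\<close>, so \<open>J * G \<ge> (1 - \<delta>) * v\<close>, while
        \<open>I * G \<le> u\<close>. Thus \<open>q * J / v - I / u\<close> is at least
        \<open>(q * (1 - \<delta>) - 1) / G\<close>, which is positive.\<close>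
      have "v x \<le> J x * G x + (Tinf - T x) / (1 - 2 * \<kappa>) * pw p (u x)"
        using green_bounds(2)[OF q pq(1) pos(2,1) s' lim(2) G x0(2)] by (simp add: J_def)
      also have "\<dots> \<le> J x * G x + \<delta> * v x"
        using dominated_p[of x] eq xR R1(2)[OF xR] \<delta>(1) by (intro add_left_mono mult_mono) auto
      finally have 1: "(1 - \<delta>) * v x \<le> J x * G x" by (simp add: algebra_simps)
      have 2: "I x * G x \<le> u x"
        using green_bounds(1)[OF pq(1) q pos s lim(1) G x0(2)] by (simp add: I_def)
      have Gx: "0 < G x" using G(3)[OF x0(2)] .
      have vx: "0 < v x" and ux: "0 < u x" using uv[of x] x0 by auto
      have "1 - \<delta> \<le> J x * G x / v x" using 1 vx by (simp add: le_divide_eq)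
      then have "q * (1 - \<delta>) \<le> q * (J x * G x / v x)" using q by (intro mult_left_mono) auto
      moreover have "I x * G x / u x \<le> 1" using 2 ux by simp
      ultimately have "(I x / u x - q * (J x / v x)) * G x < 0" using \<delta>(2) by (simp add: algebra_simps)
      then have "I x / u x - q * (J x / v x) < 0" using Gx by (simp add: mult_less_0_iff)
      then have "(I x / u x - q * (J x / v x)) / w x < 0" using w_pos[OF x0(1)] by (rule divide_neg_pos)
      then show "q * (1 / v x * (- J x / w x)) - 1 / u x * (- I x / w x) < 0"
        by (simp add: diff_divide_distrib mult.commute)
    qed (use r1 f_le[of r1] R1(1) r in auto)
    then have "pw q (v r) \<le> u r" if "r1 \<le> r" for r
      using f_le[of r] that r1 R1(1) by auto
    then show False using no_vanishing_if_dominated[OF pq(1) q pos s crit _ lim, of r1] uv by blast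
  next
    case False
    then have "pw p (u r) \<le> v r" if "R1 \<le> r" for r
    proof -
      have "\<not> pw q (v r) \<le> u r" using False that by blast
      then show ?thesis using dominated_p[of r] that by simp
    qed
    then show False
      using crit uv by (intro no_vanishing_if_dominated[OF q pq(1) pos(2,1) s' _ _ lim(2,1)]) auto
  qed
qed

lemma no_vanishing:
  assumes pq: "0 < p" "0 < q" and pos: "0 < \<xi>" "0 < \<eta>" and s: "sol p q \<xi> \<eta> u v"
    and crit: "1 / (p + 1) + 1 / (q + 1) \<le> 1 - 2 * \<kappa>"
    and uv: "\<And>r. 0 \<le> r \<Longrightarrow> 0 < u r \<and> 0 < v r"
    and lim: "(u \<longlongrightarrow> 0) at_top" "(v \<longlongrightarrow> 0) at_top"
  shows False
proof -
  have s': "sol q p \<eta> \<xi> v u" using s by (simp add: sol_swap)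
  have "1 < p * q" by (rule exponents_superlinear[OF pq crit])
  then have "1 < q \<or> 1 < p"
    using pq mult_le_one[of p q] by linarith
  then show False
  proof
    assume "1 < q"
    then show False by (rule no_vanishing_aux[OF pq(1) _ pos s crit uv lim])
  next
    assume "1 < p"
    then show False using crit uv
      by (intro no_vanishing_aux[OF pq(2) _ pos(2,1) s' _ _ lim(2,1)]) auto
  qed
qed

section \<open>A bound independent of the data\<close>

lemma T_surj:
  assumes "0 < \<tau>" "\<tau> < Tinf"
  obtains r where "0 < r" "T r = \<tau>"
proof -
  have "eventually (\<lambda>r. \<tau> < T r) at_top" using T_tendsto assms by (intro order_tendstoD(1))
  then have "eventually (\<lambda>r. \<tau> < T r \<and> 0 \<le> r) at_top"
    by (intro eventually_conj eventually_ge_at_top)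
  then obtain R where R: "\<tau> < T R" "0 \<le> R"
    using eventually_happens'[OF trivial_limit_at_top_linorder] by fast
  have "\<exists>x\<ge>0. x \<le> R \<and> T x = \<tau>"
    using R assms by (intro IVT' continuous_on_subset[OF pot_cont]) auto
  then obtain x where "0 \<le> x" "T x = \<tau>" by blast
  then show thesis using that[of x] assms by (cases "x = 0") auto
qed

text \<open>Since \<open>v\<close> decreases, its power on \<open>[0, b]\<close> is at least that at
  \<open>b\<close>, so the flux driving \<open>u\<close> is at least \<open>\<Theta>\<close> times
  this constant.\<close>

lemma sol_decrement:
  assumes pq: "0 < p" "0 < q" and s: "sol p q \<xi> \<eta> u v" and r: "0 \<le> a" "a \<le> b"
  shows "pw q (v b) * (T b - T a) \<le> u a - u b"
proof -
  have s': "sol q p \<eta> \<xi> v u" using s by (simp add: sol_swap)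
  have "u b + pw q (v b) * T b \<le> u a + pw q (v b) * T a"
  proof (rule nonincreasing_of_deriv[OF r(2), where f = "\<lambda>r. u r + pw q (v b) * T r"
        and D = "\<lambda>r. - flux (\<lambda>t. pw q (v t)) r + pw q (v b) * \<Theta> r"])
    show "continuous_on {a..b} (\<lambda>r. u r + pw q (v b) * T r)"
      using r by (intro continuous_intros continuous_on_subset[OF sol_cont[OF s]] continuous_on_subset[OF pot_cont]) auto
    fix x assume x: "a < x" "x < b"
    then have x0: "0 < x" using r by simp
    show "((\<lambda>r. u r + pw q (v b) * T r) has_real_derivative - flux (\<lambda>t. pw q (v t)) x + pw q (v b) * \<Theta> x) (at x)"
      by (intro DERIV_add DERIV_cmult sol_deriv[OF s x0] pot_deriv_at x0) simp
    have "flux (\<lambda>_. pw q (v b)) x \<le> flux (\<lambda>t. pw q (v t)) x"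
      using x r sol_antimono[OF s', of _ b] pq
      by (intro flux_mono sol_adm[OF s] pw_mono) auto
    then show "- flux (\<lambda>t. pw q (v t)) x + pw q (v b) * \<Theta> x \<le> 0"
      by (simp add: flux_const[of "pw q (v b)"])
  qed
  then show ?thesis by (simp add: algebra_simps)
qed

text \<open>Sampling \<open>v\<close> at radii that halve the remaining \<open>T\<close> twice turns the two decrement inequalities into a recursion
  with exponent \<open>p q > 1\<close>, which would blow up before \<open>T = 0\<close>.\<close>

lemma universal_bound:
  assumes pq: "0 < p" "0 < q" "1 < p * q"
  obtains M where "\<And>\<xi> \<eta> u v l. sol p q \<xi> \<eta> u v \<Longrightarrow> (\<And>r. 0 \<le> r \<Longrightarrow> 0 < u r \<and> 0 < v r) \<Longrightarrow>
    (v \<longlongrightarrow> l) at_top \<Longrightarrow> l \<le> M"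
proof -
  define \<tau> where "\<tau> = (\<lambda>j. Tinf / 2 ^ (j + 1))"
  have \<tau>: "0 < \<tau> j" "\<tau> j < Tinf" "\<tau> j - \<tau> (Suc j) = \<tau> (Suc j)" "\<tau> (Suc j) < \<tau> j" for j
  proof -
    have "1 < (2::real) ^ (j + 1)" by (rule one_less_power) auto
    then show "0 < \<tau> j" "\<tau> j < Tinf" "\<tau> j - \<tau> (Suc j) = \<tau> (Suc j)" "\<tau> (Suc j) < \<tau> j"
      using Tinf_pos by (auto simp: \<tau>_def field_simps)
  qed
  have "\<exists>r>0. T r = \<tau> j" for j using T_surj[OF \<tau>(1,2)] by blast
  then obtain \<rho> where \<rho>: "\<And>j. 0 < \<rho> j" "\<And>j. T (\<rho> j) = \<tau> j" by metis
  have \<rho>_dec: "\<rho> (Suc j) \<le> \<rho> j" for j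
  proof (rule ccontr)
    assume "\<not> \<rho> (Suc j) \<le> \<rho> j"
    then have "T (\<rho> j) < T (\<rho> (Suc j))" using \<rho>(1)[of j] by (intro T_strict_mono) auto
    then show False using \<rho>(2) \<tau>(4)[of j] by simp
  qed
  \<comment> \<open>\<open>c / B ^ j\<close> is
    \<open>(Tinf / 4 / 4 ^ j) powr p * (Tinf / 8 / 4 ^ j)\<close>, built from the two increments of
    \<open>T\<close> used in step \<open>j\<close>.\<close>
  define c where "c = Tinf / 8 * (Tinf / 4) powr p"
  define B where "B = 4 powr (p + 1)"
  have c: "0 < c" using Tinf_pos by (simp add: c_def)
  have B: "1 < B" using pq by (simp add: B_def)
  obtain M where M: "0 < M" "\<And>K x. (\<And>j. 0 < x j) \<Longrightarrow> (\<And>j. c / B ^ j * x j powr (p * q) \<le> x (Suc j)) \<Longrightarrow>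
    (\<And>j. x j \<le> K) \<Longrightarrow> x 0 < M"
    using superlinear_recursion_unbounded[OF c B pq(3)] by metis
  have "l \<le> M" if s: "sol p q \<xi> \<eta> u v" and uv: "\<And>r. 0 \<le> r \<Longrightarrow> 0 < u r \<and> 0 < v r"
    and l: "(v \<longlongrightarrow> l) at_top" for \<xi> \<eta> u v l
  proof -
    have s': "sol q p \<eta> \<xi> v u" using s by (simp add: sol_swap)
    define x where "x = (\<lambda>j. v (\<rho> (2 * j)))"
    have "x 0 < M"
    proof (rule M(2))
      show "0 < x j" for j using uv[of "\<rho> (2 * j)"] \<rho>(1)[of "2 * j"] by (simp add: x_def)
      \<comment> \<open>The radii move towards the pole, where \<open>v\<close> stays below
        \<open>\<eta>\<close>. This bound depends on the datum; \<open>M\<close> does not.\<close>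
      show "x j \<le> \<eta>" for j using sol_le[OF s'] \<rho>(1)[of "2 * j"] by (simp add: x_def)
      show "c / B ^ j * x j powr (p * q) \<le> x (Suc j)" for j
      proof -
        define a where "a = \<rho> (2 * j)"
        define b where "b = \<rho> (Suc (2 * j))"
        define d where "d = \<rho> (Suc (Suc (2 * j)))"
        have pos: "0 < a" "0 < b" "0 < d" and le: "b \<le> a" "d \<le> b"
          using \<rho> \<rho>_dec by (auto simp: a_def b_def d_def)
        have step1: "v a powr q * (Tinf / 4 / 4 ^ j) \<le> u b"
        proof -
          have "T a - T b = Tinf / 4 / 4 ^ j"
            using \<tau>(3)[of "2 * j"] by (simp add: a_def b_def \<rho> \<tau>_def power_mult)
          then show ?thesis
            using sol_decrement[OF pq(1,2) s, of b a] uv[of a] pos le by (simp add: pw_pos_eq)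
        qed
        have step2: "u b powr p * (Tinf / 8 / 4 ^ j) \<le> v d"
        proof -
          have "T b - T d = Tinf / 8 / 4 ^ j"
            using \<tau>(3)[of "Suc (2 * j)"] by (simp add: b_def d_def \<rho> \<tau>_def power_mult)
          then show ?thesis
            using sol_decrement[OF pq(2,1) s', of d b] uv[of b] uv[of d] pos le by (simp add: pw_pos_eq)
        qed
        have va: "0 < v a" using uv[of a] pos by simp
        have "B ^ j = (4 powr (p + 1)) powr real j" by (simp add: B_def powr_realpow)
        also have "\<dots> = 4 powr real j * (4 powr real j) powr p"
          by (simp add: powr_powr powr_add[symmetric] algebra_simps)
        finally have "B ^ j = 4 ^ j * (4 ^ j) powr p" by (simp add: powr_realpow)
        then have "c / B ^ j * v a powr (p * q) = (v a powr q * (Tinf / 4 / 4 ^ j)) powr p * (Tinf / 8 / 4 ^ j)"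
          using va Tinf_pos by (simp add: c_def powr_mult powr_divide powr_powr mult_ac)
        also have "\<dots> \<le> u b powr p * (Tinf / 8 / 4 ^ j)"
          using step1 va Tinf_pos pq by (intro mult_right_mono powr_mono2) auto
        also have "\<dots> \<le> v d" by (rule step2)
        finally show ?thesis by (simp add: x_def a_def d_def)
      qed
    qed
    moreover have "l \<le> v (\<rho> 0)"
    proof (rule tendsto_upperbound[OF l _ trivial_limit_at_top_linorder])
      show "eventually (\<lambda>r. v r \<le> v (\<rho> 0)) at_top"
        using sol_antimono[OF s'] \<rho>(1)[of 0] by (intro eventually_at_top_linorderI[of "\<rho> 0"]) auto
    qed
    ultimately show "l \<le> M" by (simp add: x_def)
  qed
  then show thesis using that by blast
qed

section \<open>Shooting\<close>

lemma sol_strict_antimono: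
  assumes pq: "0 < p" "0 < q" and pos: "0 < \<eta>" and s: "sol p q \<xi> \<eta> u v" and r: "0 \<le> r" "r < t"
  shows "u t < u r"
proof -
  have "pot (\<lambda>t. pw q (v t)) r < pot (\<lambda>t. pw q (v t)) t"
    using sol_0[OF s] pos by (intro pot_strict_mono_arg sol_adm[OF s] sol_pw_cont[OF pq(2) s] r) (auto simp: pw_pos)
  then show ?thesis using sol_eq(1)[OF s, of r] sol_eq(1)[OF s, of t] r by simp
qed

text \<open>Strict monotonicity keeps \<open>U\<close> above its limit at every finite radius, so a
  zero limit still belongs to a positive component. This is why the final range of
  \<open>\<eta>\<close> is a closed interval.\<close>

lemma U_positive_iff:
  assumes pq: "0 < p" "0 < q" and pos: "0 < \<xi>" "0 < \<eta>"
  shows "(\<forall>r\<ge>0. 0 < U p q \<xi> \<eta> r) \<longleftrightarrow> 0 \<le> LU p q \<xi> \<eta>"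
proof
  assume "\<forall>r\<ge>0. 0 < U p q \<xi> \<eta> r"
  then show "0 \<le> LU p q \<xi> \<eta>"
    by (intro tendsto_lowerbound[OF LU_props(1)[OF pq pos] _ trivial_limit_at_top_linorder])
      (auto intro!: eventually_at_top_linorderI[of 0] less_imp_le)
next
  assume L: "0 \<le> LU p q \<xi> \<eta>"
  show "\<forall>r\<ge>0. 0 < U p q \<xi> \<eta> r"
  proof (intro allI impI)
    fix r :: real assume "0 \<le> r"
    then show "0 < U p q \<xi> \<eta> r"
      using sol_strict_antimono[OF pq pos(2) sol_U[OF pq pos], of r "r+1"] LU_props(2)[OF pq pos, of "r+1"] L by simp
  qed
qed

text \<open>Membership is witnessed by strict inequalities at a single radius, so continuity in the
  data at that fixed radius suffices.\<close>

lemma open_crossing_set: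
  assumes pq: "0 < p" "0 < q" and \<xi>: "0 < \<xi>"
  shows "open {\<eta>. 0 < \<eta> \<and> (\<exists>r\<ge>0. U p q \<xi> \<eta> r < 0 \<and> 0 < U q p \<eta> \<xi> r)}"
    and "open {\<eta>. 0 < \<eta> \<and> (\<exists>r\<ge>0. 0 < U p q \<xi> \<eta> r \<and> U q p \<eta> \<xi> r < 0)}"
proof -
  have near: "\<exists>e>0. \<forall>\<eta>'. dist \<eta>' \<eta> < e \<longrightarrow> 0 < \<eta>' \<and> \<bar>U p q \<xi> \<eta>' r - U p q \<xi> \<eta> r\<bar> < a \<and> \<bar>U q p \<eta>' \<xi> r - U q p \<eta> \<xi> r\<bar> < b"
    if *: "0 < \<eta>" "0 \<le> r" "0 < a" "0 < b" for \<eta> r a b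
  proof -
    obtain d1 where d1: "0 < d1" "\<forall>x'>0. \<forall>y'>0. \<bar>x' - \<xi>\<bar> < d1 \<longrightarrow> \<bar>y' - \<eta>\<bar> < d1 \<longrightarrow> \<bar>U p q x' y' r - U p q \<xi> \<eta> r\<bar> < a"
      using U_continuity[OF pq \<xi> *(1,2,3)] by blast
    obtain d2 where d2: "0 < d2" "\<forall>x'>0. \<forall>y'>0. \<bar>x' - \<eta>\<bar> < d2 \<longrightarrow> \<bar>y' - \<xi>\<bar> < d2 \<longrightarrow> \<bar>U q p x' y' r - U q p \<eta> \<xi> r\<bar> < b"
      using U_continuity[OF pq(2,1) *(1) \<xi> *(2,4)] by blast
    show ?thesis
    proof (intro exI[of _ "min \<eta> (min d1 d2)"] conjI allI impI)
      fix \<eta>' assume d: "dist \<eta>' \<eta> < min \<eta> (min d1 d2)"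
      then show pos: "0 < \<eta>'" by (auto simp: dist_real_def)
      show "\<bar>U p q \<xi> \<eta>' r - U p q \<xi> \<eta> r\<bar> < a" "\<bar>U q p \<eta>' \<xi> r - U q p \<eta> \<xi> r\<bar> < b"
        using d1 d2 d pos \<xi> by (auto simp: dist_real_def)
    qed (use * d1 d2 in auto)
  qed
  show "open {\<eta>. 0 < \<eta> \<and> (\<exists>r\<ge>0. U p q \<xi> \<eta> r < 0 \<and> 0 < U q p \<eta> \<xi> r)}"
    unfolding open_dist
  proof
    fix \<eta> assume "\<eta> \<in> {\<eta>. 0 < \<eta> \<and> (\<exists>r\<ge>0. U p q \<xi> \<eta> r < 0 \<and> 0 < U q p \<eta> \<xi> r)}"
    then obtain r where r: "0 < \<eta>" "0 \<le> r" "U p q \<xi> \<eta> r < 0" "0 < U q p \<eta> \<xi> r" by blast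
    obtain e where "0 < e" "\<forall>\<eta>'. dist \<eta>' \<eta> < e \<longrightarrow> 0 < \<eta>' \<and> \<bar>U p q \<xi> \<eta>' r - U p q \<xi> \<eta> r\<bar> < - U p q \<xi> \<eta> r
        \<and> \<bar>U q p \<eta>' \<xi> r - U q p \<eta> \<xi> r\<bar> < U q p \<eta> \<xi> r"
      using near[OF r(1,2), of "- U p q \<xi> \<eta> r" "U q p \<eta> \<xi> r"] r by auto
    then show "\<exists>e>0. \<forall>\<eta>'. dist \<eta>' \<eta> < e \<longrightarrow> \<eta>' \<in> {\<eta>. 0 < \<eta> \<and> (\<exists>r\<ge>0. U p q \<xi> \<eta> r < 0 \<and> 0 < U q p \<eta> \<xi> r)}"
      using r(2) by (intro exI[of _ e]) fastforce
  qed
  show "open {\<eta>. 0 < \<eta> \<and> (\<exists>r\<ge>0. 0 < U p q \<xi> \<eta> r \<and> U q p \<eta> \<xi> r < 0)}"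
    unfolding open_dist
  proof
    fix \<eta> assume "\<eta> \<in> {\<eta>. 0 < \<eta> \<and> (\<exists>r\<ge>0. 0 < U p q \<xi> \<eta> r \<and> U q p \<eta> \<xi> r < 0)}"
    then obtain r where r: "0 < \<eta>" "0 \<le> r" "0 < U p q \<xi> \<eta> r" "U q p \<eta> \<xi> r < 0" by blast
    obtain e where "0 < e" "\<forall>\<eta>'. dist \<eta>' \<eta> < e \<longrightarrow> 0 < \<eta>' \<and> \<bar>U p q \<xi> \<eta>' r - U p q \<xi> \<eta> r\<bar> < U p q \<xi> \<eta> r
        \<and> \<bar>U q p \<eta>' \<xi> r - U q p \<eta> \<xi> r\<bar> < - U q p \<eta> \<xi> r"
      using near[OF r(1,2), of "U p q \<xi> \<eta> r" "- U q p \<eta> \<xi> r"] r by auto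
    then show "\<exists>e>0. \<forall>\<eta>'. dist \<eta>' \<eta> < e \<longrightarrow> \<eta>' \<in> {\<eta>. 0 < \<eta> \<and> (\<exists>r\<ge>0. 0 < U p q \<xi> \<eta> r \<and> U q p \<eta> \<xi> r < 0)}"
      using r(2) by (intro exI[of _ e]) fastforce
  qed
qed

text \<open>The flux collects the mass of \<open>pw q v\<close> from the pole onward, so
  \<open>u\<close> goes on decreasing strictly through its zero, while \<open>v\<close> stays
  positive nearby by continuity.\<close>

lemma crosses_after_zero:
  assumes pq: "0 < p" "0 < q" and pos: "0 < \<xi>" "0 < \<eta>" and s: "sol p q \<xi> \<eta> u v"
    and R: "0 \<le> R" "u R = 0" "0 < v R"
  shows "\<exists>r\<ge>0. u r < 0 \<and> 0 < v r"
proof -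
  have s': "sol q p \<eta> \<xi> v u" using s by (simp add: sol_swap)
  obtain d where d: "0 < d" "\<forall>x\<in>{0..}. dist x R < d \<longrightarrow> dist (v x) (v R) < v R"
    using sol_cont[OF s'] R unfolding continuous_on_iff by (metis atLeast_iff)
  have "dist (v (R + d/2)) (v R) < v R" using d R(1) by (auto simp: dist_real_def)
  then have "0 < v (R + d/2)" by (auto simp: dist_real_def)
  moreover have "u (R + d/2) < 0" using sol_strict_antimono[OF pq pos(2) s R(1), of "R + d/2"] R d by simp
  ultimately show ?thesis using R(1) d(1) by (intro exI[of _ "R + d/2"]) auto
qed

text \<open>Shooting: the data for which \<open>u\<close> crosses zero first and those for which \<open>v\<close> does form two disjoint
  nonempty open subsets of the half-line; at a datum in neither, both could only vanish simultaneously.\<close>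

lemma positive_solution_exists:
  assumes pq: "0 < p" "0 < q" and \<xi>: "0 < \<xi>"
    and crit: "1 / (p + 1) + 1 / (q + 1) \<le> 1 - 2 * \<kappa>"
  obtains \<eta> where "0 < \<eta>" "0 \<le> LU p q \<xi> \<eta>" "0 \<le> LU q p \<eta> \<xi>"
proof -
  define A where "A = {\<eta>. 0 < \<eta> \<and> (\<exists>r\<ge>0. U p q \<xi> \<eta> r < 0 \<and> 0 < U q p \<eta> \<xi> r)}"
  define B where "B = {\<eta>. 0 < \<eta> \<and> (\<exists>r\<ge>0. 0 < U p q \<xi> \<eta> r \<and> U q p \<eta> \<xi> r < 0)}"
  have op: "open A" "open B" unfolding A_def B_def by (rule open_crossing_set[OF pq \<xi>])+
  have negative: "\<exists>r\<ge>0. U p q x y r < 0" if "0 < x" "0 < y" "LU p q x y < 0" "0 < p" "0 < q" for p q x y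
  proof -
    have "eventually (\<lambda>r. U p q x y r < 0 \<and> 0 \<le> r) at_top"
      using that by (intro eventually_conj order_tendstoD(2)[OF LU_props(1)] eventually_ge_at_top)
    then show ?thesis using eventually_happens'[OF trivial_limit_at_top_linorder] by fast
  qed
  have neA: "A \<noteq> {}"
  proof -
    obtain \<eta>1 where 1: "0 < \<eta>1" "LU p q \<xi> \<eta>1 < 0" using LU_signs(2)[OF pq \<xi>] by blast
    obtain \<eta>2 where 2: "0 < \<eta>2" "0 < LU q p \<eta>2 \<xi>" using LU_signs(3)[OF pq(2,1) \<xi>] by blast
    define \<eta> where "\<eta> = max \<eta>1 \<eta>2"
    have \<eta>: "0 < \<eta>" "\<eta>1 \<le> \<eta>" "\<eta>2 \<le> \<eta>" using 1 2 by (auto simp: \<eta>_def)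
    have "LU p q \<xi> \<eta> < 0" using LU_compare[OF pq \<xi> 1(1), of \<xi> \<eta>] 1 \<eta> by simp
    then obtain r where r: "0 \<le> r" "U p q \<xi> \<eta> r < 0" using negative[OF \<xi> \<eta>(1) _ pq] by blast
    have "0 < LU q p \<eta> \<xi>" using LU_compare[OF pq(2,1) 2(1) \<xi>, of \<eta> \<xi>] 2 \<eta> by simp
    then have "0 < U q p \<eta> \<xi> r" using LU_props(2)[OF pq(2,1) \<eta>(1) \<xi> r(1)] by simp
    then show ?thesis using r \<eta> by (auto simp: A_def)
  qed
  have neB: "B \<noteq> {}"
  proof -
    obtain \<eta>1 where 1: "0 < \<eta>1" "0 < LU p q \<xi> \<eta>1" using LU_signs(1)[OF pq \<xi>] by blast
    obtain \<eta>2 where 2: "0 < \<eta>2" "LU q p \<eta>2 \<xi> < 0" using LU_signs(4)[OF pq(2,1) \<xi>] by blast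
    define \<eta> where "\<eta> = min \<eta>1 \<eta>2"
    have \<eta>: "0 < \<eta>" "\<eta> \<le> \<eta>1" "\<eta> \<le> \<eta>2" using 1 2 by (auto simp: \<eta>_def)
    have "LU q p \<eta> \<xi> < 0" using LU_compare[OF pq(2,1) \<eta>(1) \<xi>, of \<eta>2 \<xi>] 2 \<eta> by simp
    then obtain r where r: "0 \<le> r" "U q p \<eta> \<xi> r < 0" using negative[OF \<eta>(1) \<xi> _ pq(2,1)] by blast
    have "0 < LU p q \<xi> \<eta>" using LU_compare[OF pq \<xi> \<eta>(1), of \<xi> \<eta>1] 1 \<eta> by simp
    then have "0 < U p q \<xi> \<eta> r" using LU_props(2)[OF pq \<xi> \<eta>(1) r(1)] by simp
    then show ?thesis using r \<eta> by (auto simp: B_def)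
  qed
  \<comment> \<open>Both components decrease, so one that is negative at some radius cannot be
    positive at a larger one.\<close>
  have disj: "A \<inter> B = {}"
  proof (rule ccontr)
    assume "A \<inter> B \<noteq> {}"
    then obtain \<eta> r t where *: "0 < \<eta>" "0 \<le> r" "0 \<le> t" "U p q \<xi> \<eta> r < 0" "0 < U q p \<eta> \<xi> r"
      "0 < U p q \<xi> \<eta> t" "U q p \<eta> \<xi> t < 0" by (auto simp: A_def B_def)
    note s = sol_U[OF pq \<xi> *(1)]
    have s': "sol q p \<eta> \<xi> (U q p \<eta> \<xi>) (U p q \<xi> \<eta>)" using s by (simp add: sol_swap)
    show False
      using sol_antimono[OF s *(2), of t] sol_antimono[OF s' *(3), of r] * by (cases "r \<le> t") auto
  qed
  have "\<not> {0<..} \<subseteq> A \<union> B"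
  proof
    assume "{0<..} \<subseteq> A \<union> B"
    moreover have "connected {0::real<..}" by (simp add: connected_Ioi)
    ultimately have "A \<inter> {0<..} = {} \<or> B \<inter> {0<..} = {}"
      using connectedD[of "{0<..}" A B] op disj by auto
    moreover have "A \<subseteq> {0<..}" "B \<subseteq> {0<..}" by (auto simp: A_def B_def)
    ultimately show False using neA neB by auto
  qed
  then obtain \<eta> where \<eta>: "0 < \<eta>" "\<eta> \<notin> A" "\<eta> \<notin> B" by auto
  note s = sol_U[OF pq \<xi> \<eta>(1)]
  have s': "sol q p \<eta> \<xi> (U q p \<eta> \<xi>) (U p q \<xi> \<eta>)" using s by (simp add: sol_swap)
  have "0 < min (U p q \<xi> \<eta> b) (U q p \<eta> \<xi> b)" if b0: "0 \<le> b" for b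
  proof (rule ccontr)
    assume neg: "\<not> 0 < min (U p q \<xi> \<eta> b) (U q p \<eta> \<xi> b)"
    have c: "continuous_on {0..} (\<lambda>r. min (U p q \<xi> \<eta> r) (U q p \<eta> \<xi> r))"
      by (intro continuous_intros sol_cont[OF s] sol_cont[OF s'])
    have p0: "0 < min (U p q \<xi> \<eta> 0) (U q p \<eta> \<xi> 0)" using sol_0[OF s] \<xi> \<eta>(1) by simp
    obtain R where R: "0 < R" "min (U p q \<xi> \<eta> R) (U q p \<eta> \<xi> R) = 0"
      "\<And>r. 0 \<le> r \<Longrightarrow> r < R \<Longrightarrow> 0 < min (U p q \<xi> \<eta> r) (U q p \<eta> \<xi> r)"
      by (rule first_nonpos[OF c p0 b0 leI[OF neg]]) blast
    have nd: "\<not> (U p q \<xi> \<eta> R = 0 \<and> U q p \<eta> \<xi> R = 0)"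
      by (rule no_dirichlet_solution[OF pq \<xi> \<eta>(1) s crit R(1)]) (use R(3) in auto)
    have "U p q \<xi> \<eta> R = 0 \<and> 0 < U q p \<eta> \<xi> R \<or> 0 < U p q \<xi> \<eta> R \<and> U q p \<eta> \<xi> R = 0"
      using R(2) nd by (auto simp: min_def split: if_splits)
    then show False
      using crosses_after_zero[OF pq \<xi> \<eta>(1) s, of R] crosses_after_zero[OF pq(2,1) \<eta>(1) \<xi> s', of R]
        R(1) \<eta> by (auto simp: A_def B_def)
  qed
  then have "0 \<le> LU p q \<xi> \<eta>" "0 \<le> LU q p \<eta> \<xi>"
    using U_positive_iff[OF pq \<xi> \<eta>(1)] U_positive_iff[OF pq(2,1) \<eta>(1) \<xi>] by auto
  then show thesis using that \<eta>(1) by blast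
qed

section \<open>The region of data with positive solutions\<close>

definition positive_sol :: "real \<Rightarrow> real \<Rightarrow> real \<Rightarrow> real \<Rightarrow> (real \<Rightarrow> real) \<Rightarrow> (real \<Rightarrow> real) \<Rightarrow> bool" where
  "positive_sol p q \<xi> \<eta> u v \<longleftrightarrow> sol p q \<xi> \<eta> u v \<and> (\<forall>r\<ge>0. 0 < u r \<and> 0 < v r)"

lemma positive_sol_eq_U:
  assumes pq: "0 < p" "0 < q" and pos: "0 < \<xi>" "0 < \<eta>" and s: "positive_sol p q \<xi> \<eta> u v" and r: "0 \<le> r"
  shows "u r = U p q \<xi> \<eta> r" "v r = U q p \<eta> \<xi> r"
  using sol_unique[OF pq pos sol_U[OF pq pos] _ r] s by (auto simp: positive_sol_def)

lemma positive_sol_limits: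
  assumes pq: "0 < p" "0 < q" and pos: "0 < \<xi>" "0 < \<eta>" and s: "positive_sol p q \<xi> \<eta> u v"
  shows "(u \<longlongrightarrow> LU p q \<xi> \<eta>) at_top" "(v \<longlongrightarrow> LU q p \<eta> \<xi>) at_top"
proof -
  have "eventually (\<lambda>r. U p q \<xi> \<eta> r = u r) at_top" "eventually (\<lambda>r. U q p \<eta> \<xi> r = v r) at_top"
    using positive_sol_eq_U[OF pq pos s] by (auto intro: eventually_at_top_linorderI[of 0])
  then show "(u \<longlongrightarrow> LU p q \<xi> \<eta>) at_top" "(v \<longlongrightarrow> LU q p \<eta> \<xi>) at_top"
    using LU_props(1)[OF pq pos] LU_props(1)[OF pq(2,1) pos(2,1)] Lim_transform_eventually by blast+
qed

lemma positive_sol_exists_iff: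
  assumes pq: "0 < p" "0 < q" and pos: "0 < \<xi>" "0 < \<eta>"
  shows "(\<exists>u v. positive_sol p q \<xi> \<eta> u v) \<longleftrightarrow> 0 \<le> LU p q \<xi> \<eta> \<and> 0 \<le> LU q p \<eta> \<xi>"
proof
  assume "\<exists>u v. positive_sol p q \<xi> \<eta> u v"
  then obtain u v where s: "positive_sol p q \<xi> \<eta> u v" by blast
  then have "\<forall>r\<ge>0. 0 < U p q \<xi> \<eta> r" "\<forall>r\<ge>0. 0 < U q p \<eta> \<xi> r"
    using positive_sol_eq_U[OF pq pos s] by (auto simp: positive_sol_def)
  then show "0 \<le> LU p q \<xi> \<eta> \<and> 0 \<le> LU q p \<eta> \<xi>"
    using U_positive_iff[OF pq pos] U_positive_iff[OF pq(2,1) pos(2,1)] by blast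
next
  assume "0 \<le> LU p q \<xi> \<eta> \<and> 0 \<le> LU q p \<eta> \<xi>"
  then have "positive_sol p q \<xi> \<eta> (U p q \<xi> \<eta>) (U q p \<eta> \<xi>)"
    using sol_U[OF pq pos] U_positive_iff[OF pq pos] U_positive_iff[OF pq(2,1) pos(2,1)]
    by (auto simp: positive_sol_def)
  then show "\<exists>u v. positive_sol p q \<xi> \<eta> u v" by blast
qed

theorem shooting_region:
  assumes pq: "0 < p" "0 < q" and crit: "1 / (p + 1) + 1 / (q + 1) \<le> 1 - 2 * \<kappa>"
  shows "\<exists>\<eta>m \<eta>M :: real \<Rightarrow> real.
    continuous_on {0<..} \<eta>m \<and> strict_mono_on {0<..} \<eta>m \<and> bij_betw \<eta>m {0<..} {0<..} \<and>
    continuous_on {0<..} \<eta>M \<and> strict_mono_on {0<..} \<eta>M \<and> bij_betw \<eta>M {0<..} {0<..} \<and>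
    (\<forall>\<xi>>0. \<eta>m \<xi> < \<eta>M \<xi>) \<and>
    Limsup at_top (\<lambda>\<xi>. ereal (\<eta>M \<xi> - \<eta>m \<xi>)) < \<infinity> \<and>
    (\<forall>\<xi>>0. \<forall>\<eta>>0.
       (\<exists>u v. positive_sol p q \<xi> \<eta> u v) \<longleftrightarrow> \<eta>m \<xi> \<le> \<eta> \<and> \<eta> \<le> \<eta>M \<xi>) \<and>
    (\<forall>\<xi>>0. \<forall>\<eta>>0. \<forall>u v. positive_sol p q \<xi> \<eta> u v \<longrightarrow>
       (\<exists>lu lv. (u \<longlongrightarrow> lu) at_top \<and> (v \<longlongrightarrow> lv) at_top \<and>
          (\<eta> = \<eta>m \<xi> \<longrightarrow> lu > 0 \<and> lv = 0) \<and>
          (\<eta>m \<xi> < \<eta> \<and> \<eta> < \<eta>M \<xi> \<longrightarrow> lu > 0 \<and> lv > 0) \<and>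
          (\<eta> = \<eta>M \<xi> \<longrightarrow> lu = 0 \<and> lv > 0)))"
proof -
  obtain \<eta>M where M: "\<And>\<xi> \<eta>. 0 < \<xi> \<Longrightarrow> 0 < \<eta> \<Longrightarrow> 0 < LU p q \<xi> \<eta> \<longleftrightarrow> \<eta> < \<eta>M \<xi>"
    "\<And>\<xi> \<eta>. 0 < \<xi> \<Longrightarrow> 0 < \<eta> \<Longrightarrow> LU p q \<xi> \<eta> = 0 \<longleftrightarrow> \<eta> = \<eta>M \<xi>"
    "continuous_on {0<..} \<eta>M" "strict_mono_on {0<..} \<eta>M" "bij_betw \<eta>M {0<..} {0<..}"
  proof (rule zero_curve[where F = "LU p q"])
    show "LU p q x y < LU p q x' y" if "0 < x" "x < x'" "0 < y" for x x' y
      using LU_compare[OF pq that(1,3), of x' y] that by simp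
    show "LU p q x y' < LU p q x y" if "0 < x" "0 < y" "y < y'" for x y y'
      by (rule LU_strict_dec[OF pq that])
    show "\<exists>d>0. \<forall>x'>0. \<forall>y'>0. \<bar>x' - x\<bar> < d \<longrightarrow> \<bar>y' - y\<bar> < d \<longrightarrow> \<bar>LU p q x' y' - LU p q x y\<bar> < e"
      if "0 < x" "0 < y" "0 < e" for x y e by (rule LU_continuity[OF pq that])
  qed (use LU_signs[OF pq] in blast)+
  obtain \<eta>m where m: "\<And>\<xi> \<eta>. 0 < \<xi> \<Longrightarrow> 0 < \<eta> \<Longrightarrow> 0 < - LU q p \<eta> \<xi> \<longleftrightarrow> \<eta> < \<eta>m \<xi>"
    "\<And>\<xi> \<eta>. 0 < \<xi> \<Longrightarrow> 0 < \<eta> \<Longrightarrow> - LU q p \<eta> \<xi> = 0 \<longleftrightarrow> \<eta> = \<eta>m \<xi>"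
    "continuous_on {0<..} \<eta>m" "strict_mono_on {0<..} \<eta>m" "bij_betw \<eta>m {0<..} {0<..}"
  \<comment> \<open>The sign is reversed to make the function increasing in \<open>\<xi>\<close> and
    decreasing in \<open>\<eta>\<close>, as \<open>zero_curve\<close> requires.\<close>
  proof (rule zero_curve[where F = "\<lambda>\<xi> \<eta>. - LU q p \<eta> \<xi>"])
    show "- LU q p y x < - LU q p y x'" if "0 < x" "x < x'" "0 < y" for x x' y
      using LU_strict_dec[OF pq(2,1) that(3,1,2)] by simp
    show "- LU q p y' x < - LU q p y x" if "0 < x" "0 < y" "y < y'" for x y y'
      using LU_compare[OF pq(2,1) that(2,1), of y' x] that by simp
    show "\<exists>d>0. \<forall>x'>0. \<forall>y'>0. \<bar>x' - x\<bar> < d \<longrightarrow> \<bar>y' - y\<bar> < d \<longrightarrow> \<bar>- LU q p y' x' - - LU q p y x\<bar> < e"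
      if xye: "0 < x" "0 < y" "0 < e" for x y e
    proof -
      obtain d where "0 < d" "\<forall>x'>0. \<forall>y'>0. \<bar>x' - y\<bar> < d \<longrightarrow> \<bar>y' - x\<bar> < d \<longrightarrow> \<bar>LU q p x' y' - LU q p y x\<bar> < e"
        using LU_continuity[OF pq(2,1) xye(2,1,3)] by blast
      then show ?thesis by (intro exI[of _ d]) (auto simp: abs_minus_commute)
    qed
  qed (use LU_signs[OF pq(2,1)] in \<open>simp; blast\<close>)+
  have m': "0 < LU q p \<eta> \<xi> \<longleftrightarrow> \<eta>m \<xi> < \<eta>" "LU q p \<eta> \<xi> = 0 \<longleftrightarrow> \<eta> = \<eta>m \<xi>" if "0 < \<xi>" "0 < \<eta>" for \<xi> \<eta>
    using m(1,2)[OF that] by (auto simp: not_less)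
  have mpos: "0 < \<eta>m \<xi>" and Mpos: "0 < \<eta>M \<xi>" if "0 < \<xi>" for \<xi>
    using bij_betwE[OF m(5)] bij_betwE[OF M(5)] that by auto
  have sol_iff: "(\<exists>u v. positive_sol p q \<xi> \<eta> u v) \<longleftrightarrow> \<eta>m \<xi> \<le> \<eta> \<and> \<eta> \<le> \<eta>M \<xi>" if "0 < \<xi>" "0 < \<eta>" for \<xi> \<eta>
    using positive_sol_exists_iff[OF pq that] M(1,2)[OF that] m'[OF that] by (auto simp: le_less)
  have less: "\<eta>m \<xi> < \<eta>M \<xi>" if \<xi>: "0 < \<xi>" for \<xi>
  proof (rule ccontr)
    assume n: "\<not> \<eta>m \<xi> < \<eta>M \<xi>"
    obtain \<eta> where \<eta>: "0 < \<eta>" "0 \<le> LU p q \<xi> \<eta>" "0 \<le> LU q p \<eta> \<xi>"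
      using positive_solution_exists[OF pq \<xi> crit] by blast
    then obtain u v where s: "positive_sol p q \<xi> \<eta> u v" using positive_sol_exists_iff[OF pq \<xi> \<eta>(1)] by blast
    then have "\<eta>m \<xi> \<le> \<eta> \<and> \<eta> \<le> \<eta>M \<xi>" using sol_iff[OF \<xi> \<eta>(1)] by blast
    then have "\<eta> = \<eta>m \<xi>" "\<eta> = \<eta>M \<xi>" using n by auto
    then have "LU p q \<xi> \<eta> = 0" "LU q p \<eta> \<xi> = 0" using M(2)[OF \<xi> \<eta>(1)] m'(2)[OF \<xi> \<eta>(1)] by auto
    then show False
      using no_vanishing[OF pq \<xi> \<eta>(1) _ crit, of u v] positive_sol_limits[OF pq \<xi> \<eta>(1) s] s
      by (simp add: positive_sol_def)
  qed
  obtain C where C: "\<And>\<xi> \<eta> u v l. sol p q \<xi> \<eta> u v \<Longrightarrow> (\<And>r. 0 \<le> r \<Longrightarrow> 0 < u r \<and> 0 < v r) \<Longrightarrow>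
      (v \<longlongrightarrow> l) at_top \<Longrightarrow> l \<le> C"
    using universal_bound[OF pq exponents_superlinear[OF pq crit]] by blast
  have gap: "\<eta>M \<xi> - \<eta>m \<xi> \<le> C" if \<xi>: "0 < \<xi>" for \<xi>
  proof -
    obtain u v where s: "positive_sol p q \<xi> (\<eta>M \<xi>) u v"
      using sol_iff[OF \<xi> Mpos[OF \<xi>]] less[OF \<xi>] by auto
    have "LU q p (\<eta>M \<xi>) \<xi> \<le> C"
      by (rule C[of \<xi> "\<eta>M \<xi>" u v]) (use s positive_sol_limits(2)[OF pq \<xi> Mpos[OF \<xi>] s] in \<open>auto simp: positive_sol_def\<close>)
    \<comment> \<open>For equal \<open>\<xi>\<close> comparison preserves the initial gap in the
      second component up to infinity.\<close>
    moreover have "\<eta>M \<xi> - \<eta>m \<xi> \<le> LU q p (\<eta>M \<xi>) \<xi> - LU q p (\<eta>m \<xi>) \<xi>"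
      using LU_compare[OF pq(2,1) mpos[OF \<xi>] \<xi>, of "\<eta>M \<xi>" \<xi>] less[OF \<xi>] by simp
    moreover have "LU q p (\<eta>m \<xi>) \<xi> = 0" using m'(2)[OF \<xi> mpos[OF \<xi>]] by simp
    ultimately show ?thesis by simp
  qed
  have "Limsup at_top (\<lambda>\<xi>. ereal (\<eta>M \<xi> - \<eta>m \<xi>)) \<le> ereal C"
    by (rule Limsup_bounded) (use gap in \<open>auto intro!: eventually_at_top_linorderI[of 1]\<close>)
  then have Ls: "Limsup at_top (\<lambda>\<xi>. ereal (\<eta>M \<xi> - \<eta>m \<xi>)) < \<infinity>"
    by (rule order.strict_trans1) simp
  have limits: "\<exists>lu lv. (u \<longlongrightarrow> lu) at_top \<and> (v \<longlongrightarrow> lv) at_top \<and>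
          (\<eta> = \<eta>m \<xi> \<longrightarrow> lu > 0 \<and> lv = 0) \<and>
          (\<eta>m \<xi> < \<eta> \<and> \<eta> < \<eta>M \<xi> \<longrightarrow> lu > 0 \<and> lv > 0) \<and>
          (\<eta> = \<eta>M \<xi> \<longrightarrow> lu = 0 \<and> lv > 0)"
    if pos: "0 < \<xi>" "0 < \<eta>" and s: "positive_sol p q \<xi> \<eta> u v" for \<xi> \<eta> u v
    using positive_sol_limits[OF pq pos s] M(1,2)[OF pos] m'[OF pos] less[OF pos(1)]
    by (intro exI[of _ "LU p q \<xi> \<eta>"] exI[of _ "LU q p \<eta> \<xi>"]) auto
  show ?thesis
    by (rule exI[of _ \<eta>m], rule exI[of _ \<eta>M], intro conjI allI impI M m less Ls sol_iff limits)
qed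

section \<open>Classical solutions\<close>

text \<open>Where \<open>v\<close> is positive the truncated power equals the signed one. The second
  derivative comes from the quotient rule for the flux and is claimed for \<open>r > 0\<close> only,
  since \<open>w\<close> vanishes at \<open>0\<close>.\<close>

lemma sol_imp_classical:
  assumes pq: "0 < p" "0 < q" and s: "sol p q \<xi> \<eta> u v" and pos: "\<And>r. 0 \<le> r \<Longrightarrow> 0 < v r"
  shows "\<exists>u' u''. C1_with_deriv {0..} u u' \<and> C1_with_deriv {0<..} u' u'' \<and>
    (\<forall>r>0. (\<lambda>s. w s * u' s) differentiable (at r) \<and>
       deriv (\<lambda>s. w s * u' s) r + w r * \<bar>v r\<bar> powr (q - 1) * v r = 0) \<and> u' 0 = 0"
proof -
  define h where "h = (\<lambda>t. pw q (v t))"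
  have h: "adm h" "continuous_on {0..} h"
    unfolding h_def using sol_adm(1)[OF s] sol_pw_cont[OF pq(2) s] by auto
  define u'' where "u'' = (\<lambda>r. - ((w r * h r * w r - mass h r * w' r) / (w r * w r)))"
  have u': "C1_with_deriv {0..} u (\<lambda>r. - flux h r)"
    unfolding C1_with_deriv_def h_def
    by (intro conjI ballI sol_deriv_within[OF s] continuous_intros flux_cont sol_adm[OF s]) auto
  have "((\<lambda>r. - flux h r) has_real_derivative u'' r) (at r)" if "0 < r" for r
    unfolding u''_def flux_def[abs_def] using w_pos[OF that] that h
    by (intro DERIV_minus DERIV_divide mass_has_derivative w_deriv) auto
  moreover have "continuous_on {0<..} u''"
  proof -
    have "\<forall>r\<in>{0<..}. w r * w r \<noteq> 0"
    proof
      fix r :: real assume "r \<in> {0<..}"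
      then show "w r * w r \<noteq> 0" using w_pos[of r] by simp
    qed
    then show ?thesis
      unfolding u''_def
      by (intro continuous_on_minus continuous_on_divide continuous_on_diff continuous_on_mult
          continuous_on_subset[OF w_cont] continuous_on_subset[OF h(2)]
          continuous_on_subset[OF mass_cont[OF h(1)]] w'_cont) auto
  qed
  ultimately have u'': "C1_with_deriv {0<..} (\<lambda>r. - flux h r) u''"
    unfolding C1_with_deriv_def by (auto intro: has_field_derivative_at_within)
  have eq: "(\<lambda>s. w s * - flux h s) differentiable (at r) \<and>
       deriv (\<lambda>s. w s * - flux h s) r + w r * \<bar>v r\<bar> powr (q - 1) * v r = 0" if r: "0 < r" for r
  proof -
    have "((\<lambda>s. - mass h s) has_real_derivative - (w r * h r)) (at r)"
      by (intro DERIV_minus mass_has_derivative h r)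
    then have d: "((\<lambda>s. w s * - flux h s) has_real_derivative - (w r * h r)) (at r)"
    proof (rule has_field_derivative_transform_within_open[of _ _ _ "{0<..}"])
      show "- mass h s = w s * - flux h s" if "s \<in> {0<..}" for s
        using w_pos[of s] that by (simp add: flux_def)
    qed (use r in auto)
    have "h r = \<bar>v r\<bar> powr (q - 1) * v r"
      using pos[of r] r by (simp add: h_def pw_pos_eq powr_diff)
    then show ?thesis using d DERIV_imp_deriv[OF d] by (auto simp: real_differentiable_def mult.assoc)
  qed
  show ?thesis
    by (rule exI[of _ "\<lambda>r. - flux h r"], rule exI[of _ u'']) (use u' u'' eq in auto)
qed

text \<open>Supplies the upper bound that admissibility requires: continuity alone does not bound a
  classical solution on the half-line.\<close>

lemma radial_ode_nonincreasing:
  assumes u: "C1_with_deriv {0..} u u'"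
    and ode: "\<And>r. 0 < r \<Longrightarrow> ((\<lambda>s. w s * u' s) has_real_derivative - (w r * h r)) (at r)"
    and h: "\<And>r. 0 \<le> r \<Longrightarrow> 0 \<le> h r" and r: "0 \<le> r"
  shows "u r \<le> u 0"
proof (rule nonincreasing_of_deriv[OF r, where f = u and D = u'])
  show "continuous_on {0..r} u"
    by (rule continuous_on_subset[of "{0..}"], rule DERIV_continuous_on[where D = u'])
      (use u in \<open>auto simp: C1_with_deriv_def\<close>)
  fix x assume x: "0 < x" "x < r"
  show "(u has_real_derivative u' x) (at x)"
    using u x DERIV_of_within_Ici[of u "u' x" x 0] by (auto simp: C1_with_deriv_def)
  have cu': "continuous_on {0..} u'" using u unfolding C1_with_deriv_def by blast
  have "w x * u' x \<le> w 0 * u' 0"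
  proof (rule nonincreasing_of_deriv[where f = "\<lambda>s. w s * u' s" and D = "\<lambda>r. - (w r * h r)"])
    show "continuous_on {0..x} (\<lambda>s. w s * u' s)"
      by (intro continuous_intros continuous_on_subset[OF w_cont] continuous_on_subset[OF cu']) auto
    fix y assume y: "0 < y" "y < x"
    show "((\<lambda>s. w s * u' s) has_real_derivative - (w y * h y)) (at y)" by (rule ode[OF y(1)])
    show "- (w y * h y) \<le> 0" using h[of y] w_nonneg[of y] y by simp
  qed (use x in simp)
  then show "u' x \<le> 0" using w_pos[OF x(1)] by (simp add: w_zero mult_le_0_iff)
qed

text \<open>Both \<open>w * u' + mass h\<close> and \<open>u + pot h\<close> have zero derivative;
  \<open>w 0 = 0\<close> fixes the constant of the first.\<close>

lemma radial_ode_integrated: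
  assumes u: "C1_with_deriv {0..} u u'"
    and ode: "\<And>r. 0 < r \<Longrightarrow> ((\<lambda>s. w s * u' s) has_real_derivative - (w r * h r)) (at r)"
    and h: "adm h" "continuous_on {0..} h" and r: "0 \<le> r"
  shows "u r = u 0 - pot h r"
proof (cases "r = 0")
  case False
  have cu': "continuous_on {0..} u'" using u unfolding C1_with_deriv_def by blast
  have flux: "u' x = - flux h x" if x: "0 < x" for x
  proof -
    have "w x * u' x + mass h x = w 0 * u' 0 + mass h 0"
    proof (rule DERIV_isconst_end[OF x, where f = "\<lambda>x. w x * u' x + mass h x"])
      show "continuous_on {0..x} (\<lambda>x. w x * u' x + mass h x)"
        by (intro continuous_intros continuous_on_subset[OF w_cont] continuous_on_subset[OF cu']
            continuous_on_subset[OF mass_cont[OF h(1)]]) auto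
      fix y :: real assume y: "0 < y" "y < x"
      show "((\<lambda>x. w x * u' x + mass h x) has_real_derivative 0) (at y)"
        using DERIV_add[OF ode[OF y(1)] mass_has_derivative[OF h(2) y(1)]] by simp
    qed
    then show ?thesis using w_pos[OF x] by (simp add: w_zero flux_def field_simps)
  qed
  have r0: "0 < r" using r False by simp
  have "u r + pot h r = u 0 + pot h 0"
  proof (rule DERIV_isconst_end[OF r0, where f = "\<lambda>x. u x + pot h x"])
    have "continuous_on {0..} u"
      by (rule DERIV_continuous_on[where D = u']) (use u in \<open>auto simp: C1_with_deriv_def\<close>)
    note cu = this
    show "continuous_on {0..r} (\<lambda>x. u x + pot h x)"
      by (intro continuous_intros continuous_on_subset[OF cu] continuous_on_subset[OF pot_cont[OF h(1)]]) auto
    fix y :: real assume y: "0 < y" "y < r"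
    have "(u has_real_derivative u' y) (at y)"
      using u y DERIV_of_within_Ici[of u "u' y" y 0] by (auto simp: C1_with_deriv_def)
    then show "((\<lambda>x. u x + pot h x) has_real_derivative 0) (at y)"
      using DERIV_add[OF _ pot_deriv_at[OF h(1) y(1)]] flux[OF y(1)] by fastforce
  qed
  then show ?thesis by simp
qed simp

end

section \<open>Cartan-Hadamard models\<close>

text \<open>Convexity enters as the tangent inequality. Evaluated at the pole it gives
  \<open>deriv \<psi> r * r \<ge> \<psi> r > 0\<close>; two tangents added give the monotonicity of
  \<open>deriv \<psi>\<close>.\<close>

lemma cartan_hadamard_facts:
  assumes "cartan_hadamard_model \<psi>"
  shows "continuous_on {0..} \<psi>" "\<psi> 0 = 0" "0 < r \<Longrightarrow> 0 < \<psi> r"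
    "0 < r \<Longrightarrow> (\<psi> has_real_derivative deriv \<psi> r) (at r)"
    "continuous_on {0<..} (deriv \<psi>)"
    "0 < r \<Longrightarrow> 0 < deriv \<psi> r"
    "0 < s \<Longrightarrow> s \<le> r \<Longrightarrow> deriv \<psi> s \<le> deriv \<psi> r"
proof -
  have mf: "model_function \<psi>" and convex: "convex_on {0..} \<psi>"
    using assms by (auto simp: cartan_hadamard_model_def)
  obtain \<psi>' where "C1_with_deriv {0..} \<psi> \<psi>'" using mf by (auto simp: model_function_def)
  then show cont: "continuous_on {0..} \<psi>"
    by (intro DERIV_continuous_on[where D = \<psi>']) (auto simp: C1_with_deriv_def)
  show zero: "\<psi> 0 = 0" and pos: "\<And>r. 0 < r \<Longrightarrow> 0 < \<psi> r" using mf by (auto simp: model_function_def)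
  have smooth: "((deriv ^^ k) \<psi>) differentiable (at r)" if "0 < r" for k r
    using mf that by (auto simp: model_function_def)
  show der: "(\<psi> has_real_derivative deriv \<psi> r) (at r)" if "0 < r" for r
    using smooth[OF that, of 0] by (simp add: DERIV_deriv_iff_real_differentiable)
  show "continuous_on {0<..} (deriv \<psi>)"
    using smooth[of _ 1] by (intro continuous_at_imp_continuous_on ballI differentiable_imp_continuous_within) auto
  have tangent: "deriv \<psi> c * (x - c) \<le> \<psi> x - \<psi> c" if "0 < c" "0 \<le> x" for c x
    using that der[OF that(1)]
    by (intro convex_on_imp_above_tangent[OF convex]) (auto intro: has_field_derivative_at_within)
  show "0 < deriv \<psi> r" if "0 < r" for r
  proof -
    have "0 < deriv \<psi> r * r" using tangent[OF that, of 0] zero pos[OF that] by simp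
    then show ?thesis using that by (simp add: zero_less_mult_iff)
  qed
  show "deriv \<psi> s \<le> deriv \<psi> r" if "0 < s" "s \<le> r" for s r
  proof (cases "s = r")
    case False
    then have sr: "0 < r - s" using that by simp
    have "deriv \<psi> s * (r - s) \<le> deriv \<psi> r * (r - s)"
      using tangent[of s r] tangent[of r s] that by (simp add: algebra_simps)
    then show ?thesis using sr by (simp add: mult_le_cancel_right)
  qed simp
qed

text \<open>Since \<open>deriv \<psi>\<close> is nondecreasing, \<open>\<psi> r ^ n / n\<close>, the
  integral of \<open>\<psi> ^ (n - 1) * deriv \<psi>\<close>, is at most
  \<open>deriv \<psi> r\<close> times the integral of \<open>\<psi> ^ (n - 1)\<close>. Multiplying
  by \<open>(n - 1) * \<psi> r ^ (n - 2)\<close> gives the claim.\<close>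

lemma cartan_hadamard_curvature:
  fixes n :: nat
  assumes ch: "cartan_hadamard_model \<psi>" and n: "3 \<le> n" and r: "0 < r"
  shows "(1 - 1 / real n) * (\<psi> r ^ (n - 1))\<^sup>2
    \<le> real (n - 1) * \<psi> r ^ (n - 2) * deriv \<psi> r * integral {0..r} (\<lambda>s. \<psi> s ^ (n - 1))"
proof -
  note facts = cartan_hadamard_facts[OF ch]
  define w where "w = (\<lambda>s. \<psi> s ^ (n - 1))"
  have w_cont: "continuous_on {0..r} w"
    unfolding w_def by (intro continuous_intros continuous_on_subset[OF facts(1)]) auto
  have "deriv \<psi> r * integral {0..0} w - \<psi> 0 ^ n / n \<le> deriv \<psi> r * integral {0..r} w - \<psi> r ^ n / n"
  proof (rule nondecreasing_of_deriv[where f = "\<lambda>s. deriv \<psi> r * integral {0..s} w - \<psi> s ^ n / n"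
        and D = "\<lambda>s. deriv \<psi> r * w s - w s * deriv \<psi> s"])
    have "continuous_on {0..r} (\<lambda>s. integral {0..s} w)"
      by (intro indefinite_integral_continuous_1 integrable_continuous_interval w_cont)
    moreover have "continuous_on {0..r} \<psi>" by (rule continuous_on_subset[OF facts(1)]) auto
    ultimately show "continuous_on {0..r} (\<lambda>s. deriv \<psi> r * integral {0..s} w - \<psi> s ^ n / n)"
      using n by (intro continuous_intros) auto
    fix x assume x: "0 < x" "x < r"
    have "((\<lambda>s. integral {0..s} w) has_real_derivative w x) (at x within {0..r})"
      using x by (intro integral_has_real_derivative w_cont) auto
    then have dI: "((\<lambda>s. integral {0..s} w) has_real_derivative w x) (at x)"
      using x at_within_interior[of x "{0..r}"] by simp
    have "((\<lambda>s. \<psi> s ^ n) has_real_derivative real n * (deriv \<psi> x * \<psi> x ^ (n - Suc 0))) (at x)"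
      using DERIV_power[OF facts(4)[OF x(1)], of n] by simp
    then have "((\<lambda>s. \<psi> s ^ n / n) has_real_derivative real n * (deriv \<psi> x * \<psi> x ^ (n - Suc 0)) / n) (at x)"
      by (rule DERIV_cdivide)
    then have "((\<lambda>s. \<psi> s ^ n / n) has_real_derivative w x * deriv \<psi> x) (at x)"
      using n by (simp add: w_def mult.commute)
    then show "((\<lambda>s. deriv \<psi> r * integral {0..s} w - \<psi> s ^ n / n) has_real_derivative
        deriv \<psi> r * w x - w x * deriv \<psi> x) (at x)"
      by (intro DERIV_diff DERIV_cmult dI)
    have "w x * deriv \<psi> x \<le> w x * deriv \<psi> r"
      using facts(7)[of x r] facts(3)[of x] x by (intro mult_left_mono) (auto simp: w_def)
    then show "0 \<le> deriv \<psi> r * w x - w x * deriv \<psi> x" by (simp add: mult.commute)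
  qed (use r in simp)
  then have key: "\<psi> r ^ n / n \<le> deriv \<psi> r * integral {0..r} w"
    using facts(2) n by (simp add: power_0_left)
  \<comment> \<open>Removes the truncated subtractions \<open>n - 1\<close> and
    \<open>n - 2\<close>.\<close>
  obtain m where m: "n = m + 2" using n that[of "n - 2"] by simp
  have "(1 - 1 / real n) * (\<psi> r ^ (n - 1))\<^sup>2 = real (n - 1) * \<psi> r ^ (n - 2) * (\<psi> r ^ n / n)"
    unfolding m by (simp add: field_simps power2_eq_square)
  also have "\<dots> \<le> real (n - 1) * \<psi> r ^ (n - 2) * (deriv \<psi> r * integral {0..r} w)"
    using key facts(3)[OF r] by (intro mult_left_mono) auto
  finally show ?thesis by (simp add: w_def mult.assoc)
qed

text \<open>Passes from Lebesgue to gauge integrals; the point \<open>0\<close>, missing from the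
  hypothesis, is negligible, and the integrand is nonnegative.\<close>

lemma Theta_integral_bounded:
  assumes ch: "cartan_hadamard_model \<psi>" and int: "set_integrable lborel {0<..} (Theta n \<psi>)"
  shows "\<exists>B. \<forall>r\<ge>0. integral {0..r} (\<lambda>s. integral {0..s} (\<lambda>t. \<psi> t ^ (n - 1)) / \<psi> s ^ (n - 1)) \<le> B"
proof -
  note facts = cartan_hadamard_facts[OF ch]
  define h where "h = (\<lambda>s. integral {0..s} (\<lambda>t. \<psi> t ^ (n - 1)) / \<psi> s ^ (n - 1))"
  have eq: "Theta n \<psi> = h"
  proof
    fix r
    have "continuous_on {0..r} (\<lambda>t. \<psi> t ^ (n - 1))"
      by (intro continuous_intros continuous_on_subset[OF facts(1)]) auto
    from set_borel_integral_eq_integral(2)[OF borel_integrable_atLeastAtMost'[OF this]]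
    show "Theta n \<psi> r = h r" by (simp add: Theta_def h_def)
  qed
  have \<psi>_nonneg: "0 \<le> \<psi> t" if "0 \<le> t" for t using facts(2) facts(3)[of t] that by (cases "t = 0") auto
  have nonneg: "0 \<le> h s" if "0 \<le> s" for s
    unfolding h_def using that \<psi>_nonneg
    by (intro divide_nonneg_nonneg integral_nonneg integrable_continuous_interval continuous_intros
        continuous_on_subset[OF facts(1)]) auto
  have "h integrable_on {0<..}" using set_borel_integral_eq_integral(1)[OF int] by (simp add: eq)
  then have "h integrable_on {0..}"
  proof (rule integrable_spike_set)
    have "{x \<in> {0..} - {0<..}. h x \<noteq> 0} \<subseteq> {0}" by auto
    then show "negligible {x \<in> {0..} - {0<..}. h x \<noteq> 0}" by (rule negligible_subset[OF negligible_sing])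
    have "{x \<in> {0<..} - {0..}. h x \<noteq> 0} = {}" by auto
    then show "negligible {x \<in> {0<..} - {0..}. h x \<noteq> 0}" by (simp only: negligible_empty)
  qed
  then have "integral {0..r} h \<le> integral {0..} h" for r
    by (intro integral_subset_le integrable_on_subinterval[of h "{0..}"]) (auto intro: nonneg)
  then show ?thesis unfolding h_def by blast
qed

lemma cartan_hadamard_radial_weight:
  fixes n :: nat
  assumes ch: "cartan_hadamard_model \<psi>" and n: "3 \<le> n" and int: "set_integrable lborel {0<..} (Theta n \<psi>)"
  shows "radial_weight (\<lambda>r. \<psi> r ^ (n - 1)) (\<lambda>r. real (n - 1) * \<psi> r ^ (n - 2) * deriv \<psi> r) (1 / real n)"
proof
  note facts = cartan_hadamard_facts[OF ch]
  show "continuous_on {0..} (\<lambda>r. \<psi> r ^ (n - 1))" by (intro continuous_intros facts(1))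
  show "\<psi> 0 ^ (n - 1) = 0" using facts(2) n by simp
  show "0 < \<psi> r ^ (n - 1)" if "0 < r" for r using facts(3)[OF that] by simp
  show "\<psi> r ^ (n - 1) \<le> \<psi> s ^ (n - 1)" if "0 \<le> r" "r \<le> s" for r s
  proof (rule power_mono)
    show "\<psi> r \<le> \<psi> s"
    proof (rule nondecreasing_of_deriv[OF that(2), where f = \<psi> and D = "deriv \<psi>"])
      show "continuous_on {r..s} \<psi>" using that by (intro continuous_on_subset[OF facts(1)]) auto
      show "(\<psi> has_real_derivative deriv \<psi> x) (at x)" "0 \<le> deriv \<psi> x" if "r < x" "x < s" for x
        using facts(4,6)[of x] that \<open>0 \<le> r\<close> by auto
    qed
    show "0 \<le> \<psi> r" using facts(2) facts(3)[of r] that by (cases "r = 0") auto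
  qed
  show "((\<lambda>r. \<psi> r ^ (n - 1)) has_real_derivative real (n - 1) * \<psi> r ^ (n - 2) * deriv \<psi> r) (at r)" if "0 < r" for r
  proof -
    have "n - 1 - Suc 0 = n - 2" by simp
    then show ?thesis using DERIV_power[OF facts(4)[OF that], of "n - 1"] by (simp add: mult_ac)
  qed
  show "continuous_on {0<..} (\<lambda>r. real (n - 1) * \<psi> r ^ (n - 2) * deriv \<psi> r)"
    by (intro continuous_intros facts(5) continuous_on_subset[OF facts(1)]) auto
  show "0 < 1 / real n" "1 / real n < 1 / 2" using n by auto
  show "(1 - 1 / real n) * (\<psi> r ^ (n - 1))\<^sup>2
      \<le> real (n - 1) * \<psi> r ^ (n - 2) * deriv \<psi> r * integral {0..r} (\<lambda>r. \<psi> r ^ (n - 1))" if "0 < r" for r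
    by (rule cartan_hadamard_curvature[OF ch n that])
  show "\<exists>B. \<forall>r\<ge>0. integral {0..r} (\<lambda>s. integral {0..s} (\<lambda>r. \<psi> r ^ (n - 1)) / \<psi> s ^ (n - 1)) \<le> B"
    by (rule Theta_integral_bounded[OF ch int])
qed

text \<open>On positive functions the truncated and the signed powers agree. In the forward
  direction monotonicity is shown first: the bound it gives makes the right-hand sides admissible,
  and only then are the equations integrated.\<close>

lemma globally_positive_solution_iff:
  fixes n :: nat
  assumes rw: "radial_weight (\<lambda>r. \<psi> r ^ (n - 1)) w' \<kappa>" and pq: "0 < p" "0 < q"
  shows "globally_positive_solution n \<psi> p q \<xi> \<eta> u v \<longleftrightarrow>
    radial_weight.positive_sol (\<lambda>r. \<psi> r ^ (n - 1)) p q \<xi> \<eta> u v"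
proof -
  interpret radial_weight "\<lambda>r. \<psi> r ^ (n - 1)" w' \<kappa> by (rule rw)
  show ?thesis
  proof
    assume g: "globally_positive_solution n \<psi> p q \<xi> \<eta> u v"
    then have pos: "\<forall>r\<ge>0. 0 < u r \<and> 0 < v r" and init: "u 0 = \<xi>" "v 0 = \<eta>"
      by (auto simp: globally_positive_solution_def CP_global_solution_def)
    obtain u' v' where C: "C1_with_deriv {0..} u u'" "C1_with_deriv {0..} v v'"
      and ode: "\<And>r. 0 < r \<Longrightarrow> (\<lambda>s. \<psi> s ^ (n - 1) * u' s) differentiable (at r) \<and>
               deriv (\<lambda>s. \<psi> s ^ (n - 1) * u' s) r + \<psi> r ^ (n - 1) * \<bar>v r\<bar> powr (q - 1) * v r = 0"
        "\<And>r. 0 < r \<Longrightarrow> (\<lambda>s. \<psi> s ^ (n - 1) * v' s) differentiable (at r) \<and>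
               deriv (\<lambda>s. \<psi> s ^ (n - 1) * v' s) r + \<psi> r ^ (n - 1) * \<bar>u r\<bar> powr (p - 1) * u r = 0"
      using g unfolding globally_positive_solution_def CP_global_solution_def by blast
    have odeD: "(f has_real_derivative - (\<psi> r ^ (n - 1) * pw s z)) (at r)"
      if "f differentiable (at r) \<and> deriv f r + \<psi> r ^ (n - 1) * \<bar>z\<bar> powr (s - 1) * z = 0" "0 < z" for f z s r
    proof -
      have "pw s z = \<bar>z\<bar> powr (s - 1) * z" using that(2) by (simp add: pw_pos_eq powr_diff)
      then have "deriv f r = - (\<psi> r ^ (n - 1) * pw s z)" using that(1) by (simp add: mult.assoc)
      then show ?thesis using that(1) by (metis DERIV_deriv_iff_real_differentiable)
    qed
    have du: "((\<lambda>s. \<psi> s ^ (n - 1) * u' s) has_real_derivative - (\<psi> r ^ (n - 1) * pw q (v r))) (at r)"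
      and dv: "((\<lambda>s. \<psi> s ^ (n - 1) * v' s) has_real_derivative - (\<psi> r ^ (n - 1) * pw p (u r))) (at r)"
      if "0 < r" for r
      using odeD[OF ode(1)[OF that]] odeD[OF ode(2)[OF that]] pos that by auto
    have cu: "continuous_on {0..} u" and cv: "continuous_on {0..} v"
      using C DERIV_continuous_on[of "{0..}" u u'] DERIV_continuous_on[of "{0..}" v v'] by (auto simp: C1_with_deriv_def)
    have le: "u r \<le> \<xi>" "v r \<le> \<eta>" if "0 \<le> r" for r
      using radial_ode_nonincreasing[OF C(1) du _ that] radial_ode_nonincreasing[OF C(2) dv _ that] init by auto
    have a: "adm (\<lambda>t. pw q (v t))" "adm (\<lambda>t. pw p (u t))"
      using adm_pw[OF pq(2) cv le(2)] adm_pw[OF pq(1) cu le(1)] by auto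
    have c: "continuous_on {0..} (\<lambda>t. pw q (v t))" "continuous_on {0..} (\<lambda>t. pw p (u t))"
      using continuous_on_compose2[OF continuous_pw[OF pq(2), of UNIV] cv]
        continuous_on_compose2[OF continuous_pw[OF pq(1), of UNIV] cu] by auto
    show "positive_sol p q \<xi> \<eta> u v"
      unfolding positive_sol_def sol_def
      using a pos radial_ode_integrated[OF C(1) du a(1) c(1)] radial_ode_integrated[OF C(2) dv a(2) c(2)] init by auto
  next
    assume g: "positive_sol p q \<xi> \<eta> u v"
    then have s: "sol p q \<xi> \<eta> u v" and pos: "\<And>r. 0 \<le> r \<Longrightarrow> 0 < u r" "\<And>r. 0 \<le> r \<Longrightarrow> 0 < v r"
      unfolding positive_sol_def by blast+
    have s': "sol q p \<eta> \<xi> v u" by (rule sol_swap[THEN iffD1, OF s])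
    from sol_imp_classical[OF pq s pos(2)] sol_imp_classical[OF pq(2,1) s' pos(1)] sol_0[OF s] pos
    show "globally_positive_solution n \<psi> p q \<xi> \<eta> u v"
      unfolding globally_positive_solution_def CP_global_solution_def by blast
  qed
qed

theorem theorem1p2:
  fixes n :: nat and \<psi> :: "real \<Rightarrow> real" and p q :: real
  assumes "n \<ge> 3"
    and "cartan_hadamard_model \<psi>"
    and "set_integrable lborel {0<..} (Theta n \<psi>)"
    and "p > 0" and "q > 0"
    and "1 / (p + 1) + 1 / (q + 1) \<le> (real n - 2) / real n"
  shows "\<exists>\<eta>m \<eta>M :: real \<Rightarrow> real.
    continuous_on {0<..} \<eta>m \<and> strict_mono_on {0<..} \<eta>m \<and> bij_betw \<eta>m {0<..} {0<..} \<and>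
    continuous_on {0<..} \<eta>M \<and> strict_mono_on {0<..} \<eta>M \<and> bij_betw \<eta>M {0<..} {0<..} \<and>
    (\<forall>\<xi>>0. \<eta>m \<xi> < \<eta>M \<xi>) \<and>
    Limsup at_top (\<lambda>\<xi>. ereal (\<eta>M \<xi> - \<eta>m \<xi>)) < \<infinity> \<and>
    (\<forall>\<xi>>0. \<forall>\<eta>>0.
       (\<exists>u v. globally_positive_solution n \<psi> p q \<xi> \<eta> u v) \<longleftrightarrow> \<eta>m \<xi> \<le> \<eta> \<and> \<eta> \<le> \<eta>M \<xi>) \<and>
    (\<forall>\<xi>>0. \<forall>\<eta>>0. \<forall>u v. globally_positive_solution n \<psi> p q \<xi> \<eta> u v \<longrightarrow>
       (\<exists>lu lv. (u \<longlongrightarrow> lu) at_top \<and> (v \<longlongrightarrow> lv) at_top \<and>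
          (\<eta> = \<eta>m \<xi> \<longrightarrow> lu > 0 \<and> lv = 0) \<and>
          (\<eta>m \<xi> < \<eta> \<and> \<eta> < \<eta>M \<xi> \<longrightarrow> lu > 0 \<and> lv > 0) \<and>
          (\<eta> = \<eta>M \<xi> \<longrightarrow> lu = 0 \<and> lv > 0)))"
proof -
  have rw: "radial_weight (\<lambda>r. \<psi> r ^ (n - 1)) (\<lambda>r. real (n - 1) * \<psi> r ^ (n - 2) * deriv \<psi> r) (1 / real n)"
    by (rule cartan_hadamard_radial_weight[OF assms(2,1,3)])
  \<comment> \<open>\<open>(n - 2) / n\<close> is \<open>1 - 2 * \<kappa>\<close> for
    \<open>\<kappa> = 1 / n\<close>.\<close>
  have crit: "1 / (p + 1) + 1 / (q + 1) \<le> 1 - 2 * (1 / real n)"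
    using assms(1,6) by (simp add: diff_divide_distrib)
  show ?thesis
    unfolding globally_positive_solution_iff[OF rw assms(4,5)]
    by (rule radial_weight.shooting_region[OF rw assms(4,5) crit])
qed

end
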